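(* Fix $n\in\mathbb N$ and let $\sigma_n:[0,1]\to\mathbb R$ be a strictly increasing function, twice differentiable on $(0,1)$ with $\sigma_n'>0$ there, satisfying for every $r\in(0,\infty)$ $$1+\frac{\sigma_n''(\Psi_n(r))\, \Psi_n(r)}{\sigma_n'(\Psi_n(r))} = \frac{2}{n} - \frac{c_n}{n^2\,\Psi_n(r)}\, r^n e^{-r^2/2},$$ where $c_n^{-1} = 2^{\frac{n}{2}-1}\Gamma(n/2)$. Then for every origin-symmetric convex sets $K,L\subseteq\mathbb R^n$ and every $\lambda\in(0,1)$, $$\sigma_n\big(\gamma_n\big(\lambda K+(1-\lambda)L\big)\big) \geq \lambda\, \sigma_n(\gamma_n(K))+(1-\lambda)\,\sigma_n(\gamma_n(L)).$$
   Context: $\gamma_n$ is the standard Gaussian measure on $\mathbb R^n$ with density $(2\pi)^{-n/2}e^{-|x|^2/2}$. $\Psi_n(r)=\gamma_n(rB_2^n)$, where $rB_2^n=\{x\in\mathbb R^n: |x|\le r\}$. A set $K$ is symmetric if $K=-K$; $\lambda K+(1-\lambda)L=\{\lambda a+(1-\lambda)b: a\in K, b\in L\}$. *)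

theory Defs
  imports "HOL-Analysis.Analysis"
begin

text \<open>Standard Gaussian measure on an n-dimensional Euclidean space (n = DIM('a)),
  defined on the Lebesgue (completed) sigma-algebra so that every convex set is measurable.\<close>
definition gaussian_measure :: "'a::euclidean_space measure" where
  "gaussian_measure = density lebesgue
     (\<lambda>x. ennreal ((2 * pi) powr (- real DIM('a) / 2) * exp (- (norm x)\<^sup>2 / 2)))"

definition gamma_n :: "'a::euclidean_space set \<Rightarrow> real" where
  "gamma_n A = measure (gaussian_measure :: 'a measure) A"

definition Psi :: "'a::euclidean_space itself \<Rightarrow> real \<Rightarrow> real" where
  "Psi _ r = gamma_n (cball (0::'a) r)"

definition c_const :: "nat \<Rightarrow> real" where
  "c_const n = 1 / (2 powr (real n / 2 - 1) * Gamma (real n / 2))"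

definition minkowski_comb :: "real \<Rightarrow> 'a::real_vector set \<Rightarrow> 'a set \<Rightarrow> 'a set" where
  "minkowski_comb t K L = {t *\<^sub>R a + (1 - t) *\<^sub>R b | a b. a \<in> K \<and> b \<in> L}"

definition symmetric_set :: "'a::real_vector set \<Rightarrow> bool" where
  "symmetric_set K \<longleftrightarrow> K = uminus ` K"

end

theory Submission
  imports Defs "HOL-Probability.Probability" "HOL-Complex_Analysis.Great_Picard"
begin

text \<open>Write \<open>\<gamma>\<close> for the Gaussian measure. The heart of the matter is the inequality
  \<open>\<gamma> U * \<gamma> V \<le> (\<gamma> ((\<mu> U + V / \<mu>) / 2))\<^sup>2\<close> for symmetric convex bodies and every \<open>\<mu> > 0\<close>
  (for \<open>\<mu> = 1\<close> it is log-concavity of \<open>\<gamma>\<close>, for homothetic bodies it is the B-theorem). It is proved in the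
  functional form \<open>gint \<psi> * gint \<phi> \<le> (gint (infconv \<mu> \<psi> \<phi>))\<^sup>2\<close> for even convex potentials with bounded
  Hessian, by a rotation argument in the style of Ball and Brascamp--Lieb: the class is compact, so an extremal pair
  exists; rotating two copies of it by 45 degrees, slicing and integrating shows that both the
  self-convolved pair and the rescaled pair \<open>2 * \<psi> (x / sqrt 2)\<close> are again extremal. Self-convolution makes the
  potential twice differentiable at 0, and iterated rescaling then converges to a quadratic form, so that
  it suffices to treat Gaussians; these are handled by the arithmetic-harmonic mean iteration.

  Applied to two bodies of the path \<open>K\<^sub>u = u K + (1 - u) L\<close> the inequality reads
  \<open>\<gamma> K\<^sub>u\<^sub>-\<^sub>e * \<gamma> K\<^sub>u\<^sub>+\<^sub>e \<le> (\<gamma> (cosh \<eta> K\<^sub>v))\<^sup>2\<close> with \<open>v = u - e * tanh \<eta>\<close>, and the right-hand side only increases if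
  \<open>K\<^sub>v\<close> is replaced by the centred ball of the same measure. To second order in \<open>e\<close>, with \<open>\<eta> = e * p / n\<close> and \<open>p\<close> the
  derivative of \<open>ln (\<gamma> K\<^sub>u)\<close>, this is the differential inequality which the equation for \<open>\<sigma>\<close> turns into
  concavity of \<open>\<sigma> (\<gamma> K\<^sub>u)\<close>; lacking smoothness, it is tested against a parabola touching from below.\<close>

section \<open>Gaussian integrals\<close>

text \<open>The class of potentials is shaped by stability: slicing, self-convolution, rescaling and
  pointwise limits must stay inside it without worsening the Hessian bound \<open>A\<close>, because
  the extremal constant belongs to a fixed \<open>A\<close>. Evenness makes slices admissible: the
  rotated sections of two copies of a potential are again centred at 0. A finite \<open>A\<close>
  gives equicontinuity, hence compactness; convex bodies enter only as \<open>A\<close> tends to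
  infinity. A potential of the class need not be twice differentiable at 0, so its blow-ups need not
  have a quadratic limit. Self-convolution removes this obstacle because its second-order expansion
  involves only first derivatives.

  The equation for \<sigma> becomes transparent in logarithmic coordinates: with \<tau>(x) =
  \<sigma>(exp x) and G(y) = ln \<Psi>(exp y) it says \<tau>''(x) / \<tau>'(x) = 2/n - G'(y)/n^2 at
  x = G(y). The dilation by cosh \<eta> raises the log-radius by about \<eta>^2/2, whence the term
  with G'; the shift of the parameter by e tanh \<eta> changes ln \<gamma> by about -p e \<eta>,
  whence the term 2/n.\<close>

lemma nn_integral_lborel_affine:
  fixes f :: "'a::euclidean_space \<Rightarrow> ennreal" and c :: real
  assumes [measurable]: "f \<in> borel_measurable borel" and c: "c \<noteq> 0"
  shows "(\<integral>\<^sup>+x. f x \<partial>lborel) = ennreal (\<bar>c\<bar> ^ DIM('a)) * (\<integral>\<^sup>+x. f (t + c *\<^sub>R x) \<partial>lborel)"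
  by (subst lborel_affine[OF c, of t])
    (simp add: nn_integral_density nn_integral_distr nn_integral_cmult)

lemma nn_integral_lborel_shift:
  fixes f :: "'a::euclidean_space \<Rightarrow> ennreal"
  assumes [measurable]: "f \<in> borel_measurable borel"
  shows "(\<integral>\<^sup>+x. f (t + x) \<partial>lborel) = (\<integral>\<^sup>+x. f x \<partial>lborel)"
  using nn_integral_lborel_affine[OF assms, of 1 t] by simp

lemma nn_integral_gauss:
  "(\<integral>\<^sup>+x. ennreal (exp (- (norm x)\<^sup>2 / 2)) \<partial>(lborel :: 'a::euclidean_space measure))
     = ennreal (sqrt (2 * pi) ^ DIM('a))"
proof -
  interpret product_sigma_finite "\<lambda>b::'a. (lborel :: real measure)"
    by (simp add: product_sigma_finite_def lborel.sigma_finite_measure_axioms)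
  have one: "(\<integral>\<^sup>+x. ennreal (exp (- (x::real)\<^sup>2 / 2)) \<partial>lborel) = ennreal (sqrt (2 * pi))"
  proof -
    have "integrable lborel std_normal_density" "(\<integral>x. std_normal_density x \<partial>lborel) = 1"
      by (auto intro: integral_normal_density)
    then have "(\<integral>\<^sup>+x. ennreal (std_normal_density x) \<partial>lborel) = 1"
      by (subst nn_integral_eq_integral) auto
    moreover have "(\<integral>\<^sup>+x. ennreal (exp (- (x::real)\<^sup>2 / 2)) \<partial>lborel)
        = (\<integral>\<^sup>+x. ennreal (sqrt (2 * pi)) * ennreal (std_normal_density x) \<partial>lborel)"
      by (intro nn_integral_cong) (simp add: std_normal_density_def ennreal_mult[symmetric])
    ultimately show ?thesis by (simp add: nn_integral_cmult)
  qed
  have "(\<integral>\<^sup>+x. ennreal (exp (- (norm x)\<^sup>2 / 2)) \<partial>(lborel :: 'a measure))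
     = (\<integral>\<^sup>+f. ennreal (exp (- (norm (\<Sum>b\<in>Basis. f b *\<^sub>R b :: 'a))\<^sup>2 / 2)) \<partial>(\<Pi>\<^sub>M b\<in>(Basis::'a set). lborel))"
    by (subst lborel_eq, subst nn_integral_distr) auto
  also have "\<dots> = (\<integral>\<^sup>+f. (\<Prod>b\<in>Basis. ennreal (exp (- (f b)\<^sup>2 / 2))) \<partial>(\<Pi>\<^sub>M b\<in>(Basis::'a set). lborel))"
  proof (intro nn_integral_cong)
    fix f :: "'a \<Rightarrow> real"
    have "(norm (\<Sum>b\<in>Basis. f b *\<^sub>R b :: 'a))\<^sup>2 = (\<Sum>b\<in>(Basis::'a set). (f b)\<^sup>2)"
      unfolding norm_eq_sqrt_inner
      by (subst real_sqrt_pow2, simp, subst euclidean_inner) (simp add: power2_eq_square)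
    then show "ennreal (exp (- (norm (\<Sum>b\<in>Basis. f b *\<^sub>R b :: 'a))\<^sup>2 / 2)) = (\<Prod>b\<in>(Basis::'a set). ennreal (exp (- (f b)\<^sup>2 / 2)))"
      by (simp add: prod_ennreal exp_sum[symmetric] sum_negf sum_divide_distrib)
  qed
  also have "\<dots> = (\<Prod>b\<in>(Basis::'a set). (\<integral>\<^sup>+x. ennreal (exp (- x\<^sup>2 / 2)) \<partial>lborel))"
    by (rule product_nn_integral_prod) auto
  also have "\<dots> = ennreal (sqrt (2 * pi) ^ DIM('a))"
    using one by (simp add: ennreal_power)
  finally show ?thesis .
qed

lemma integrable_gauss: "integrable lborel (\<lambda>x::'a::euclidean_space. exp (- (norm x)\<^sup>2 / 2))"
  by (rule integrableI_nonneg) (simp_all only: nn_integral_gauss, auto)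

lemma integral_gauss: "(\<integral>x. exp (- (norm x)\<^sup>2 / 2) \<partial>(lborel :: 'a::euclidean_space measure)) = sqrt (2 * pi) ^ DIM('a)"
  by (rule integral_eq_nn_integral[THEN trans]) (simp_all only: nn_integral_gauss, auto)

lemma integrable_gauss_scaled:
  assumes c: "c > 0"
  shows "integrable lborel (\<lambda>x::'a::euclidean_space. exp (- c * (norm x)\<^sup>2))"
proof (rule integrableI_nonneg)
  let ?k = "1 / sqrt (2 * c)"
  have k: "?k \<noteq> 0" using c by simp
  have *: "- c * (norm (0 + ?k *\<^sub>R x))\<^sup>2 = - (norm x)\<^sup>2 / 2" for x :: 'a
    using c by (simp add: power_mult_distrib power_divide)
  have "(\<integral>\<^sup>+x. ennreal (exp (- c * (norm x)\<^sup>2)) \<partial>(lborel::'a measure))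
      = ennreal (\<bar>?k\<bar> ^ DIM('a)) * (\<integral>\<^sup>+x. ennreal (exp (- (norm x)\<^sup>2 / 2)) \<partial>(lborel::'a measure))"
    by (subst nn_integral_lborel_affine[OF _ k, where t = 0]) (simp_all only: *, simp_all)
  also have "\<dots> < \<infinity>" unfolding nn_integral_gauss by (simp add: ennreal_mult[symmetric])
  finally show "(\<integral>\<^sup>+x. ennreal (exp (- c * (norm x)\<^sup>2)) \<partial>(lborel::'a measure)) < \<infinity>" .
qed auto

text \<open>The rotation of the product space is factored into two substitutions, each affine in one
  variable with the other fixed, with Fubini in between. The Jacobian
  \<open>sqrt 2 ^ DIM('a)\<close> produced by the first is absorbed by the second.\<close>

lemma nn_integral_rotate:
  fixes G :: "'a::euclidean_space \<Rightarrow> 'a \<Rightarrow> ennreal"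
  assumes G: "case_prod G \<in> borel_measurable (borel \<Otimes>\<^sub>M borel)"
  shows "(\<integral>\<^sup>+x. (\<integral>\<^sup>+y. G ((1 / sqrt 2) *\<^sub>R (y + x)) ((1 / sqrt 2) *\<^sub>R (y - x)) \<partial>lborel) \<partial>lborel)
     = (\<integral>\<^sup>+x. (\<integral>\<^sup>+y. G x y \<partial>lborel) \<partial>lborel)"
proof -
  have Gm1: "(\<lambda>t. G (f t) (g t)) \<in> borel_measurable borel"
    if "f \<in> borel_measurable borel" "g \<in> borel_measurable borel" for f g :: "'a \<Rightarrow> 'a"
    using measurable_compose[OF measurable_Pair[OF that] G] by simp
  have Gm2: "(\<lambda>t. G (f t) (g t)) \<in> borel_measurable (borel \<Otimes>\<^sub>M borel)"
    if "f \<in> borel_measurable (borel \<Otimes>\<^sub>M borel)" "g \<in> borel_measurable (borel \<Otimes>\<^sub>M borel)" for f g :: "'a \<times> 'a \<Rightarrow> 'a"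
    using measurable_compose[OF measurable_Pair[OF that] G] by simp
  have Gp: "case_prod (\<lambda>x s. G s (s - c *\<^sub>R x)) \<in> borel_measurable (lborel \<Otimes>\<^sub>M lborel)" 
       "case_prod (\<lambda>s x. G s (s - c *\<^sub>R x)) \<in> borel_measurable (lborel \<Otimes>\<^sub>M lborel)" for c
    using Gm2[of snd "\<lambda>p. snd p - c *\<^sub>R fst p"] Gm2[of fst "\<lambda>p. fst p - c *\<^sub>R snd p"]
    by (simp_all add: case_prod_beta' cong: measurable_cong_sets)
  have "(\<integral>\<^sup>+x. (\<integral>\<^sup>+y. G ((1 / sqrt 2) *\<^sub>R (y + x)) ((1 / sqrt 2) *\<^sub>R (y - x)) \<partial>lborel) \<partial>lborel)
    = (\<integral>\<^sup>+x. ennreal (sqrt 2 ^ DIM('a)) * (\<integral>\<^sup>+s. G s (s - sqrt 2 *\<^sub>R x) \<partial>lborel) \<partial>lborel)"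
  proof (intro nn_integral_cong)
    fix x :: 'a
    have eq: "(1 / sqrt 2) *\<^sub>R ((- x + sqrt 2 *\<^sub>R s) - x) = s - sqrt 2 *\<^sub>R x" for s
    proof -
      have "(1 / sqrt 2) *\<^sub>R ((- x + sqrt 2 *\<^sub>R s) - x) = s - (2 / sqrt 2) *\<^sub>R x"
        by (simp add: algebra_simps scaleR_2[symmetric])
      then show ?thesis by (simp add: real_div_sqrt)
    qed
    have "(\<integral>\<^sup>+y. G ((1 / sqrt 2) *\<^sub>R (y + x)) ((1 / sqrt 2) *\<^sub>R (y - x)) \<partial>lborel)
      = ennreal (\<bar>sqrt 2\<bar> ^ DIM('a)) * (\<integral>\<^sup>+s. G ((1 / sqrt 2) *\<^sub>R ((- x + sqrt 2 *\<^sub>R s) + x)) ((1 / sqrt 2) *\<^sub>R ((- x + sqrt 2 *\<^sub>R s) - x)) \<partial>lborel)"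
      using nn_integral_lborel_affine[OF Gm1[of "\<lambda>y. (1 / sqrt 2) *\<^sub>R (y + x)" "\<lambda>y. (1 / sqrt 2) *\<^sub>R (y - x)"], of "sqrt 2" "- x"]
      by measurable
    then show "(\<integral>\<^sup>+y. G ((1 / sqrt 2) *\<^sub>R (y + x)) ((1 / sqrt 2) *\<^sub>R (y - x)) \<partial>lborel)
      = ennreal (sqrt 2 ^ DIM('a)) * (\<integral>\<^sup>+s. G s (s - sqrt 2 *\<^sub>R x) \<partial>lborel)"
      unfolding eq by simp
  qed
  also have "\<dots> = ennreal (sqrt 2 ^ DIM('a)) * (\<integral>\<^sup>+x. (\<integral>\<^sup>+s. G s (s - sqrt 2 *\<^sub>R x) \<partial>lborel) \<partial>lborel)"
    by (rule nn_integral_cmult, rule lborel.borel_measurable_nn_integral, rule Gp)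
  also have "(\<integral>\<^sup>+x. (\<integral>\<^sup>+s. G s (s - sqrt 2 *\<^sub>R x) \<partial>lborel) \<partial>lborel) = (\<integral>\<^sup>+s. (\<integral>\<^sup>+x. G s (s - sqrt 2 *\<^sub>R x) \<partial>lborel) \<partial>lborel)"
    by (rule lborel_pair.Fubini', rule Gp)
  also have "ennreal (sqrt 2 ^ DIM('a)) * \<dots> = (\<integral>\<^sup>+s. ennreal (sqrt 2 ^ DIM('a)) * (\<integral>\<^sup>+x. G s (s - sqrt 2 *\<^sub>R x) \<partial>lborel) \<partial>lborel)"
    by (rule nn_integral_cmult[symmetric], rule lborel.borel_measurable_nn_integral, rule Gp)
  also have "\<dots> = (\<integral>\<^sup>+s. (\<integral>\<^sup>+x. G s x \<partial>lborel) \<partial>lborel)"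
  proof (intro nn_integral_cong)
    fix s :: 'a
    have "(\<integral>\<^sup>+x. G s x \<partial>lborel) = ennreal (\<bar>- sqrt 2\<bar> ^ DIM('a)) * (\<integral>\<^sup>+x. G s (s + (- sqrt 2) *\<^sub>R x) \<partial>lborel)"
      using nn_integral_lborel_affine[OF Gm1[of "\<lambda>y. s" "\<lambda>y. y"], of "- sqrt 2" s] by measurable
    then show "ennreal (sqrt 2 ^ DIM('a)) * (\<integral>\<^sup>+x. G s (s - sqrt 2 *\<^sub>R x) \<partial>lborel) = (\<integral>\<^sup>+x. G s x \<partial>lborel)"
      by simp
  qed
  finally show ?thesis .
qed

section \<open>The Prekopa--Leindler inequality\<close>

lemma emeasure_lborel_preimage_half:
  fixes S :: "real set"
  assumes [measurable]: "S \<in> sets borel"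
  shows "emeasure lborel {x. (x + b) / 2 \<in> S} = 2 * emeasure lborel S"
proof -
  have "(\<integral>\<^sup>+x. indicator S x \<partial>(lborel::real measure)) = ennreal (1 / 2) * (\<integral>\<^sup>+x. indicator S (b / 2 + (1 / 2) *\<^sub>R x) \<partial>lborel)"
    using nn_integral_lborel_affine[of "indicator S" "1/2" "b/2"] by simp
  also have "(\<lambda>x. indicator S (b / 2 + (1 / 2) *\<^sub>R x)) = (indicator {x. (x + b) / 2 \<in> S} :: real \<Rightarrow> ennreal)"
    by (auto simp: fun_eq_iff indicator_def add_divide_distrib add.commute)
  finally have "emeasure lborel S = ennreal (1/2) * emeasure lborel {x. (x + b) / 2 \<in> S}"
    by (subst (asm) (1 2) nn_integral_indicator) auto
  then have "2 * emeasure lborel S = (ennreal 2 * ennreal (1/2)) * emeasure lborel {x. (x + b) / 2 \<in> S}"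
    by (simp add: mult.assoc)
  also have "ennreal 2 * ennreal (1/2) = 1" by (subst ennreal_mult[symmetric]) auto
  finally show ?thesis by simp
qed

text \<open>Freezing one endpoint places halved copies of both pieces in \<open>D\<close>: the
  points \<open>(x + b) / 2\<close> with \<open>x \<le> a\<close> lie to the left of
  \<open>?m\<close>, the points \<open>(a + y) / 2\<close> with \<open>y > b\<close> to its right,
  so their measures add. The single point \<open>b\<close> is discarded because both copies would
  contain \<open>?m\<close>.\<close>

lemma brunn_minkowski_real_split:
  fixes A B D :: "real set"
  assumes [measurable]: "A \<in> sets borel" "B \<in> sets borel" "D \<in> sets borel"
    and ab: "a \<in> A" "b \<in> B" and D: "\<And>x y. x \<in> A \<Longrightarrow> y \<in> B \<Longrightarrow> (x + y) / 2 \<in> D"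
  shows "emeasure lborel (A \<inter> {..a}) + emeasure lborel (B \<inter> {b..}) \<le> 2 * emeasure lborel D"
proof -
  let ?m = "(a + b) / 2"
  have "emeasure lborel (A \<inter> {..a}) \<le> emeasure lborel {x. (x + b) / 2 \<in> D \<inter> {..?m}}"
    using ab D by (intro emeasure_mono) auto
  then have 1: "emeasure lborel (A \<inter> {..a}) \<le> 2 * emeasure lborel (D \<inter> {..?m})"
    by (subst (asm) emeasure_lborel_preimage_half) auto
  have "emeasure lborel (B \<inter> {b..}) \<le> emeasure lborel ((B \<inter> {b<..}) \<union> {b})"
    by (intro emeasure_mono) auto
  also have "\<dots> \<le> emeasure lborel (B \<inter> {b<..}) + emeasure lborel {b}"
    by (intro emeasure_subadditive) auto
  also have "\<dots> = emeasure lborel (B \<inter> {b<..})" by simp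
  also have "\<dots> \<le> emeasure lborel {x. (x + a) / 2 \<in> D \<inter> {?m<..}}"
    using ab D[OF ab(1)] by (intro emeasure_mono) (auto simp: add.commute)
  finally have 2: "emeasure lborel (B \<inter> {b..}) \<le> 2 * emeasure lborel (D \<inter> {?m<..})"
    by (subst (asm) emeasure_lborel_preimage_half) auto
  have "emeasure lborel (D \<inter> {..?m}) + emeasure lborel (D \<inter> {?m<..}) = emeasure lborel ((D \<inter> {..?m}) \<union> (D \<inter> {?m<..}))"
    by (intro plus_emeasure) auto
  also have "(D \<inter> {..?m}) \<union> (D \<inter> {?m<..}) = D" by auto
  finally show ?thesis using add_mono[OF 1 2] by (simp add: distrib_left[symmetric])
qed

text \<open>\<open>Sup A\<close> and \<open>Inf B\<close> need not be attained. Points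
  \<open>a\<close> and \<open>b\<close> within \<open>e / 2\<close> of them cut off pieces of
  measure at most \<open>e / 2\<close> each, and the split version handles the rest.\<close>

lemma brunn_minkowski_real_bounded:
  fixes A B D :: "real set"
  assumes [measurable]: "A \<in> sets borel" "B \<in> sets borel" "D \<in> sets borel"
    and ne: "A \<noteq> {}" "B \<noteq> {}" and bdd: "bounded A" "bounded B"
    and D: "\<And>x y. x \<in> A \<Longrightarrow> y \<in> B \<Longrightarrow> (x + y) / 2 \<in> D"
  shows "emeasure lborel A + emeasure lborel B \<le> 2 * emeasure lborel D"
proof (rule ennreal_le_epsilon)
  fix e :: real assume e: "0 < e"
  have bA: "bdd_above A" and bB: "bdd_below B" using bdd bounded_imp_bdd_above bounded_imp_bdd_below by auto
  obtain a where a: "a \<in> A" "Sup A - e / 2 < a" using less_cSupE[of "Sup A - e / 2" A] ne e by auto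
  obtain b where b: "b \<in> B" "b < Inf B + e / 2" using cInf_lessD[of B "Inf B + e / 2"] ne e by auto
  have "emeasure lborel A \<le> emeasure lborel ((A \<inter> {..a}) \<union> {a .. Sup A})"
    using cSup_upper[OF _ bA] by (intro emeasure_mono) auto
  also have "\<dots> \<le> emeasure lborel (A \<inter> {..a}) + emeasure lborel {a .. Sup A}"
    by (intro emeasure_subadditive) auto
  also have "emeasure lborel {a .. Sup A} \<le> ennreal (e / 2)"
    using a cSup_upper[OF a(1) bA] by (simp add: ennreal_leI)
  finally have 1: "emeasure lborel A \<le> emeasure lborel (A \<inter> {..a}) + ennreal (e / 2)" by (simp add: add_left_mono)
  have "emeasure lborel B \<le> emeasure lborel ((B \<inter> {b..}) \<union> {Inf B .. b})"
    using cInf_lower[OF _ bB] by (intro emeasure_mono) auto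
  also have "\<dots> \<le> emeasure lborel (B \<inter> {b..}) + emeasure lborel {Inf B .. b}"
    by (intro emeasure_subadditive) auto
  also have "emeasure lborel {Inf B .. b} \<le> ennreal (e / 2)"
    using b cInf_lower[OF b(1) bB] by (simp add: ennreal_leI)
  finally have 2: "emeasure lborel B \<le> emeasure lborel (B \<inter> {b..}) + ennreal (e / 2)" by (simp add: add_left_mono)
  have "emeasure lborel A + emeasure lborel B
     \<le> (emeasure lborel (A \<inter> {..a}) + emeasure lborel (B \<inter> {b..})) + (ennreal (e / 2) + ennreal (e / 2))"
    using add_mono[OF 1 2] by (simp add: ac_simps)
  also have "ennreal (e / 2) + ennreal (e / 2) = ennreal e" using e by (subst ennreal_plus[symmetric]) auto
  finally show "emeasure lborel A + emeasure lborel B \<le> 2 * emeasure lborel D + ennreal e"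
    using brunn_minkowski_real_split[OF assms(1-3) a(1) b(1) D] by (meson add_right_mono order_trans)
qed

lemma emeasure_SUP_inter_Icc:
  fixes A :: "real set"
  assumes [measurable]: "A \<in> sets borel"
  shows "emeasure lborel A = (SUP n. emeasure lborel (A \<inter> {- real n .. real n}))"
proof -
  have "(SUP n. emeasure lborel (A \<inter> {- real n .. real n})) = emeasure lborel (\<Union>n. A \<inter> {- real n .. real n})"
    by (intro SUP_emeasure_incseq) (auto simp: incseq_def)
  also have "(\<Union>n. A \<inter> {- real n .. real n}) = A"
  proof -
    have "\<exists>n. - real n \<le> x \<and> x \<le> real n" for x :: real
    proof -
      obtain n where "\<bar>x\<bar> \<le> real n" using real_arch_simple by blast
      then show ?thesis by (intro exI[of _ n]) linarith
    qed
    then show ?thesis by auto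
  qed
  finally show ?thesis by simp
qed

lemma brunn_minkowski_real:
  fixes A B D :: "real set"
  assumes [measurable]: "A \<in> sets borel" "B \<in> sets borel" "D \<in> sets borel"
    and ne: "A \<noteq> {}" "B \<noteq> {}"
    and D: "\<And>x y. x \<in> A \<Longrightarrow> y \<in> B \<Longrightarrow> (x + y) / 2 \<in> D"
  shows "emeasure lborel A + emeasure lborel B \<le> 2 * emeasure lborel D"
proof -
  obtain a b where ab: "a \<in> A" "b \<in> B" using ne by blast
  obtain N where N: "\<bar>a\<bar> \<le> real N" "\<bar>b\<bar> \<le> real N"
    using real_arch_simple[of "max \<bar>a\<bar> \<bar>b\<bar>"] by auto
  let ?A = "\<lambda>n. emeasure lborel (A \<inter> {- real n .. real n})" and ?B = "\<lambda>n. emeasure lborel (B \<inter> {- real n .. real n})"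
  have *: "?A n + ?B n \<le> 2 * emeasure lborel D" for n
  proof -
    \<comment> \<open>Enlarging the window to \<open>max n N\<close> keeps both truncated sets
      nonempty, as the bounded case requires.\<close>
    have "?A n + ?B n \<le> ?A (max n N) + ?B (max n N)"
      by (intro add_mono emeasure_mono) auto
    also have "\<dots> \<le> 2 * emeasure lborel D"
    proof (rule brunn_minkowski_real_bounded)
      show "A \<inter> {- real (max n N)..real (max n N)} \<noteq> {}" "B \<inter> {- real (max n N)..real (max n N)} \<noteq> {}"
        using ab N by (auto simp: max_def abs_le_iff intro!: exI[of _ a] exI[of _ b])
    qed (use D in \<open>auto intro: bounded_subset[OF bounded_closed_interval]\<close>)
    finally show ?thesis .
  qed
  have "emeasure lborel A + emeasure lborel B = (SUP n. ?A n + ?B n)"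
    unfolding emeasure_SUP_inter_Icc[OF assms(1)] emeasure_SUP_inter_Icc[OF assms(2)]
    by (rule ennreal_SUP_add[symmetric]) (auto simp: incseq_def intro!: emeasure_mono)
  also have "\<dots> \<le> 2 * emeasure lborel D" using * by (rule SUP_least)
  finally show ?thesis .
qed

section \<open>Prekopa--Leindler on the line, by integration over superlevel sets\<close>

lemma emeasure_lborel_positive_below:
  "emeasure lborel {c::real. 0 < c \<and> ennreal c < u} = u"
proof (cases u)
  case (real r)
  then have "{c. 0 < c \<and> ennreal c < u} = {0<..<r}" by (auto simp: ennreal_less_iff)
  then show ?thesis using real by simp
next
  case top
  have "emeasure lborel {0::real<..} = \<infinity>"
  proof (rule ccontr)
    assume "emeasure lborel {0::real<..} \<noteq> \<infinity>"
    then obtain r where r: "emeasure lborel {0::real<..} = ennreal r" "r \<ge> 0"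
      by (cases "emeasure lborel {0::real<..}") auto
    have "emeasure lborel {0<..r + 1} \<le> emeasure lborel {0::real<..}" by (intro emeasure_mono) auto
    then show False using r by (simp add: ennreal_le_iff)
  qed
  moreover have "{c::real. 0 < c \<and> ennreal c < u} = {0<..}" using top by auto
  ultimately show ?thesis using top by simp
qed

lemma nn_integral_layer_cake:
  fixes u :: "real \<Rightarrow> ennreal"
  assumes [measurable]: "u \<in> borel_measurable borel"
  shows "(\<integral>\<^sup>+x. u x \<partial>lborel) = (\<integral>\<^sup>+c. indicator {0<..} c * emeasure lborel {x. ennreal c < u x} \<partial>lborel)"
proof -
  define S where "S = {p. 0 < fst p \<and> ennreal (fst p) < u (snd p)}"
  have S[measurable]: "S \<in> sets (borel \<Otimes>\<^sub>M borel)" 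
  proof -
    have "{p \<in> space (borel \<Otimes>\<^sub>M borel). 0 < fst p \<and> ennreal (fst p) < u (snd p)} \<in> sets (borel \<Otimes>\<^sub>M borel)"
      by measurable
    then show ?thesis by (simp add: S_def space_pair_measure)
  qed
  have 1: "u x = (\<integral>\<^sup>+c. indicator S (c, x) \<partial>lborel)" for x
  proof -
    have "(\<integral>\<^sup>+c. indicator S (c, x) \<partial>lborel) = (\<integral>\<^sup>+c. indicator {c. 0 < c \<and> ennreal c < u x} c \<partial>lborel)"
      by (rule nn_integral_cong) (simp add: indicator_def S_def)
    also have "\<dots> = emeasure lborel {c. 0 < c \<and> ennreal c < u x}"
    proof (rule nn_integral_indicator)
      have "{c \<in> space (borel::real measure). 0 < c \<and> ennreal c < u x} \<in> sets borel" by measurable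
      then show "{c. 0 < c \<and> ennreal c < u x} \<in> sets lborel" by (simp only: space_borel UNIV_I simp_thms sets_lborel)
    qed
    also have "\<dots> = u x" by (rule emeasure_lborel_positive_below)
    finally show ?thesis by (rule sym)
  qed
  have 2: "(\<integral>\<^sup>+x. indicator S (c, x) \<partial>lborel) = indicator {0<..} c * emeasure lborel {x. ennreal c < u x}" for c
  proof -
    have "(\<integral>\<^sup>+x. indicator S (c, x) \<partial>lborel) = (\<integral>\<^sup>+x. indicator {0<..} c * indicator {x. ennreal c < u x} x \<partial>lborel)"
      by (rule nn_integral_cong) (simp add: indicator_def S_def)
    also have "\<dots> = indicator {0<..} c * emeasure lborel {x. ennreal c < u x}"
    proof (rule nn_integral_cmult_indicator)
      have "{x \<in> space (borel::real measure). ennreal c < u x} \<in> sets borel" by measurable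
      then show "{x. ennreal c < u x} \<in> sets lborel" by (simp only: space_borel UNIV_I simp_thms sets_lborel)
    qed
    finally show ?thesis .
  qed
  have "(\<integral>\<^sup>+x. (\<integral>\<^sup>+c. indicator S (c, x) \<partial>lborel) \<partial>lborel) = (\<integral>\<^sup>+c. (\<integral>\<^sup>+x. indicator S (c, x) \<partial>lborel) \<partial>lborel)"
    by (rule lborel_pair.Fubini') (use S in \<open>simp add: case_prod_beta' cong: measurable_cong_sets\<close>)
  then show ?thesis by (simp only: 1[symmetric] 2)
qed

lemma ennreal_less_of_mult_le_square:
  fixes a b h :: ennreal
  assumes "ennreal c < a" "ennreal c < b" and le: "a * b \<le> h\<^sup>2" and c: "0 < c"
  shows "ennreal c < h"
proof (cases "h = \<top>")
  case False
  then obtain r where r: "h = ennreal r" "0 \<le> r" by (cases h) auto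
  have "0 < a" "0 < b" using assms(1,2) by (auto intro: le_less_trans[OF zero_le])
  moreover have "a * b \<noteq> \<top>" using le r by (auto simp: ennreal_power top_unique)
  ultimately have "a \<noteq> \<top>" "b \<noteq> \<top>" by (auto simp: ennreal_mult_eq_top_iff)
  then obtain x y where xy: "a = ennreal x" "0 \<le> x" "b = ennreal y" "0 \<le> y" by (cases a; cases b) auto
  have "c * c < x * y" using assms(1,2) xy c by (intro mult_strict_mono) (auto simp: ennreal_less_iff)
  also have "x * y \<le> r\<^sup>2"
    using le xy r by (simp add: ennreal_mult[symmetric] ennreal_power ennreal_le_iff)
  finally have "c\<^sup>2 < r\<^sup>2" by (simp only: power2_eq_square)
  then have "c < r" using r(2) by (rule power_less_imp_less_base)
  then show ?thesis using r c by (simp add: ennreal_less_iff)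
qed (simp add: less_top[symmetric])

text \<open>Equal suprema make the superlevel sets of \<open>u\<close> and \<open>v\<close> at a
  given height both nonempty or both empty. In the first case Brunn--Minkowski applies to them and
  to the superlevel set of \<open>h\<close>; in the second there is nothing to prove. Integration
  over the height yields an additive bound, stronger than the product bound.\<close>

lemma prekopa_leindler_normalized:
  fixes u v h :: "real \<Rightarrow> ennreal"
  assumes [measurable]: "u \<in> borel_measurable borel" "v \<in> borel_measurable borel" "h \<in> borel_measurable borel"
    and le: "\<And>x y. u x * v y \<le> (h ((x + y) / 2))\<^sup>2" and sup: "(SUP x. u x) = (SUP x. v x)"
  shows "(\<integral>\<^sup>+x. u x \<partial>lborel) + (\<integral>\<^sup>+x. v x \<partial>lborel) \<le> 2 * (\<integral>\<^sup>+x. h x \<partial>lborel)"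
proof -
  have "emeasure lborel {x. ennreal c < u x} + emeasure lborel {x. ennreal c < v x} \<le> 2 * emeasure lborel {x. ennreal c < h x}"
    if c: "0 < c" for c
  proof (cases "ennreal c < (SUP x. u x)")
    case True
    show ?thesis
    proof (rule brunn_minkowski_real)
      show "{x. ennreal c < u x} \<noteq> {}" using True by (auto simp: less_SUP_iff)
      show "{x. ennreal c < v x} \<noteq> {}" using True unfolding sup by (auto simp: less_SUP_iff)
      fix x y assume "x \<in> {x. ennreal c < u x}" "y \<in> {x. ennreal c < v x}"
      then show "(x + y) / 2 \<in> {x. ennreal c < h x}"
        using ennreal_less_of_mult_le_square[OF _ _ le[of x y]] c by auto
    qed measurable
  next
    case False
    then have "\<not> ennreal c < u x" "\<not> ennreal c < v x" for x
      using less_le_trans[OF _ SUP_upper[of x UNIV u]] less_le_trans[OF _ SUP_upper[of x UNIV v]] sup by auto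
    then show ?thesis by simp
  qed
  then have "(\<integral>\<^sup>+c. indicator {0<..} c * emeasure lborel {x. ennreal c < u x} + indicator {0<..} c * emeasure lborel {x. ennreal c < v x} \<partial>lborel)
    \<le> (\<integral>\<^sup>+c. 2 * (indicator {0<..} c * emeasure lborel {x. ennreal c < h x}) \<partial>lborel)"
    by (intro nn_integral_mono) (auto simp: indicator_def)
  then show ?thesis
    unfolding nn_integral_layer_cake[OF assms(1)] nn_integral_layer_cake[OF assms(2)] nn_integral_layer_cake[OF assms(3)]
    by (subst (asm) nn_integral_add, simp, simp, subst (asm) nn_integral_cmult, simp)
qed

lemma ennreal_am_gm:
  fixes a b H :: ennreal
  assumes "a + b \<le> 2 * H" shows "a * b \<le> H\<^sup>2"
proof (cases H)
  case (real h)
  then have "a + b < \<top>" using assms by (metis ennreal_mult_less_top ennreal_less_top ennreal_numeral le_less_trans)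
  then obtain x y where xy: "a = ennreal x" "b = ennreal y" "0 \<le> x" "0 \<le> y"
    by (cases a; cases b) auto
  have "ennreal (x + y) \<le> ennreal (2 * h)" using assms xy real by (simp add: ennreal_mult ennreal_plus)
  then have le: "x + y \<le> 2 * h" using real by (simp add: ennreal_le_iff)
  have "4 * (x * y) = (x + y)\<^sup>2 - (x - y)\<^sup>2" by (simp add: power2_eq_square algebra_simps)
  also have "\<dots> \<le> (2 * h)\<^sup>2" using power_mono[OF le, of 2] xy zero_le_power2[of "x - y"] by linarith
  finally have "x * y \<le> h\<^sup>2" by (simp add: power_mult_distrib)
  then show ?thesis using xy real by (simp add: ennreal_mult[symmetric] ennreal_power ennreal_leI)
qed simp

text \<open>Multiplying \<open>u\<close> by \<open>a\<close> and \<open>v\<close> by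
  \<open>1 / a\<close> leaves the hypothesis and the product of the integrals unchanged;
  \<open>a\<close> is chosen to equalise the suprema. The normalised case then gives a bound for a
  sum, and the arithmetic-geometric mean inequality one for the product.\<close>

lemma prekopa_leindler_bounded:
  fixes u v h :: "real \<Rightarrow> ennreal"
  assumes [measurable]: "u \<in> borel_measurable borel" "v \<in> borel_measurable borel" "h \<in> borel_measurable borel"
    and le: "\<And>x y. u x * v y \<le> (h ((x + y) / 2))\<^sup>2"
    and fin: "(SUP x. u x) < \<top>" "(SUP x. v x) < \<top>"
  shows "(\<integral>\<^sup>+x. u x \<partial>lborel) * (\<integral>\<^sup>+x. v x \<partial>lborel) \<le> (\<integral>\<^sup>+x. h x \<partial>lborel)\<^sup>2"
proof (cases "(SUP x. u x) = 0 \<or> (SUP x. v x) = 0")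
  case True
  then have "(\<forall>x. u x = 0) \<or> (\<forall>x. v x = 0)" by (auto simp: SUP_eq_iff bot_ennreal[symmetric] simp del: bot_ennreal)
  then show ?thesis by auto
next
  case False
  then obtain U V where UV: "(SUP x. u x) = ennreal U" "(SUP x. v x) = ennreal V" "0 < U" "0 < V"
    using fin by (cases "SUP x. u x"; cases "SUP x. v x") (auto simp: less_le)
  define a where "a = sqrt (V / U)"
  have a: "0 < a" using UV by (simp add: a_def)
  have aU: "a * U = (1 / a) * V"
  proof -
    have "a * a = V / U" using UV by (simp add: a_def)
    then show ?thesis using a UV by (simp add: field_simps)
  qed
  have one: "ennreal a * ennreal (1 / a) = 1" using a by (simp add: ennreal_mult[symmetric])
  have "(\<integral>\<^sup>+x. ennreal a * u x \<partial>lborel) + (\<integral>\<^sup>+x. ennreal (1 / a) * v x \<partial>lborel) \<le> 2 * (\<integral>\<^sup>+x. h x \<partial>lborel)"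
  proof (rule prekopa_leindler_normalized)
    fix x y
    have "ennreal a * u x * (ennreal (1 / a) * v y) = (ennreal a * ennreal (1 / a)) * (u x * v y)"
      by (simp only: ac_simps)
    then show "ennreal a * u x * (ennreal (1 / a) * v y) \<le> (h ((x + y) / 2))\<^sup>2" using le[of x y] by (simp only: one) simp
  next
    show "(SUP x. ennreal a * u x) = (SUP x. ennreal (1 / a) * v x)"
      unfolding SUP_mult_left_ennreal[symmetric] UV using a UV aU by (simp add: ennreal_mult[symmetric])
  qed measurable
  then have "(ennreal a * (\<integral>\<^sup>+x. u x \<partial>lborel)) * (ennreal (1 / a) * (\<integral>\<^sup>+x. v x \<partial>lborel)) \<le> (\<integral>\<^sup>+x. h x \<partial>lborel)\<^sup>2"
    by (intro ennreal_am_gm) (simp add: nn_integral_cmult)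
  also have "(ennreal a * (\<integral>\<^sup>+x. u x \<partial>lborel)) * (ennreal (1 / a) * (\<integral>\<^sup>+x. v x \<partial>lborel))
     = (ennreal a * ennreal (1 / a)) * ((\<integral>\<^sup>+x. u x \<partial>lborel) * (\<integral>\<^sup>+x. v x \<partial>lborel))"
    by (simp only: ac_simps)
  finally show ?thesis by (simp only: one) simp
qed

lemma nn_integral_SUP_min:
  fixes u :: "real \<Rightarrow> ennreal"
  assumes [measurable]: "u \<in> borel_measurable borel"
  shows "(\<integral>\<^sup>+x. u x \<partial>lborel) = (SUP k. \<integral>\<^sup>+x. min (u x) (of_nat k) \<partial>lborel)"
proof -
  have "(SUP k. min (u x) (of_nat k)) = u x" for x
  proof (rule antisym)
    show "(SUP k. min (u x) (of_nat k)) \<le> u x" by (rule SUP_least) simp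
    have "(SUP k. min (u x) (of_nat k)) = min (u x) (SUP k. of_nat k)"
      by (simp add: inf_min[symmetric] inf_SUP)
    also have "(SUP k. of_nat k :: ennreal) = \<top>" by (rule ennreal_SUP_of_nat_eq_top)
    finally show "u x \<le> (SUP k. min (u x) (of_nat k))" by simp
  qed
  then have "(\<integral>\<^sup>+x. u x \<partial>lborel) = (\<integral>\<^sup>+x. (SUP k. min (u x) (of_nat k)) \<partial>lborel)" by simp
  also have "\<dots> = (SUP k. \<integral>\<^sup>+x. min (u x) (of_nat k) \<partial>lborel)"
    by (intro nn_integral_monotone_convergence_SUP) (auto simp: incseq_def le_fun_def intro: order_trans[OF min.cobounded2] of_nat_mono)
  finally show ?thesis .
qed

lemma prekopa_leindler_real:
  fixes u v h :: "real \<Rightarrow> ennreal"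
  assumes [measurable]: "u \<in> borel_measurable borel" "v \<in> borel_measurable borel" "h \<in> borel_measurable borel"
    and le: "\<And>x y. u x * v y \<le> (h ((x + y) / 2))\<^sup>2"
  shows "(\<integral>\<^sup>+x. u x \<partial>lborel) * (\<integral>\<^sup>+x. v x \<partial>lborel) \<le> (\<integral>\<^sup>+x. h x \<partial>lborel)\<^sup>2"
proof -
  have fin: "(SUP x. min (w x) (of_nat k)) < \<top>" for w :: "real \<Rightarrow> ennreal" and k
    by (rule le_less_trans[of _ "of_nat k"]) (auto intro!: SUP_least simp: of_nat_less_top)
  have "(\<integral>\<^sup>+x. min (u x) (of_nat k) \<partial>lborel) * (\<integral>\<^sup>+x. min (v x) (of_nat j) \<partial>lborel) \<le> (\<integral>\<^sup>+x. h x \<partial>lborel)\<^sup>2" for k j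
  proof (rule prekopa_leindler_bounded)
    fix x y
    have "min (u x) (of_nat k) * min (v y) (of_nat j) \<le> u x * v y" by (intro mult_mono) auto
    also note le
    finally show "min (u x) (of_nat k) * min (v y) (of_nat j) \<le> (h ((x + y) / 2))\<^sup>2" .
  qed (auto intro: fin)
  then show ?thesis
    unfolding nn_integral_SUP_min[OF assms(1)] nn_integral_SUP_min[OF assms(2)]
    by (simp add: SUP_mult_left_ennreal SUP_mult_right_ennreal SUP_le_iff)
qed

section \<open>Marginals of log-concave functions\<close>

definition midpoint_log_concave :: "('a::real_vector \<Rightarrow> ennreal) \<Rightarrow> bool" where
  "midpoint_log_concave G \<longleftrightarrow> (\<forall>x y. G x * G y \<le> (G ((1 / 2) *\<^sub>R (x + y)))\<^sup>2)"

lemma midpoint_log_concave_integrate_line: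
  fixes G :: "'a::euclidean_space \<Rightarrow> ennreal"
  assumes [measurable]: "G \<in> borel_measurable borel" and G: "midpoint_log_concave G"
  shows "midpoint_log_concave (\<lambda>x. \<integral>\<^sup>+s. G (x + s *\<^sub>R e) \<partial>lborel)"
  unfolding midpoint_log_concave_def
proof (intro allI, rule prekopa_leindler_real)
  fix x y :: 'a and s t :: real
  have "(1 / 2) *\<^sub>R ((x + s *\<^sub>R e) + (y + t *\<^sub>R e)) = (1 / 2) *\<^sub>R (x + y) + ((s + t) / 2) *\<^sub>R e"
    by (simp add: algebra_simps add_divide_distrib)
  then show "G (x + s *\<^sub>R e) * G (y + t *\<^sub>R e) \<le> (G ((1 / 2) *\<^sub>R (x + y) + ((s + t) / 2) *\<^sub>R e))\<^sup>2"
    using G unfolding midpoint_log_concave_def by metis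
qed measurable

text \<open>Directions are integrated out one at a time, each by the one-dimensional inequality.
  Measurability belongs to the induction claim because the next integration needs it.\<close>

lemma midpoint_log_concave_integrate_PiM:
  fixes G :: "'a::euclidean_space \<Rightarrow> ennreal" and e :: "'i \<Rightarrow> 'a"
  assumes [measurable]: "G \<in> borel_measurable borel" and G: "midpoint_log_concave G" and J: "finite J"
  shows "(\<lambda>x. \<integral>\<^sup>+f. G (x + (\<Sum>j\<in>J. f j *\<^sub>R e j)) \<partial>(\<Pi>\<^sub>M j\<in>J. lborel)) \<in> borel_measurable borel
    \<and> midpoint_log_concave (\<lambda>x. \<integral>\<^sup>+f. G (x + (\<Sum>j\<in>J. f j *\<^sub>R e j)) \<partial>(\<Pi>\<^sub>M j\<in>J. lborel))"
  using J
proof (induction J)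
  case empty
  then show ?case using G by (simp add: PiM_empty nn_integral_count_space_finite)
next
  case (insert i J)
  interpret product_sigma_finite "\<lambda>j::'i. (lborel :: real measure)"
    by (simp add: product_sigma_finite_def lborel.sigma_finite_measure_axioms)
  let ?H = "\<lambda>x. \<integral>\<^sup>+f. G (x + (\<Sum>j\<in>J. f j *\<^sub>R e j)) \<partial>(\<Pi>\<^sub>M j\<in>J. lborel)"
  have [measurable]: "?H \<in> borel_measurable borel" using insert by blast
  have eq: "(\<integral>\<^sup>+f. G (x + (\<Sum>j\<in>insert i J. f j *\<^sub>R e j)) \<partial>(\<Pi>\<^sub>M j\<in>insert i J. lborel)) = (\<integral>\<^sup>+s. ?H (x + s *\<^sub>R e i) \<partial>lborel)" for x
  proof -
    have "(\<integral>\<^sup>+f. G (x + (\<Sum>j\<in>insert i J. f j *\<^sub>R e j)) \<partial>(\<Pi>\<^sub>M j\<in>insert i J. lborel))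
      = (\<integral>\<^sup>+s. (\<integral>\<^sup>+f. G (x + (\<Sum>j\<in>insert i J. (f(i := s)) j *\<^sub>R e j)) \<partial>(\<Pi>\<^sub>M j\<in>J. lborel)) \<partial>lborel)"
      using insert by (intro product_nn_integral_insert_rev) measurable
    also have "\<dots> = (\<integral>\<^sup>+s. ?H (x + s *\<^sub>R e i) \<partial>lborel)"
    proof (intro nn_integral_cong)
      fix s f
      have "(\<Sum>j\<in>J. (f(i := s)) j *\<^sub>R e j) = (\<Sum>j\<in>J. f j *\<^sub>R e j)" using insert by (intro sum.cong) auto
      then show "G (x + (\<Sum>j\<in>insert i J. (f(i := s)) j *\<^sub>R e j)) = G (x + s *\<^sub>R e i + (\<Sum>j\<in>J. f j *\<^sub>R e j))"
        using insert by (simp add: add.assoc)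
    qed
    finally show ?thesis .
  qed
  show ?case unfolding eq
    using insert by (intro conjI midpoint_log_concave_integrate_line) measurable
qed

text \<open>Integrating along the directions \<open>(0, b)\<close> gives a midpoint log-concave
  function on the whole product space; the marginal is its restriction to the points
  \<open>(x, 0)\<close>.\<close>

lemma prekopa_marginal:
  fixes G :: "'a::euclidean_space \<times> 'b::euclidean_space \<Rightarrow> ennreal"
  assumes [measurable]: "G \<in> borel_measurable borel" and G: "midpoint_log_concave G"
  shows "midpoint_log_concave (\<lambda>x. \<integral>\<^sup>+y. G (x, y) \<partial>lborel)"
proof -
  let ?H = "\<lambda>p. \<integral>\<^sup>+f. G (p + (\<Sum>b\<in>(Basis::'b set). f b *\<^sub>R (0, b))) \<partial>(\<Pi>\<^sub>M b\<in>(Basis::'b set). lborel)"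
  have "midpoint_log_concave ?H"
    using midpoint_log_concave_integrate_PiM[OF assms, of "Basis::'b set" "\<lambda>b. (0, b)"] by simp
  moreover have "(\<integral>\<^sup>+y. G (x, y) \<partial>lborel) = ?H (x, 0)" for x
  proof -
    have "(\<Sum>b\<in>(Basis::'b set). f b *\<^sub>R (0::'a, b)) = (0, \<Sum>b\<in>Basis. f b *\<^sub>R b)" for f
      by (simp add: prod_eq_iff fst_sum snd_sum)
    then have "?H (x, 0) = (\<integral>\<^sup>+f. G (x, \<Sum>b\<in>Basis. f b *\<^sub>R b) \<partial>(\<Pi>\<^sub>M b\<in>(Basis::'b set). lborel))" by simp
    then show ?thesis by (subst lborel_eq, subst nn_integral_distr) auto
  qed
  ultimately show ?thesis
    unfolding midpoint_log_concave_def
  proof (intro allI)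
    fix x y :: 'a
    assume H: "\<forall>p q. ?H p * ?H q \<le> (?H ((1 / 2) *\<^sub>R (p + q)))\<^sup>2"
      and eq: "\<And>x. (\<integral>\<^sup>+y. G (x, y) \<partial>lborel) = ?H (x, 0)"
    have m: "(1 / 2) *\<^sub>R ((x, 0) + (y, 0)) = ((1 / 2) *\<^sub>R (x + y), 0::'b)" by simp
    show "(\<integral>\<^sup>+z. G (x, z) \<partial>lborel) * (\<integral>\<^sup>+z. G (y, z) \<partial>lborel) \<le> (\<integral>\<^sup>+z. G ((1 / 2) *\<^sub>R (x + y), z) \<partial>lborel)\<^sup>2"
      unfolding eq using H[rule_format, of "(x, 0)" "(y, 0)"] unfolding m .
  qed
qed

section \<open>Even potentials with bounded second differences\<close>

text \<open>Second differences express 0 \<le> Hess \<psi> \<le> A without derivatives. Unlike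
  differentiability, such bounds pass to pointwise limits, and they control the local Lipschitz
  constants through \<open>A\<close> alone.\<close>

definition potential :: "real \<Rightarrow> ('a::euclidean_space \<Rightarrow> real) \<Rightarrow> bool" where
  "potential A \<psi> \<longleftrightarrow> (\<forall>x. \<psi> (- x) = \<psi> x) \<and> \<psi> 0 = 0 \<and>
     (\<forall>x h. 2 * \<psi> x \<le> \<psi> (x + h) + \<psi> (x - h) \<and> \<psi> (x + h) + \<psi> (x - h) \<le> 2 * \<psi> x + A * (norm h)\<^sup>2)"

lemma potentialI:
  assumes "\<And>x. \<psi> (- x) = \<psi> x" "\<psi> 0 = 0" "\<And>x h. 2 * \<psi> x \<le> \<psi> (x + h) + \<psi> (x - h)"
    "\<And>x h. \<psi> (x + h) + \<psi> (x - h) \<le> 2 * \<psi> x + A * (norm h)\<^sup>2"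
  shows "potential A \<psi>"
  using assms unfolding potential_def by blast

context
  fixes A and \<psi> :: "'a::euclidean_space \<Rightarrow> real"
  assumes pot: "potential A \<psi>"
begin

lemma potential_even: "\<psi> (- x) = \<psi> x" using pot unfolding potential_def by blast
lemma potential_zero: "\<psi> 0 = 0" using pot unfolding potential_def by blast
lemma potential_lower: "2 * \<psi> x \<le> \<psi> (x + h) + \<psi> (x - h)" using pot unfolding potential_def by blast
lemma potential_upper: "\<psi> (x + h) + \<psi> (x - h) \<le> 2 * \<psi> x + A * (norm h)\<^sup>2" using pot unfolding potential_def by blast

lemma potential_nonneg: "0 \<le> \<psi> x"
  using potential_lower[of 0 x] potential_even[of x] potential_zero by simp

lemma potential_le_norm: "\<psi> x \<le> A / 2 * (norm x)\<^sup>2"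
  using potential_upper[of 0 x] potential_even[of x] potential_zero by simp

lemma potential_const_nonneg: "0 \<le> A"
proof -
  obtain b :: 'a where "b \<in> Basis" using nonempty_Basis by blast
  then show ?thesis using potential_le_norm[of b] potential_nonneg[of b] by simp
qed

lemma potential_midpoint: "2 * \<psi> ((1/2) *\<^sub>R (x + y)) \<le> \<psi> x + \<psi> y"
proof -
  have "(1/2) *\<^sub>R (x + y) + (1/2) *\<^sub>R (x - y) = x" "(1/2) *\<^sub>R (x + y) - (1/2) *\<^sub>R (x - y) = y"
    by (simp_all add: algebra_simps flip: scaleR_add_left)
  then show ?thesis using potential_lower[of "(1/2) *\<^sub>R (x + y)" "(1/2) *\<^sub>R (x - y)"] by simp
qed

lemma potential_midpoint_upper: "\<psi> x + \<psi> y \<le> 2 * \<psi> ((1/2) *\<^sub>R (x + y)) + A / 4 * (norm (x - y))\<^sup>2"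
proof -
  have "(1/2) *\<^sub>R (x + y) + (1/2) *\<^sub>R (x - y) = x" "(1/2) *\<^sub>R (x + y) - (1/2) *\<^sub>R (x - y) = y"
    by (simp_all add: algebra_simps flip: scaleR_add_left)
  then show ?thesis using potential_upper[of "(1/2) *\<^sub>R (x + y)" "(1/2) *\<^sub>R (x - y)"]
    by (simp add: power_divide)
qed

text \<open>By convexity the increments along an arithmetic progression increase, so the first one
  is at most their average.\<close>

lemma potential_slope: "real N * (\<psi> (x + h) - \<psi> x) \<le> \<psi> (x + real N *\<^sub>R h) - \<psi> x"
proof -
  have d: "\<psi> (x + h) - \<psi> x \<le> \<psi> (x + real (Suc j) *\<^sub>R h) - \<psi> (x + real j *\<^sub>R h)" for j
  proof (induction j)
    case (Suc j)
    have 1: "(x + real (Suc j) *\<^sub>R h) + h = x + real (Suc (Suc j)) *\<^sub>R h"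
      and 2: "(x + real (Suc j) *\<^sub>R h) - h = x + real j *\<^sub>R h"
      by (simp_all add: algebra_simps scaleR_2)
    show ?case using Suc potential_lower[of "x + real (Suc j) *\<^sub>R h" h] unfolding 1 2 by linarith
  qed simp
  show ?thesis
  proof (induction N)
    case (Suc N)
    then show ?case using d[of N] by (simp add: algebra_simps)
  qed simp
qed

text \<open>Convexity compares a short increment with one \<open>N\<close> times as long, where
  \<open>N\<close> is the least integer with \<open>N * norm h \<ge> 1\<close>. That longer step has
  length at most 2, hence the radius \<open>norm x + 2\<close>, and there the quadratic upper bound
  applies.\<close>

lemma potential_increment: 
  assumes "norm h \<le> 1"
  shows "\<psi> (x + h) - \<psi> x \<le> A / 2 * (norm x + 2)\<^sup>2 * norm h"
proof (cases "h = 0")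
  case False
  then have hp: "0 < norm h" by simp
  define N where "N = nat \<lceil>1 / norm h\<rceil>"
  have N1: "1 / norm h \<le> real N" "real N \<le> 1 / norm h + 1" "0 < real N"
    using hp unfolding N_def by (auto simp: of_nat_ceiling) linarith?
  have "norm (x + real N *\<^sub>R h) \<le> norm x + real N * norm h"
    by (metis norm_scaleR abs_of_nat norm_triangle_ineq)
  also have "real N * norm h \<le> (1 / norm h + 1) * norm h" using N1 hp by (intro mult_right_mono) auto
  also have "\<dots> \<le> 2" using hp assms by (simp add: algebra_simps)
  finally have n2: "norm (x + real N *\<^sub>R h) \<le> norm x + 2" by simp
  have "real N * (\<psi> (x + h) - \<psi> x) \<le> \<psi> (x + real N *\<^sub>R h) - \<psi> x" by (rule potential_slope)
  also have "\<dots> \<le> A / 2 * (norm (x + real N *\<^sub>R h))\<^sup>2"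
    using potential_le_norm[of "x + real N *\<^sub>R h"] potential_nonneg[of x] by simp
  also have "\<dots> \<le> A / 2 * (norm x + 2)\<^sup>2"
    using n2 potential_const_nonneg by (intro mult_left_mono power_mono) auto
  finally have "\<psi> (x + h) - \<psi> x \<le> A / 2 * (norm x + 2)\<^sup>2 / real N"
    using N1 by (simp add: field_simps)
  also have "\<dots> \<le> A / 2 * (norm x + 2)\<^sup>2 * norm h"
  proof -
    have "1 / real N \<le> norm h" using N1 hp by (simp add: field_simps)
    then show ?thesis
      using mult_left_mono[of "1 / real N" "norm h" "A / 2 * (norm x + 2)\<^sup>2"] potential_const_nonneg by simp
  qed
  finally show ?thesis .
qed simp

text \<open>The lower estimate is the upper one for the step back from \<open>x + h\<close>;
  starting there costs one more unit of radius, hence 3 instead of 2. The constant depends on \<psi>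
  only through \<open>A\<close>, which makes it an equicontinuity bound for the class.\<close>

lemma potential_lipschitz:
  assumes h: "norm h \<le> 1"
  shows "\<bar>\<psi> (x + h) - \<psi> x\<bar> \<le> A * (norm x + 3)\<^sup>2 * norm h"
proof -
  have A: "0 \<le> A" by (rule potential_const_nonneg)
  have "\<psi> (x + h) - \<psi> x \<le> A / 2 * (norm x + 2)\<^sup>2 * norm h" by (rule potential_increment[OF h])
  also have "\<dots> \<le> A * (norm x + 3)\<^sup>2 * norm h"
    using A by (intro mult_right_mono mult_mono power_mono) auto
  finally have 1: "\<psi> (x + h) - \<psi> x \<le> A * (norm x + 3)\<^sup>2 * norm h" .
  have "\<psi> ((x + h) + - h) - \<psi> (x + h) \<le> A / 2 * (norm (x + h) + 2)\<^sup>2 * norm (- h)"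
    by (rule potential_increment) (use h in simp)
  also have "\<dots> \<le> A * (norm x + 3)\<^sup>2 * norm (- h)"
    using A h norm_triangle_ineq[of x h] by (intro mult_right_mono mult_mono power_mono) auto
  finally show ?thesis using 1 by (simp add: abs_le_iff)
qed

lemma potential_continuous: "continuous_on UNIV \<psi>"
proof (rule continuous_at_imp_continuous_on, rule ballI)
  fix x
  have "((\<lambda>h. \<psi> (x + h) - \<psi> x) \<longlongrightarrow> 0) (at 0)"
  proof (rule Lim_null_comparison)
    show "\<forall>\<^sub>F h in at 0. norm (\<psi> (x + h) - \<psi> x) \<le> A * (norm x + 3)\<^sup>2 * norm h"
      unfolding eventually_at by (rule exI[of _ 1]) (auto intro!: potential_lipschitz)
    show "((\<lambda>h::'a. A * (norm x + 3)\<^sup>2 * norm h) \<longlongrightarrow> 0) (at 0)"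
      by (auto intro!: tendsto_eq_intros)
  qed
  then have "((\<lambda>h. \<psi> (x + h)) \<longlongrightarrow> \<psi> x) (at 0)" by (simp add: LIM_zero_iff)
  then show "isCont \<psi> x" by (simp add: isCont_def LIM_offset_zero_iff)
qed

lemma potential_measurable[measurable]: "\<psi> \<in> borel_measurable borel"
  using potential_continuous by (rule borel_measurable_continuous_onI)

end

lemma potential_limit:
  assumes "\<And>n. potential A (\<psi> n)" and lim: "\<And>x. (\<lambda>n. \<psi> n x) \<longlonglongrightarrow> \<phi> x"
  shows "potential A \<phi>"
proof (rule potentialI)
  show "\<phi> (- x) = \<phi> x" for x
    using LIMSEQ_unique[OF lim[of "-x"]] lim[of x] potential_even[OF assms(1)] by simp
  show "\<phi> 0 = 0" using LIMSEQ_unique[OF lim[of 0]] potential_zero[OF assms(1)] by simp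
  show "2 * \<phi> x \<le> \<phi> (x + h) + \<phi> (x - h)" for x h
    by (rule LIMSEQ_le[OF tendsto_mult[OF tendsto_const lim] tendsto_add[OF lim lim]])
       (use potential_lower[OF assms(1)] in auto)
  show "\<phi> (x + h) + \<phi> (x - h) \<le> 2 * \<phi> x + A * (norm h)\<^sup>2" for x h
    by (rule LIMSEQ_le[OF tendsto_add[OF lim lim] tendsto_add[OF tendsto_mult[OF tendsto_const lim] tendsto_const]])
       (use potential_upper[OF assms(1)] in auto)
qed

text \<open>Section of \<open>\<psi> \<oplus> \<psi>\<close>, rotated by 45 degrees, at height x.\<close>
definition slice :: "('a::euclidean_space \<Rightarrow> real) \<Rightarrow> 'a \<Rightarrow> 'a \<Rightarrow> real" where
  "slice \<psi> x s = \<psi> ((1 / sqrt 2) *\<^sub>R (s + x)) + \<psi> ((1 / sqrt 2) *\<^sub>R (s - x)) - 2 * \<psi> ((1 / sqrt 2) *\<^sub>R x)"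

text \<open>A sign change of \<open>s\<close> swaps the two shifted terms, since \<psi> is even. The
  factor \<open>1 / sqrt 2\<close> halves each Hessian, so that the sum of two terms again has the
  bound \<open>A\<close>.\<close>

lemma potential_slice:
  assumes p: "potential A \<psi>"
  shows "potential A (slice \<psi> x)"
proof (rule potentialI)
  have e: "\<psi> ((1 / sqrt 2) *\<^sub>R (x - s)) = \<psi> ((1 / sqrt 2) *\<^sub>R (s - x))" for s x :: 'a
    using potential_even[OF p, of "(1 / sqrt 2) *\<^sub>R (x - s)"]
    by (simp add: scaleR_minus_right[symmetric] del: scaleR_minus_right)
  have e2: "\<psi> ((1 / sqrt 2) *\<^sub>R (- s - x)) = \<psi> ((1 / sqrt 2) *\<^sub>R (s + x))" for s x :: 'a
    using potential_even[OF p, of "(1 / sqrt 2) *\<^sub>R (s + x)"]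
    by (simp add: scaleR_minus_right[symmetric] del: scaleR_minus_right)
  show "slice \<psi> x (- s) = slice \<psi> x s" for s
    using e[of x s] e2[of s x] by (simp add: slice_def)
  show "slice \<psi> x 0 = 0" using e2[of 0 x] by (simp add: slice_def)
  fix s h
  have s: "(1 / sqrt 2) *\<^sub>R (s + h + x) = (1 / sqrt 2) *\<^sub>R (s + x) + (1 / sqrt 2) *\<^sub>R h"
    "(1 / sqrt 2) *\<^sub>R (s - h + x) = (1 / sqrt 2) *\<^sub>R (s + x) - (1 / sqrt 2) *\<^sub>R h"
    "(1 / sqrt 2) *\<^sub>R (s + h - x) = (1 / sqrt 2) *\<^sub>R (s - x) + (1 / sqrt 2) *\<^sub>R h"
    "(1 / sqrt 2) *\<^sub>R (s - h - x) = (1 / sqrt 2) *\<^sub>R (s - x) - (1 / sqrt 2) *\<^sub>R h"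
    by (simp_all add: algebra_simps)
  show "2 * slice \<psi> x s \<le> slice \<psi> x (s + h) + slice \<psi> x (s - h)"
    unfolding slice_def s
    using potential_lower[OF p, of "(1 / sqrt 2) *\<^sub>R (s + x)" "(1 / sqrt 2) *\<^sub>R h"]
      potential_lower[OF p, of "(1 / sqrt 2) *\<^sub>R (s - x)" "(1 / sqrt 2) *\<^sub>R h"] by simp
  have n: "(norm ((1 / sqrt 2) *\<^sub>R h))\<^sup>2 = (norm h)\<^sup>2 / 2" by (simp add: power_divide)
  show "slice \<psi> x (s + h) + slice \<psi> x (s - h) \<le> 2 * slice \<psi> x s + A * (norm h)\<^sup>2"
    unfolding slice_def s
    using potential_upper[OF p, of "(1 / sqrt 2) *\<^sub>R (s + x)" "(1 / sqrt 2) *\<^sub>R h"]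
      potential_upper[OF p, of "(1 / sqrt 2) *\<^sub>R (s - x)" "(1 / sqrt 2) *\<^sub>R h"] unfolding n by simp
qed

lemma potential_rescale:
  assumes p: "potential A \<psi>" and c: "c > 0"
  shows "potential A (\<lambda>x. c\<^sup>2 * \<psi> ((1 / c) *\<^sub>R x))"
proof (rule potentialI)
  show "c\<^sup>2 * \<psi> ((1 / c) *\<^sub>R (- x)) = c\<^sup>2 * \<psi> ((1 / c) *\<^sub>R x)" for x
    using potential_even[OF p, of "(1 / c) *\<^sub>R x"] by simp
  show "c\<^sup>2 * \<psi> ((1 / c) *\<^sub>R 0) = 0" using potential_zero[OF p] by simp
  fix x h
  show "2 * (c\<^sup>2 * \<psi> ((1 / c) *\<^sub>R x)) \<le> c\<^sup>2 * \<psi> ((1 / c) *\<^sub>R (x + h)) + c\<^sup>2 * \<psi> ((1 / c) *\<^sub>R (x - h))"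
    using mult_left_mono[OF potential_lower[OF p, of "(1 / c) *\<^sub>R x" "(1 / c) *\<^sub>R h"], of "c\<^sup>2"]
    by (simp add: algebra_simps)
  have "(norm ((1 / c) *\<^sub>R h))\<^sup>2 = (norm h)\<^sup>2 / c\<^sup>2" by (simp add: power_divide)
  then have "c\<^sup>2 * (A * (norm ((1 / c) *\<^sub>R h))\<^sup>2) = A * (norm h)\<^sup>2" using c by simp
  moreover have "c\<^sup>2 * (\<psi> ((1 / c) *\<^sub>R x + (1 / c) *\<^sub>R h) + \<psi> ((1 / c) *\<^sub>R x - (1 / c) *\<^sub>R h))
      \<le> c\<^sup>2 * (2 * \<psi> ((1 / c) *\<^sub>R x) + A * (norm ((1 / c) *\<^sub>R h))\<^sup>2)"
    by (intro mult_left_mono potential_upper[OF p]) simp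
  ultimately show "c\<^sup>2 * \<psi> ((1 / c) *\<^sub>R (x + h)) + c\<^sup>2 * \<psi> ((1 / c) *\<^sub>R (x - h)) \<le> 2 * (c\<^sup>2 * \<psi> ((1 / c) *\<^sub>R x)) + A * (norm h)\<^sup>2"
    unfolding scaleR_add_right scaleR_diff_right distrib_left by linarith
qed

section \<open>Infimal convolution with dilation\<close>

text \<open>In terms of \<open>f = exp (- \<psi>)\<close>, \<open>g = exp (- \<phi>)\<close> this is the potential of the
  supremum of \<open>sqrt (f x * g y)\<close> over \<open>\<mu> x + y / \<mu> = 2 z\<close>.\<close>
definition infconv :: "real \<Rightarrow> ('a::euclidean_space \<Rightarrow> real) \<Rightarrow> ('a \<Rightarrow> real) \<Rightarrow> 'a \<Rightarrow> real" where
  "infconv \<mu> \<psi> \<phi> z = (INF u. (\<psi> ((1 / \<mu>) *\<^sub>R (z + u)) + \<phi> (\<mu> *\<^sub>R (z - u))) / 2)"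

context
  fixes \<psi> \<phi> :: "'a::euclidean_space \<Rightarrow> real" and \<mu> :: real
  assumes nn: "\<And>x. 0 \<le> \<psi> x" "\<And>x. 0 \<le> \<phi> x" and mu: "\<mu> > 0"
begin

lemma infconv_le:
  assumes "\<mu> *\<^sub>R x + (1 / \<mu>) *\<^sub>R y = 2 *\<^sub>R z"
  shows "infconv \<mu> \<psi> \<phi> z \<le> (\<psi> x + \<phi> y) / 2"
proof -
  define u where "u = \<mu> *\<^sub>R x - z"
  have x: "(1 / \<mu>) *\<^sub>R (z + u) = x" using mu by (simp add: u_def)
  have "z - u = (1 / \<mu>) *\<^sub>R y" using assms by (simp add: u_def scaleR_2 algebra_simps)
  then have y: "\<mu> *\<^sub>R (z - u) = y" using mu by simp
  have "infconv \<mu> \<psi> \<phi> z \<le> (\<psi> ((1 / \<mu>) *\<^sub>R (z + u)) + \<phi> (\<mu> *\<^sub>R (z - u))) / 2"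
    unfolding infconv_def by (rule cINF_lower) (auto intro!: bdd_belowI[of _ 0] simp: nn)
  then show ?thesis by (simp only: x y)
qed

lemma infconv_greatest:
  assumes "\<And>x y. \<mu> *\<^sub>R x + (1 / \<mu>) *\<^sub>R y = 2 *\<^sub>R z \<Longrightarrow> c \<le> (\<psi> x + \<phi> y) / 2"
  shows "c \<le> infconv \<mu> \<psi> \<phi> z"
  unfolding infconv_def
proof (rule cINF_greatest)
  fix u
  show "c \<le> (\<psi> ((1 / \<mu>) *\<^sub>R (z + u)) + \<phi> (\<mu> *\<^sub>R (z - u))) / 2"
    by (rule assms) (use mu in \<open>simp add: scaleR_2\<close>)
qed simp

end

text \<open>Convexity comes from averaging two admissible pairs. For the upper bound the
  displacement \<open>h\<close> of \<open>z\<close> is distributed by moving x by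
  \<open>(1 / \<mu>) *\<^sub>R h\<close> and y by \<open>\<mu> *\<^sub>R h\<close>; the mean of the
  two second-difference errors is the stated constant.\<close>

lemma potential_infconv:
  assumes p: "potential A \<psi>" and q: "potential A \<phi>" and mu: "\<mu> > 0"
  shows "potential (A * (1 / \<mu>\<^sup>2 + \<mu>\<^sup>2) / 2) (infconv \<mu> \<psi> \<phi>)"
proof (rule potentialI)
  note nn = potential_nonneg[OF p] potential_nonneg[OF q]
  note le = infconv_le[of \<psi> \<phi> \<mu>, OF nn mu] and ge = infconv_greatest[of \<psi> \<phi> \<mu>, OF nn mu]
  have ev: "infconv \<mu> \<psi> \<phi> (- z) \<le> infconv \<mu> \<psi> \<phi> z" for z
  proof (rule ge)
    fix x y assume "\<mu> *\<^sub>R x + (1 / \<mu>) *\<^sub>R y = 2 *\<^sub>R z"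
    moreover have "\<mu> *\<^sub>R (- x) + (1 / \<mu>) *\<^sub>R (- y) = - (\<mu> *\<^sub>R x + (1 / \<mu>) *\<^sub>R y)" by simp
    ultimately have "\<mu> *\<^sub>R (- x) + (1 / \<mu>) *\<^sub>R (- y) = 2 *\<^sub>R (- z)" by simp
    then show "infconv \<mu> \<psi> \<phi> (- z) \<le> (\<psi> x + \<phi> y) / 2"
      using le[of "- x" "- y" "- z"] potential_even[OF p] potential_even[OF q] by simp
  qed
  show "infconv \<mu> \<psi> \<phi> (- z) = infconv \<mu> \<psi> \<phi> z" for z
    using ev[of z] ev[of "- z"] by simp
  have "infconv \<mu> \<psi> \<phi> 0 \<le> 0"
    using le[of 0 0 0] by (simp add: potential_zero[OF p] potential_zero[OF q])
  moreover have "0 \<le> infconv \<mu> \<psi> \<phi> 0"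
    by (rule ge) (simp add: nn)
  ultimately show "infconv \<mu> \<psi> \<phi> 0 = 0" by simp
  fix z h
  show "2 * infconv \<mu> \<psi> \<phi> z \<le> infconv \<mu> \<psi> \<phi> (z + h) + infconv \<mu> \<psi> \<phi> (z - h)"
  proof -
    have *: "2 * infconv \<mu> \<psi> \<phi> z \<le> (\<psi> x1 + \<phi> y1) / 2 + (\<psi> x2 + \<phi> y2) / 2"
      if 1: "\<mu> *\<^sub>R x1 + (1 / \<mu>) *\<^sub>R y1 = 2 *\<^sub>R (z + h)" and 2: "\<mu> *\<^sub>R x2 + (1 / \<mu>) *\<^sub>R y2 = 2 *\<^sub>R (z - h)" for x1 x2 y1 y2
    proof -
      have "\<mu> *\<^sub>R ((1/2) *\<^sub>R (x1 + x2)) + (1 / \<mu>) *\<^sub>R ((1/2) *\<^sub>R (y1 + y2))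
         = (1/2) *\<^sub>R ((\<mu> *\<^sub>R x1 + (1 / \<mu>) *\<^sub>R y1) + (\<mu> *\<^sub>R x2 + (1 / \<mu>) *\<^sub>R y2))"
        by (simp add: scaleR_add_right mult.commute)
      also have "\<dots> = 2 *\<^sub>R z" unfolding 1 2 scaleR_add_right[symmetric] by (simp add: scaleR_2)
      finally show ?thesis
        using le[of "(1/2) *\<^sub>R (x1 + x2)" "(1/2) *\<^sub>R (y1 + y2)" z] potential_midpoint[OF p, of x1 x2] potential_midpoint[OF q, of y1 y2]
        by argo
    qed
    \<comment> \<open>Minimisers are not assumed to exist, so the infima at \<open>z - h\<close> and
      \<open>z + h\<close> are approached one after the other by the greatest-lower-bound
      rule.\<close>
    have "2 * infconv \<mu> \<psi> \<phi> z - infconv \<mu> \<psi> \<phi> (z + h) \<le> infconv \<mu> \<psi> \<phi> (z - h)"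
    proof (rule ge)
      fix x2 y2 assume 2: "\<mu> *\<^sub>R x2 + (1 / \<mu>) *\<^sub>R y2 = 2 *\<^sub>R (z - h)"
      have "2 * infconv \<mu> \<psi> \<phi> z - (\<psi> x2 + \<phi> y2) / 2 \<le> infconv \<mu> \<psi> \<phi> (z + h)"
      proof (rule ge)
        fix x1 y1 assume "\<mu> *\<^sub>R x1 + (1 / \<mu>) *\<^sub>R y1 = 2 *\<^sub>R (z + h)"
        from *[OF this 2] show "2 * infconv \<mu> \<psi> \<phi> z - (\<psi> x2 + \<phi> y2) / 2 \<le> (\<psi> x1 + \<phi> y1) / 2" by linarith
      qed
      then show "2 * infconv \<mu> \<psi> \<phi> z - infconv \<mu> \<psi> \<phi> (z + h) \<le> (\<psi> x2 + \<phi> y2) / 2" by linarith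
    qed
    then show ?thesis by simp
  qed
  have ring: "a * (b + c) / 2 * n = (a * (b * n) + a * (c * n)) / 2" for a b c n :: real
    by (simp add: algebra_simps)
  have lin: "(m1 + m2 - S) / 2 \<le> (p + q) / 2"
    if "m1 \<le> (a + c) / 2" "m2 \<le> (b + d) / 2" "a + b \<le> 2 * p + P" "c + d \<le> 2 * q + Q" "S = (P + Q) / 2"
    for m1 m2 a b c d p q P Q S :: real
    using that by simp
  let ?B = "A * (1 / \<mu>\<^sup>2 + \<mu>\<^sup>2) / 2"
  have "((infconv \<mu> \<psi> \<phi> (z + h) + infconv \<mu> \<psi> \<phi> (z - h)) - ?B * (norm h)\<^sup>2) / 2 \<le> infconv \<mu> \<psi> \<phi> z"
  proof (rule ge)
    fix x y assume xy: "\<mu> *\<^sub>R x + (1 / \<mu>) *\<^sub>R y = 2 *\<^sub>R z"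
    have "\<mu> *\<^sub>R (x + (1 / \<mu>) *\<^sub>R h) + (1 / \<mu>) *\<^sub>R (y + \<mu> *\<^sub>R h) = (\<mu> *\<^sub>R x + (1 / \<mu>) *\<^sub>R y) + (h + h)"
      "\<mu> *\<^sub>R (x - (1 / \<mu>) *\<^sub>R h) + (1 / \<mu>) *\<^sub>R (y - \<mu> *\<^sub>R h) = (\<mu> *\<^sub>R x + (1 / \<mu>) *\<^sub>R y) - (h + h)"
      using mu by (simp_all only: scaleR_add_right scaleR_diff_right scaleR_scaleR) (simp_all)
    then have 1: "\<mu> *\<^sub>R (x + (1 / \<mu>) *\<^sub>R h) + (1 / \<mu>) *\<^sub>R (y + \<mu> *\<^sub>R h) = 2 *\<^sub>R (z + h)"
      and 2: "\<mu> *\<^sub>R (x - (1 / \<mu>) *\<^sub>R h) + (1 / \<mu>) *\<^sub>R (y - \<mu> *\<^sub>R h) = 2 *\<^sub>R (z - h)"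
      unfolding xy by (simp_all add: scaleR_2 add.assoc add.left_commute)
    have n: "(norm ((1 / \<mu>) *\<^sub>R h))\<^sup>2 = (1 / \<mu>\<^sup>2) * (norm h)\<^sup>2" "(norm (\<mu> *\<^sub>R h))\<^sup>2 = \<mu>\<^sup>2 * (norm h)\<^sup>2"
      by (simp_all add: power_divide power_mult_distrib)
    define P Q S where "P = A * (norm ((1 / \<mu>) *\<^sub>R h))\<^sup>2" and "Q = A * (norm (\<mu> *\<^sub>R h))\<^sup>2" and "S = ?B * (norm h)\<^sup>2"
    have S: "S = (P + Q) / 2"
      unfolding P_def Q_def S_def n by (rule ring)
    show "((infconv \<mu> \<psi> \<phi> (z + h) + infconv \<mu> \<psi> \<phi> (z - h)) - ?B * (norm h)\<^sup>2) / 2 \<le> (\<psi> x + \<phi> y) / 2"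
      using le[OF 1] le[OF 2] potential_upper[OF p, of x "(1 / \<mu>) *\<^sub>R h"] potential_upper[OF q, of y "\<mu> *\<^sub>R h"] S
      unfolding P_def[symmetric] Q_def[symmetric] S_def[symmetric] by (rule lin)
  qed
  then show "infconv \<mu> \<psi> \<phi> (z + h) + infconv \<mu> \<psi> \<phi> (z - h) \<le> 2 * infconv \<mu> \<psi> \<phi> z + ?B * (norm h)\<^sup>2"
    by simp
qed

section \<open>Gaussian integrals of potentials and self-convolution\<close>

definition gint :: "('a::euclidean_space \<Rightarrow> real) \<Rightarrow> real" where
  "gint \<psi> = (\<integral>x. exp (- \<psi> x - (norm x)\<^sup>2 / 2) \<partial>lborel)"

lemma gint_integrable:
  fixes \<psi> :: "'a::euclidean_space \<Rightarrow> real"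
  assumes [measurable]: "\<psi> \<in> borel_measurable borel" and nn: "\<And>x. 0 \<le> \<psi> x"
  shows "integrable lborel (\<lambda>x. exp (- \<psi> x - (norm x)\<^sup>2 / 2))"
  by (rule Bochner_Integration.integrable_bound[OF integrable_gauss]) (use nn in auto)

lemma integral_pos_lborel:
  fixes f :: "'a::euclidean_space \<Rightarrow> real"
  assumes int: "integrable lborel f" and pos: "\<And>x. 0 < f x"
  shows "0 < (\<integral>x. f x \<partial>lborel)"
proof -
  have nn: "0 \<le> (\<integral>x. f x \<partial>lborel)" using pos by (simp add: less_imp_le)
  have "(\<integral>x. f x \<partial>lborel) \<noteq> 0"
  proof
    assume "(\<integral>x. f x \<partial>lborel) = 0"
    then have "AE x in lborel. f x = 0"
      using pos by (subst (asm) integral_nonneg_eq_0_iff_AE[OF int]) (auto simp: less_imp_le)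
    then have "AE x in (lborel::'a measure). False"
      by (rule AE_mp) (use pos in \<open>auto simp: less_le\<close>)
    then show False by (simp add: eventually_False ae_filter_eq_bot_iff emeasure_lborel_UNIV)
  qed
  with nn show ?thesis by simp
qed

lemma gint_pos:
  fixes \<psi> :: "'a::euclidean_space \<Rightarrow> real"
  assumes "\<psi> \<in> borel_measurable borel" "\<And>x. 0 \<le> \<psi> x"
  shows "0 < gint \<psi>"
  unfolding gint_def by (rule integral_pos_lborel[OF gint_integrable[OF assms]]) simp

lemma gint_mono:
  fixes \<psi> \<phi> :: "'a::euclidean_space \<Rightarrow> real"
  assumes "\<psi> \<in> borel_measurable borel" "\<phi> \<in> borel_measurable borel" "\<And>x. 0 \<le> \<psi> x" "\<And>x. \<psi> x \<le> \<phi> x"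
  shows "gint \<phi> \<le> gint \<psi>"
  unfolding gint_def
  using assms order_trans[OF assms(3,4)] by (intro integral_mono gint_integrable) auto

lemma gint_tendsto:
  fixes \<psi> :: "nat \<Rightarrow> 'a::euclidean_space \<Rightarrow> real"
  assumes [measurable]: "\<And>n. \<psi> n \<in> borel_measurable borel" "\<phi> \<in> borel_measurable borel"
    and nn: "\<And>n x. 0 \<le> \<psi> n x" and lim: "\<And>x. (\<lambda>n. \<psi> n x) \<longlonglongrightarrow> \<phi> x"
  shows "(\<lambda>n. gint (\<psi> n)) \<longlonglongrightarrow> gint \<phi>"
  unfolding gint_def
proof (rule integral_dominated_convergence[OF _ _ integrable_gauss])
  show "AE x in lborel. (\<lambda>n. exp (- \<psi> n x - (norm x)\<^sup>2 / 2)) \<longlonglongrightarrow> exp (- \<phi> x - (norm x)\<^sup>2 / 2)"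
    by (intro AE_I2 tendsto_intros lim)
qed (use nn in auto)

lemmas potential_gint_pos = gint_pos[OF potential_measurable potential_nonneg]

section \<open>Self-convolution and its potential\<close>

text \<open>For \<open>f = exp (- \<psi>)\<close> and the Gaussian weight \<open>w\<close>, \<open>sconv \<psi> * w\<close> is the density of
  \<open>(X + Y) / sqrt 2\<close> for independent X, Y with density \<open>f * w\<close>, and \<open>spot \<psi>\<close> is its potential.\<close>
definition sconv :: "('a::euclidean_space \<Rightarrow> real) \<Rightarrow> 'a \<Rightarrow> real" where
  "sconv \<psi> x = (\<integral>y. exp (- (\<psi> ((1 / sqrt 2) *\<^sub>R (y + x)) + \<psi> ((1 / sqrt 2) *\<^sub>R (y - x)) + (norm y)\<^sup>2 / 2)) \<partial>lborel)"

definition spot :: "('a::euclidean_space \<Rightarrow> real) \<Rightarrow> 'a \<Rightarrow> real" where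
  "spot \<psi> x = ln (sconv \<psi> 0) - ln (sconv \<psi> x)"

context
  fixes A and \<psi> :: "'a::euclidean_space \<Rightarrow> real"
  assumes pot: "potential A \<psi>"
begin

private lemma meas[measurable]: "\<psi> \<in> borel_measurable borel" by (rule potential_measurable[OF pot])

lemma sconv_integrable:
  "integrable lborel (\<lambda>y. exp (- (\<psi> ((1 / sqrt 2) *\<^sub>R (y + x)) + \<psi> ((1 / sqrt 2) *\<^sub>R (y - x)) + (norm y)\<^sup>2 / 2)))"
proof (rule Bochner_Integration.integrable_bound[OF integrable_gauss])
  show "AE y in lborel. norm (exp (- (\<psi> ((1 / sqrt 2) *\<^sub>R (y + x)) + \<psi> ((1 / sqrt 2) *\<^sub>R (y - x)) + (norm y)\<^sup>2 / 2)))
      \<le> norm (exp (- (norm y)\<^sup>2 / 2))"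
  proof (rule AE_I2)
    fix y
    show "norm (exp (- (\<psi> ((1 / sqrt 2) *\<^sub>R (y + x)) + \<psi> ((1 / sqrt 2) *\<^sub>R (y - x)) + (norm y)\<^sup>2 / 2)))
      \<le> norm (exp (- (norm y)\<^sup>2 / 2))"
      using potential_nonneg[OF pot, of "(1 / sqrt 2) *\<^sub>R (y + x)"] potential_nonneg[OF pot, of "(1 / sqrt 2) *\<^sub>R (y - x)"]
      unfolding real_norm_def abs_exp_cancel exp_le_cancel_iff by linarith
  qed
qed measurable

lemma sconv_pos: "0 < sconv \<psi> x"
  unfolding sconv_def by (rule integral_pos_lborel[OF sconv_integrable]) simp

lemma exp_spot: "exp (- spot \<psi> x) = sconv \<psi> x / sconv \<psi> 0"
  by (simp add: spot_def exp_diff sconv_pos)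

text \<open>Separates the value at the centre of a slice from the normalised slice. An inequality
  between Gaussian integrals of slices thereby becomes one between self-convolutions.\<close>

lemma sconv_eq_slice: "sconv \<psi> x = exp (- 2 * \<psi> ((1 / sqrt 2) *\<^sub>R x)) * gint (slice \<psi> x)"
  unfolding sconv_def gint_def slice_def
  by (subst integral_mult_right_zero[symmetric], rule Bochner_Integration.integral_cong)
     (auto simp: exp_add[symmetric])

lemma sconv_even: "sconv \<psi> (- x) = sconv \<psi> x"
  unfolding sconv_def by (simp add: add.commute)

lemma nn_integral_sconv:
  "(\<integral>\<^sup>+y. ennreal (exp (- (\<psi> ((1 / sqrt 2) *\<^sub>R (y + x)) + \<psi> ((1 / sqrt 2) *\<^sub>R (y - x)) + (norm y)\<^sup>2 / 2))) \<partial>lborel)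
    = ennreal (sconv \<psi> x)"
  unfolding sconv_def by (rule nn_integral_eq_integral[OF sconv_integrable]) simp

lemma sconv_measurable[measurable]: "sconv \<psi> \<in> borel_measurable borel"
  unfolding sconv_def by measurable

text \<open>The rotation preserves the Gaussian weight of the pair, so the double integral is the
  product of two copies of \<open>gint \<psi>\<close>.\<close>

lemma integral_sconv:
  "(\<integral>\<^sup>+x. ennreal (sconv \<psi> x * exp (- (norm x)\<^sup>2 / 2)) \<partial>lborel) = ennreal ((gint \<psi>)\<^sup>2)"
proof -
  let ?g = "\<lambda>x. exp (- \<psi> x - (norm x)\<^sup>2 / 2)"
  let ?G = "\<lambda>x y. ennreal (?g x * ?g y)"
  have nrm: "(norm ((1 / sqrt 2) *\<^sub>R (y + x)))\<^sup>2 + (norm ((1 / sqrt 2) *\<^sub>R (y - x)))\<^sup>2 = (norm x)\<^sup>2 + (norm y)\<^sup>2" for x y :: 'a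
    by (simp add: power_divide power2_norm_eq_inner inner_add_left inner_add_right inner_diff_left inner_diff_right
        inner_commute add_divide_distrib[symmetric])
  have gi: "(\<integral>\<^sup>+x. ennreal (?g x) \<partial>lborel) = ennreal (gint \<psi>)"
    unfolding gint_def by (rule nn_integral_eq_integral[OF gint_integrable]) (auto simp: potential_nonneg[OF pot])
  have "(\<integral>\<^sup>+x. ennreal (sconv \<psi> x * exp (- (norm x)\<^sup>2 / 2)) \<partial>lborel)
    = (\<integral>\<^sup>+x. (\<integral>\<^sup>+y. ?G ((1 / sqrt 2) *\<^sub>R (y + x)) ((1 / sqrt 2) *\<^sub>R (y - x)) \<partial>lborel) \<partial>lborel)"
  proof (rule nn_integral_cong)
    fix x :: 'a
    have "ennreal (sconv \<psi> x * exp (- (norm x)\<^sup>2 / 2)) = ennreal (exp (- (norm x)\<^sup>2 / 2)) * ennreal (sconv \<psi> x)"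
      using sconv_pos[of x] by (simp add: ennreal_mult[symmetric] mult.commute)
    also have "\<dots> = (\<integral>\<^sup>+y. ennreal (exp (- (norm x)\<^sup>2 / 2)) * ennreal (exp (- (\<psi> ((1 / sqrt 2) *\<^sub>R (y + x)) + \<psi> ((1 / sqrt 2) *\<^sub>R (y - x)) + (norm y)\<^sup>2 / 2))) \<partial>lborel)"
      unfolding nn_integral_sconv[symmetric] by (rule nn_integral_cmult[symmetric]) measurable
    also have "\<dots> = (\<integral>\<^sup>+y. ?G ((1 / sqrt 2) *\<^sub>R (y + x)) ((1 / sqrt 2) *\<^sub>R (y - x)) \<partial>lborel)"
    proof (rule nn_integral_cong)
      fix y :: 'a
      show "ennreal (exp (- (norm x)\<^sup>2 / 2)) * ennreal (exp (- (\<psi> ((1 / sqrt 2) *\<^sub>R (y + x)) + \<psi> ((1 / sqrt 2) *\<^sub>R (y - x)) + (norm y)\<^sup>2 / 2)))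
        = ?G ((1 / sqrt 2) *\<^sub>R (y + x)) ((1 / sqrt 2) *\<^sub>R (y - x))"
      proof -
        have "- (norm x)\<^sup>2 / 2 + - (a + b + (norm y)\<^sup>2 / 2) = (- a - m / 2) + (- b - n / 2)"
          if "m + n = (norm x)\<^sup>2 + (norm y)\<^sup>2" for a b m n :: real using that by argo
        from this[OF nrm] show ?thesis by (simp only: ennreal_mult[symmetric] exp_ge_zero exp_add[symmetric])
      qed
    qed
    finally show "ennreal (sconv \<psi> x * exp (- (norm x)\<^sup>2 / 2)) = (\<integral>\<^sup>+y. ?G ((1 / sqrt 2) *\<^sub>R (y + x)) ((1 / sqrt 2) *\<^sub>R (y - x)) \<partial>lborel)" .
  qed
  also have "\<dots> = (\<integral>\<^sup>+x. (\<integral>\<^sup>+y. ?G x y \<partial>lborel) \<partial>lborel)"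
    by (rule nn_integral_rotate) measurable
  also have "\<dots> = (\<integral>\<^sup>+x. ennreal (?g x) * ennreal (gint \<psi>) \<partial>lborel)"
    unfolding gi[symmetric] by (rule nn_integral_cong) (subst nn_integral_cmult[symmetric], auto simp: ennreal_mult)
  also have "\<dots> = ennreal (gint \<psi>) * ennreal (gint \<psi>)"
    by (subst nn_integral_multc) (auto simp: gi)
  also have "\<dots> = ennreal ((gint \<psi>)\<^sup>2)"
    by (simp add: ennreal_mult[symmetric] power2_eq_square less_imp_le[OF potential_gint_pos[OF pot pot]])
  finally show ?thesis .
qed

text \<open>The exponent is jointly midpoint convex in \<open>(x, y)\<close>, being a sum of \<psi>
  composed with linear maps and a convex quadratic. Prekopa's theorem for the marginal in y gives
  the claim.\<close>

lemma sconv_midpoint: "sconv \<psi> (x + h) * sconv \<psi> (x - h) \<le> (sconv \<psi> x)\<^sup>2"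
proof -
  let ?e = "\<lambda>x y. \<psi> ((1 / sqrt 2) *\<^sub>R (y + x)) + \<psi> ((1 / sqrt 2) *\<^sub>R (y - x)) + (norm y)\<^sup>2 / 2"
  define G where "G = (\<lambda>p::'a \<times> 'a. ennreal (exp (- ?e (fst p) (snd p))))"
  have "midpoint_log_concave (\<lambda>x. \<integral>\<^sup>+y. G (x, y) \<partial>lborel)"
  proof (rule prekopa_marginal)
    show "G \<in> borel_measurable borel" unfolding G_def borel_prod[symmetric] by measurable
    show "midpoint_log_concave G" unfolding midpoint_log_concave_def
    proof (intro allI)
      fix p q :: "'a \<times> 'a"
      obtain a b c d where pq: "p = (a, b)" "q = (c, d)" by (cases p; cases q) auto
      have m: "(1 / sqrt 2) *\<^sub>R ((1 / 2) *\<^sub>R (b + d) + (1 / 2) *\<^sub>R (a + c)) = (1 / 2) *\<^sub>R ((1 / sqrt 2) *\<^sub>R (b + a) + (1 / sqrt 2) *\<^sub>R (d + c))"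
        "(1 / sqrt 2) *\<^sub>R ((1 / 2) *\<^sub>R (b + d) - (1 / 2) *\<^sub>R (a + c)) = (1 / 2) *\<^sub>R ((1 / sqrt 2) *\<^sub>R (b - a) + (1 / sqrt 2) *\<^sub>R (d - c))"
        by (simp_all add: algebra_simps)
      have "2 * (norm ((1 / 2) *\<^sub>R (b + d)))\<^sup>2 \<le> (norm b)\<^sup>2 + (norm d)\<^sup>2"
      proof -
        have "(norm b)\<^sup>2 + (norm d)\<^sup>2 - 2 * (norm ((1 / 2) *\<^sub>R (b + d)))\<^sup>2 = (norm (b - d))\<^sup>2 / 2"
          by (simp add: power_divide power2_norm_eq_inner inner_add_left inner_add_right inner_diff_left inner_diff_right
              inner_commute field_simps)
        then show ?thesis using zero_le_power2[of "norm (b - d)"] by linarith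
      qed
      then have "2 * ?e ((1 / 2) *\<^sub>R (a + c)) ((1 / 2) *\<^sub>R (b + d)) \<le> ?e a b + ?e c d"
        unfolding m
        using potential_midpoint[OF pot, of "(1 / sqrt 2) *\<^sub>R (b + a)" "(1 / sqrt 2) *\<^sub>R (d + c)"]
          potential_midpoint[OF pot, of "(1 / sqrt 2) *\<^sub>R (b - a)" "(1 / sqrt 2) *\<^sub>R (d - c)"]
        by argo
      then have "exp (- ?e a b) * exp (- ?e c d) \<le> (exp (- ?e ((1 / 2) *\<^sub>R (a + c)) ((1 / 2) *\<^sub>R (b + d))))\<^sup>2"
        unfolding exp_add[symmetric] exp_double[symmetric] exp_le_cancel_iff by argo
      then show "G p * G q \<le> (G ((1 / 2) *\<^sub>R (p + q)))\<^sup>2"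
        unfolding G_def pq
        by (simp only: fst_conv snd_conv add_Pair scaleR_Pair ennreal_mult[symmetric] exp_ge_zero ennreal_power ennreal_leI)
    qed
  qed
  then have "ennreal (sconv \<psi> (x + h)) * ennreal (sconv \<psi> (x - h)) \<le> (ennreal (sconv \<psi> ((1 / 2) *\<^sub>R ((x + h) + (x - h)))))\<^sup>2"
    unfolding midpoint_log_concave_def G_def fst_conv snd_conv nn_integral_sconv by blast
  moreover have "(1 / 2) *\<^sub>R ((x + h) + (x - h)) = x" by (simp add: scaleR_2[symmetric])
  ultimately show ?thesis
    using sconv_pos less_imp_le[OF sconv_pos] by (simp add: ennreal_mult[symmetric] ennreal_power ennreal_le_iff)
qed

text \<open>With y fixed, replacing x by \<open>x + h\<close> or \<open>x - h\<close> moves both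
  arguments of \<psi> by plus or minus \<open>h / sqrt 2\<close>, so the total second difference is
  at most \<open>A * (norm h)\<^sup>2\<close>. The resulting pointwise bound is integrated by the
  Cauchy--Schwarz inequality.\<close>

lemma sconv_midpoint_upper: "(sconv \<psi> x)\<^sup>2 * exp (- A * (norm h)\<^sup>2) \<le> sconv \<psi> (x + h) * sconv \<psi> (x - h)"
proof -
  let ?e = "\<lambda>x y. \<psi> ((1 / sqrt 2) *\<^sub>R (y + x)) + \<psi> ((1 / sqrt 2) *\<^sub>R (y - x)) + (norm y)\<^sup>2 / 2"
  \<comment> \<open>The weight \<open>t\<close> balances the two integrals,
    \<open>t * p = q / t\<close>; with this choice the weighted arithmetic-geometric mean integrates
    to Cauchy--Schwarz.\<close>
  define p q t where "p = sconv \<psi> (x + h)" and "q = sconv \<psi> (x - h)" and "t = sqrt (q / p)"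
  have pq: "0 < p" "0 < q" unfolding p_def q_def by (rule sconv_pos)+
  have t: "0 < t" "t * t = q / p" using pq by (simp_all add: t_def)
  have am_gm: "a * b \<le> ((a + b) / 2)\<^sup>2" for a b :: real
    using zero_le_power2[of "a - b"] by (simp add: power2_eq_square field_simps)
  have pt: "exp (- ?e x y) * exp (- A / 2 * (norm h)\<^sup>2) \<le> (t * exp (- ?e (x + h) y) + (1 / t) * exp (- ?e (x - h) y)) / 2" for y
  proof -
    let ?k = "(1 / sqrt 2) *\<^sub>R h"
    have s: "(1 / sqrt 2) *\<^sub>R (y + (x + h)) = (1 / sqrt 2) *\<^sub>R (y + x) + ?k" "(1 / sqrt 2) *\<^sub>R (y - (x + h)) = (1 / sqrt 2) *\<^sub>R (y - x) - ?k"
       "(1 / sqrt 2) *\<^sub>R (y + (x - h)) = (1 / sqrt 2) *\<^sub>R (y + x) - ?k" "(1 / sqrt 2) *\<^sub>R (y - (x - h)) = (1 / sqrt 2) *\<^sub>R (y - x) + ?k"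
      by (simp_all add: algebra_simps)
    have k: "(norm ?k)\<^sup>2 = (norm h)\<^sup>2 / 2" by (simp add: power_divide)
    have "?e (x + h) y + ?e (x - h) y \<le> 2 * ?e x y + A * (norm h)\<^sup>2"
      unfolding s
      using potential_upper[OF pot, of "(1 / sqrt 2) *\<^sub>R (y + x)" ?k] potential_upper[OF pot, of "(1 / sqrt 2) *\<^sub>R (y - x)" ?k]
      unfolding k by argo
    then have "(exp (- ?e x y) * exp (- A / 2 * (norm h)\<^sup>2))\<^sup>2 \<le> exp (- ?e (x + h) y) * exp (- ?e (x - h) y)"
      unfolding exp_add[symmetric] exp_double[symmetric] exp_le_cancel_iff by argo
    also have "\<dots> = (t * exp (- ?e (x + h) y)) * ((1 / t) * exp (- ?e (x - h) y))" using t by simp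
    also have "\<dots> \<le> ((t * exp (- ?e (x + h) y) + (1 / t) * exp (- ?e (x - h) y)) / 2)\<^sup>2"
      by (rule am_gm)
    finally show ?thesis
      by (rule power2_le_imp_le) (use t in \<open>auto intro!: add_nonneg_nonneg\<close>)
  qed
  have "sconv \<psi> x * exp (- A / 2 * (norm h)\<^sup>2) = (\<integral>y. exp (- ?e x y) * exp (- A / 2 * (norm h)\<^sup>2) \<partial>lborel)"
    unfolding sconv_def by simp
  also have "\<dots> \<le> (\<integral>y. (t * exp (- ?e (x + h) y) + (1 / t) * exp (- ?e (x - h) y)) / 2 \<partial>lborel)"
    using pt by (intro integral_mono integrable_mult_left integrable_divide Bochner_Integration.integrable_add integrable_mult_right sconv_integrable)
  also have "\<dots> = (t * p + (1 / t) * q) / 2"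
    unfolding p_def q_def sconv_def using sconv_integrable[of "x + h"] sconv_integrable[of "x - h"]
    by (subst Bochner_Integration.integral_divide_zero, subst Bochner_Integration.integral_add) auto
  also have "\<dots> = sqrt (p * q)"
  proof (rule real_sqrt_unique[symmetric])
    have "(1 / t) * q = t * p" using t pq by (simp add: field_simps)
    then have "((t * p + (1 / t) * q) / 2) = t * p" by simp
    moreover have "(t * p)\<^sup>2 = p * q" using t pq by (simp add: power2_eq_square algebra_simps)
    ultimately show "((t * p + (1 / t) * q) / 2)\<^sup>2 = p * q" by (simp only:)
  qed (use t pq in auto)
  finally have "(sconv \<psi> x * exp (- A / 2 * (norm h)\<^sup>2))\<^sup>2 \<le> (sqrt (p * q))\<^sup>2"
    using less_imp_le[OF sconv_pos] by (intro power_mono) auto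
  then show ?thesis
    using pq by (simp add: power_mult_distrib p_def q_def exp_double[symmetric])
qed

text \<open>These are the logarithms of the two product inequalities. The constant \<open>A\<close>
  is not worsened, so the self-convolved pair competes for the same extremal constant.\<close>

lemma potential_spot: "potential A (spot \<psi>)"
proof (rule potentialI)
  show "spot \<psi> (- x) = spot \<psi> x" for x by (simp add: spot_def sconv_even)
  show "spot \<psi> 0 = 0" by (simp add: spot_def)
  fix x h
  have "ln (sconv \<psi> (x + h) * sconv \<psi> (x - h)) \<le> ln ((sconv \<psi> x)\<^sup>2)"
    by (intro ln_mono sconv_midpoint mult_pos_pos sconv_pos)
  then show "2 * spot \<psi> x \<le> spot \<psi> (x + h) + spot \<psi> (x - h)"
    using sconv_pos[of "x + h"] sconv_pos[of "x - h"] by (simp add: spot_def ln_mult ln_realpow)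
  have "ln ((sconv \<psi> x)\<^sup>2 * exp (- A * (norm h)\<^sup>2)) \<le> ln (sconv \<psi> (x + h) * sconv \<psi> (x - h))"
    by (intro ln_mono sconv_midpoint_upper mult_pos_pos zero_less_power sconv_pos exp_gt_zero)
  then show "spot \<psi> (x + h) + spot \<psi> (x - h) \<le> 2 * spot \<psi> x + A * (norm h)\<^sup>2"
    using sconv_pos[of x] sconv_pos[of "x + h"] sconv_pos[of "x - h"] by (simp add: spot_def ln_mult ln_realpow)
qed

lemma gint_spot: "gint (spot \<psi>) * sconv \<psi> 0 = (gint \<psi>)\<^sup>2"
proof -
  have e: "exp (- spot \<psi> x - (norm x)\<^sup>2 / 2) = (1 / sconv \<psi> 0) * (sconv \<psi> x * exp (- (norm x)\<^sup>2 / 2))" for x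
  proof -
    have "exp (- spot \<psi> x - (norm x)\<^sup>2 / 2) = exp (- spot \<psi> x) * exp (- (norm x)\<^sup>2 / 2)"
      by (simp add: exp_add[symmetric])
    then show ?thesis by (simp add: exp_spot)
  qed
  have "ennreal (gint (spot \<psi>)) = (\<integral>\<^sup>+x. ennreal (exp (- spot \<psi> x - (norm x)\<^sup>2 / 2)) \<partial>lborel)"
    unfolding gint_def using potential_nonneg[OF potential_spot] potential_measurable[OF potential_spot]
    by (intro nn_integral_eq_integral[symmetric] gint_integrable) auto
  also have "\<dots> = (\<integral>\<^sup>+x. ennreal (1 / sconv \<psi> 0) * ennreal (sconv \<psi> x * exp (- (norm x)\<^sup>2 / 2)) \<partial>lborel)"
    unfolding e using less_imp_le[OF sconv_pos] by (intro nn_integral_cong) (simp add: ennreal_mult[symmetric])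
  also have "\<dots> = ennreal (1 / sconv \<psi> 0) * ennreal ((gint \<psi>)\<^sup>2)"
    unfolding integral_sconv[symmetric] by (rule nn_integral_cmult) measurable
  finally have "gint (spot \<psi>) = (1 / sconv \<psi> 0) * (gint \<psi>)\<^sup>2"
    using less_imp_le[OF sconv_pos[of 0]] less_imp_le[OF potential_gint_pos[OF potential_spot potential_spot]]
    by (simp add: ennreal_mult[symmetric] ennreal_inj)
  then show ?thesis using sconv_pos[of 0] by simp
qed

end

section \<open>Extremal pairs of potentials\<close>

text \<open>Pointwise convergence bounds the limit superior of the infimal convolutions by
  \<open>m\<close>, using near-optimal pairs of the limit problem. The maximum with \<open>m\<close>
  therefore converges to \<open>m\<close>, and raising the potential only lowers its Gaussian
  integral, so the inequality for each \<open>n\<close> survives the replacement.\<close>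

lemma gint_infconv_limit:
  fixes \<psi> \<phi> :: "nat \<Rightarrow> 'a::euclidean_space \<Rightarrow> real"
  assumes p: "\<And>n. potential A (\<psi> n)" and q: "\<And>n. potential A (\<phi> n)" and mu: "\<mu> > 0"
    and lim1: "\<And>x. (\<lambda>n. \<psi> n x) \<longlonglongrightarrow> \<psi>' x" and lim2: "\<And>x. (\<lambda>n. \<phi> n x) \<longlonglongrightarrow> \<phi>' x"
    and C: "C \<longlonglongrightarrow> c" "\<And>n. 0 \<le> C n"
    and le: "\<And>n. C n * (gint (infconv \<mu> (\<psi> n) (\<phi> n)))\<^sup>2 \<le> gint (\<psi> n) * gint (\<phi> n)"
  shows "c * (gint (infconv \<mu> \<psi>' \<phi>'))\<^sup>2 \<le> gint \<psi>' * gint \<phi>'"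
proof -
  have p': "potential A \<psi>'" by (rule potential_limit[OF p lim1])
  have q': "potential A \<phi>'" by (rule potential_limit[OF q lim2])
  define m where "m = infconv \<mu> \<psi>' \<phi>'"
  define k where "k = (\<lambda>n x. max (infconv \<mu> (\<psi> n) (\<phi> n) x) (m x))"
  have pm: "potential (A * (1 / \<mu>\<^sup>2 + \<mu>\<^sup>2) / 2) m" unfolding m_def by (rule potential_infconv[OF p' q' mu])
  have pn: "potential (A * (1 / \<mu>\<^sup>2 + \<mu>\<^sup>2) / 2) (infconv \<mu> (\<psi> n) (\<phi> n))" for n by (rule potential_infconv[OF p q mu])
  note nn = potential_nonneg[OF p'] potential_nonneg[OF q']
  have [measurable]: "m \<in> borel_measurable borel" "\<And>n. infconv \<mu> (\<psi> n) (\<phi> n) \<in> borel_measurable borel"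
    using pm pn by (auto intro: potential_measurable)
  have kn: "0 \<le> k n x" for n x using potential_nonneg[OF pm, of x] by (simp add: k_def max_def)
  have "(\<lambda>n. gint (k n)) \<longlonglongrightarrow> gint m"
  proof (rule gint_tendsto[OF _ _ kn])
    show "k n \<in> borel_measurable borel" for n unfolding k_def by measurable
    show "(\<lambda>n. k n x) \<longlonglongrightarrow> m x" for x
    proof (rule LIMSEQ_I)
      fix e :: real assume e: "0 < e"
      have "\<exists>a b. \<mu> *\<^sub>R a + (1 / \<mu>) *\<^sub>R b = 2 *\<^sub>R x \<and> (\<psi>' a + \<phi>' b) / 2 < m x + e"
      proof (rule ccontr)
        assume "\<not> ?thesis"
        then have "m x + e \<le> (\<psi>' a + \<phi>' b) / 2" if "\<mu> *\<^sub>R a + (1 / \<mu>) *\<^sub>R b = 2 *\<^sub>R x" for a b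
          using that by (metis not_less)
        then have "m x + e \<le> m x" unfolding m_def by (intro infconv_greatest[OF nn mu]) auto
        then show False using e by simp
      qed
      then obtain a b where ab: "\<mu> *\<^sub>R a + (1 / \<mu>) *\<^sub>R b = 2 *\<^sub>R x" "(\<psi>' a + \<phi>' b) / 2 < m x + e" by blast
      have "(\<lambda>n. (\<psi> n a + \<phi> n b) / 2) \<longlonglongrightarrow> (\<psi>' a + \<phi>' b) / 2" by (intro tendsto_intros lim1 lim2) simp
      then have "eventually (\<lambda>n. (\<psi> n a + \<phi> n b) / 2 < m x + e) sequentially" using ab(2) by (rule order_tendstoD)
      then obtain N where N: "\<And>n. n \<ge> N \<Longrightarrow> (\<psi> n a + \<phi> n b) / 2 < m x + e" by (auto simp: eventually_sequentially)
      have "norm (k n x - m x) < e" if "n \<ge> N" for n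
      proof -
        have "infconv \<mu> (\<psi> n) (\<phi> n) x \<le> (\<psi> n a + \<phi> n b) / 2"
          by (rule infconv_le[OF potential_nonneg[OF p] potential_nonneg[OF q] mu ab(1)])
        then show ?thesis using N[OF that] e by (simp add: k_def max_def)
      qed
      then show "\<exists>N. \<forall>n\<ge>N. norm (k n x - m x) < e" by blast
    qed
  qed measurable
  moreover have "C n * (gint (k n))\<^sup>2 \<le> gint (\<psi> n) * gint (\<phi> n)" for n
  proof -
    have "gint (k n) \<le> gint (infconv \<mu> (\<psi> n) (\<phi> n))"
      by (rule gint_mono) (auto simp: k_def potential_nonneg[OF pn])
    moreover have "0 \<le> gint (k n)" by (simp add: gint_def)
    ultimately have "C n * (gint (k n))\<^sup>2 \<le> C n * (gint (infconv \<mu> (\<psi> n) (\<phi> n)))\<^sup>2"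
      using C(2) by (intro mult_left_mono power_mono) auto
    with le[of n] show ?thesis by simp
  qed
  moreover have "(\<lambda>n. gint (\<psi> n)) \<longlonglongrightarrow> gint \<psi>'"
    by (rule gint_tendsto[OF potential_measurable[OF p] potential_measurable[OF p'] potential_nonneg[OF p] lim1])
  moreover have "(\<lambda>n. gint (\<phi> n)) \<longlonglongrightarrow> gint \<phi>'"
    by (rule gint_tendsto[OF potential_measurable[OF q] potential_measurable[OF q'] potential_nonneg[OF q] lim2])
  ultimately show ?thesis
    unfolding m_def[symmetric]
    by (intro LIMSEQ_le[OF tendsto_mult[OF C(1) tendsto_power] tendsto_mult]) auto
qed

text \<open>An Arzela--Ascoli argument: convergence on a countable dense set, extended to all points
  by the Lipschitz bound that the class shares. Treating the pairs as one function yields a common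
  subsequence.\<close>

lemma potential_subsequence:
  fixes \<psi> \<phi> :: "nat \<Rightarrow> 'a::euclidean_space \<Rightarrow> real"
  assumes p: "\<And>n. potential A (\<psi> n)" and q: "\<And>n. potential A (\<phi> n)"
  obtains r \<psi>' \<phi>' where "strict_mono (r::nat \<Rightarrow> nat)"
    "\<And>x. (\<lambda>n. \<psi> (r n) x) \<longlonglongrightarrow> \<psi>' x" "\<And>x. (\<lambda>n. \<phi> (r n) x) \<longlonglongrightarrow> \<phi>' x"
proof -
  obtain D :: "'a set" where D: "countable D" "\<And>X. open X \<Longrightarrow> X \<noteq> {} \<Longrightarrow> \<exists>d\<in>D. d \<in> X"
    using countable_dense_exists by blast
  have A: "0 \<le> A" using potential_const_nonneg[OF p] .
  \<comment> \<open>Dividing by this quadratic weight makes the family uniformly bounded, as the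
    diagonal argument requires.\<close>
  define w where "w x = 1 + A / 2 * (norm x)\<^sup>2" for x :: 'a
  have w: "0 < w x" for x using A by (simp add: w_def add_pos_nonneg)
  have b: "\<bar>\<theta> x / w x\<bar> \<le> 1" if "potential A \<theta>" for \<theta> x
    using potential_nonneg[OF that, of x] potential_le_norm[OF that, of x] w[of x] by (simp add: w_def field_simps)
  define f where "f n x = (\<psi> n x / w x, \<phi> n x / w x)" for n x
  have "norm (f n x) \<le> 2" for n x
    using norm_Pair_le[of "\<psi> n x / w x" "\<phi> n x / w x"] b[OF p, of n x] b[OF q, of n x] by (simp add: f_def)
  then obtain r where r: "strict_mono (r::nat \<Rightarrow> nat)" "\<And>x. x \<in> D \<Longrightarrow> \<exists>l. (\<lambda>n. f (r n) x) \<longlonglongrightarrow> l"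
    using function_convergent_subsequence[OF D(1), of f 2] by metis
  have conv: "convergent (\<lambda>n. \<theta> (r n) x)"
    if pc: "\<And>n. potential A (\<theta> n)" and cD: "\<And>d. d \<in> D \<Longrightarrow> convergent (\<lambda>n. \<theta> (r n) d / w d)" for \<theta> and x :: 'a
  proof -
    have cD': "Cauchy (\<lambda>n. \<theta> (r n) d)" if "d \<in> D" for d
    proof -
      have "convergent (\<lambda>n. \<theta> (r n) d / w d)" by (rule cD[OF that])
      then obtain l where "(\<lambda>n. \<theta> (r n) d / w d) \<longlonglongrightarrow> l" by (auto simp: convergent_def)
      then have "(\<lambda>n. w d * (\<theta> (r n) d / w d)) \<longlonglongrightarrow> w d * l" by (intro tendsto_intros)
      then have "(\<lambda>n. \<theta> (r n) d) \<longlonglongrightarrow> w d * l" using w[of d] by simp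
      then show ?thesis by (rule LIMSEQ_imp_Cauchy)
    qed
    have "Cauchy (\<lambda>n. \<theta> (r n) x)"
    proof (rule metric_CauchyI)
      fix e :: real assume e: "0 < e"
      define K where "K = A * (norm x + 3)\<^sup>2 + 1"
      have K: "0 < K" using A by (simp add: K_def add_nonneg_pos)
      have "0 < min 1 (e / (3 * K))" using e K by simp
      then have "\<exists>d\<in>D. d \<in> ball x (min 1 (e / (3 * K)))" by (intro D(2)) (simp_all del: min_less_iff_conj)
      then obtain d where d: "d \<in> D" "d \<in> ball x (min 1 (e / (3 * K)))" by blast
      have near: "dist (\<theta> n x) (\<theta> n d) < e / 3" for n
      proof -
        have n1: "norm (d - x) \<le> 1" and n2: "norm (d - x) < e / (3 * K)"
          using d(2) by (auto simp: dist_norm norm_minus_commute)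
        have "\<bar>\<theta> n (x + (d - x)) - \<theta> n x\<bar> \<le> A * (norm x + 3)\<^sup>2 * norm (d - x)"
          by (rule potential_lipschitz[OF pc n1])
        also have "\<dots> \<le> K * norm (d - x)" by (intro mult_right_mono) (auto simp: K_def)
        also have "\<dots> < K * (e / (3 * K))" using n2 K by (intro mult_strict_left_mono)
        also have "\<dots> = e / 3" using K by simp
        finally show ?thesis by (simp add: dist_real_def abs_minus_commute)
      qed
      obtain N where N: "\<And>m n. m \<ge> N \<Longrightarrow> n \<ge> N \<Longrightarrow> dist (\<theta> (r m) d) (\<theta> (r n) d) < e / 3"
        using metric_CauchyD[OF cD'[OF d(1)], of "e / 3"] e by auto
      have "dist (\<theta> (r m) x) (\<theta> (r n) x) < e" if "m \<ge> N" "n \<ge> N" for m n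
      proof -
        have "dist (\<theta> (r m) x) (\<theta> (r n) x) \<le> dist (\<theta> (r m) x) (\<theta> (r m) d) + (dist (\<theta> (r m) d) (\<theta> (r n) d) + dist (\<theta> (r n) d) (\<theta> (r n) x))"
          by (meson add_left_mono dist_triangle order_trans)
        then show ?thesis using near[of "r m"] near[of "r n"] N[OF that] by (simp add: dist_commute)
      qed
      then show "\<exists>N. \<forall>m\<ge>N. \<forall>n\<ge>N. dist (\<theta> (r m) x) (\<theta> (r n) x) < e" by blast
    qed
    then show ?thesis by (simp add: Cauchy_convergent_iff)
  qed
  have "convergent (\<lambda>n. \<psi> (r n) x)" "convergent (\<lambda>n. \<phi> (r n) x)" for x
  proof -
    have *: "convergent (\<lambda>n. \<psi> (r n) d / w d)" "convergent (\<lambda>n. \<phi> (r n) d / w d)" if "d \<in> D" for d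
      using r(2)[OF that] tendsto_fst tendsto_snd unfolding f_def convergent_def by fastforce+
    show "convergent (\<lambda>n. \<psi> (r n) x)" "convergent (\<lambda>n. \<phi> (r n) x)"
      using conv[of \<psi>, OF p *(1)] conv[of \<phi>, OF q *(2)] by auto
  qed
  then show ?thesis using that[OF r(1), of "\<lambda>x. lim (\<lambda>n. \<psi> (r n) x)" "\<lambda>x. lim (\<lambda>n. \<phi> (r n) x)"]
    by (simp add: convergent_LIMSEQ_iff)
qed

text \<open>Only the attained half is recorded; that \<open>C\<close> also bounds the quotient for
  every pair of the class is carried as a separate hypothesis.\<close>

definition extremal :: "real \<Rightarrow> real \<Rightarrow> real \<Rightarrow> ('a::euclidean_space \<Rightarrow> real) \<Rightarrow> ('a \<Rightarrow> real) \<Rightarrow> bool" where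
  "extremal A \<mu> C \<psi> \<phi> \<longleftrightarrow> potential A \<psi> \<and> potential A \<phi> \<and> C * (gint (infconv \<mu> \<psi> \<phi>))\<^sup>2 \<le> gint \<psi> * gint \<phi>"

text \<open>\<open>C\<close> is the supremum of the quotient \<open>R\<close>. It is finite because
  numerators are at most the value for zero potentials, while each infimal convolution lies below a
  fixed quadratic whose Gaussian integral is \<open>d\<close>. It is attained in the limit of a
  maximising sequence.\<close>

lemma extremal_exists:
  assumes A: "0 \<le> A" and mu: "\<mu> > 0"
  obtains C and \<psi> \<phi> :: "'a::euclidean_space \<Rightarrow> real" where "C > 0" "extremal A \<mu> C \<psi> \<phi>"
    "\<And>\<psi> \<phi> :: 'a \<Rightarrow> real. potential A \<psi> \<Longrightarrow> potential A \<phi> \<Longrightarrow> gint \<psi> * gint \<phi> \<le> C * (gint (infconv \<mu> \<psi> \<phi>))\<^sup>2"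
proof -
  let ?B = "A * (1 / \<mu>\<^sup>2 + \<mu>\<^sup>2) / 2"
  define R where "R p = gint (fst p) * gint (snd p) / (gint (infconv \<mu> (fst p) (snd p)))\<^sup>2" for p :: "('a \<Rightarrow> real) \<times> ('a \<Rightarrow> real)"
  define S where "S = {p :: ('a \<Rightarrow> real) \<times> ('a \<Rightarrow> real). potential A (fst p) \<and> potential A (snd p)}"
  have pz: "potential A (\<lambda>_::'a. 0)" using A by (auto intro!: potentialI)
  have ipos: "0 < gint (infconv \<mu> (fst p) (snd p))" if "p \<in> S" for p
    using that potential_infconv[OF _ _ mu, of A "fst p" "snd p"] potential_gint_pos by (auto simp: S_def)
  have gle: "gint \<psi> \<le> gint (\<lambda>_::'a. 0)" if "potential A \<psi>" for \<psi> :: "'a \<Rightarrow> real"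
    by (rule gint_mono) (use that in \<open>auto intro: potential_measurable potential_nonneg\<close>)
  define d where "d = gint (\<lambda>x::'a. ?B / 2 * (norm x)\<^sup>2)"
  have d: "0 < d" unfolding d_def by (rule gint_pos) (use A in auto)
  have bound: "R p \<le> (gint (\<lambda>_::'a. 0))\<^sup>2 / d\<^sup>2" if "p \<in> S" for p
  proof -
    have pp: "potential A (fst p)" "potential A (snd p)" using that by (auto simp: S_def)
    have pi: "potential ?B (infconv \<mu> (fst p) (snd p))" by (rule potential_infconv[OF pp mu])
    have "d \<le> gint (infconv \<mu> (fst p) (snd p))" unfolding d_def
      by (rule gint_mono[OF potential_measurable[OF pi] _ potential_nonneg[OF pi] potential_le_norm[OF pi]]) measurable
    then show ?thesis unfolding R_def power2_eq_square[of "gint (\<lambda>_::'a. 0)"]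
      using d gle[OF pp(1)] gle[OF pp(2)] potential_gint_pos[OF pp(1) pp(1)] potential_gint_pos[OF pp(2) pp(2)]
      by (intro frac_le mult_mono power_mono) (auto intro: less_imp_le)
  qed
  have S: "(\<lambda>_. 0, \<lambda>_. 0) \<in> S" using pz by (simp add: S_def)
  define C where "C = (SUP p\<in>S. R p)"
  have bdd: "bdd_above (R ` S)" using bound by (auto intro!: bdd_aboveI)
  have RC: "R p \<le> C" if "p \<in> S" for p unfolding C_def by (rule cSUP_upper[OF that bdd])
  have "0 < R (\<lambda>_. 0, \<lambda>_. 0)" unfolding R_def using ipos[OF S] potential_gint_pos[OF pz pz] by simp
  then have C: "0 < C" using RC[OF S] by simp
  have "\<exists>p\<in>S. C - C / real (n + 2) < R p" for n
  proof -
    have "C - C / real (n + 2) < C" using C by simp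
    then show ?thesis unfolding C_def using less_cSUP_iff[of S R "C - C / real (n + 2)", OF _ bdd] S by (auto simp: C_def)
  qed
  then obtain p where p: "\<And>n. p n \<in> S" "\<And>n. C - C / real (n + 2) < R (p n)" by metis
  have pp: "potential A (fst (p n))" "potential A (snd (p n))" for n using p(1)[of n] by (auto simp: S_def)
  obtain r \<psi> \<phi> where r: "strict_mono (r::nat \<Rightarrow> nat)"
    "\<And>x. (\<lambda>n. fst (p (r n)) x) \<longlonglongrightarrow> \<psi> x" "\<And>x. (\<lambda>n. snd (p (r n)) x) \<longlonglongrightarrow> \<phi> x"
    by (rule potential_subsequence[of A "\<lambda>n. fst (p n)" "\<lambda>n. snd (p n)", OF pp]) blast
  have "C * (gint (infconv \<mu> \<psi> \<phi>))\<^sup>2 \<le> gint \<psi> * gint \<phi>"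
  proof (rule gint_infconv_limit[OF pp mu r(2,3)])
    have "(\<lambda>n. C - C / real (n + 2)) \<longlonglongrightarrow> C - 0"
      by (intro tendsto_intros tendsto_divide_0[OF tendsto_const] filterlim_at_top_imp_at_infinity
          filterlim_compose[OF filterlim_real_sequentially] filterlim_add_const_nat_at_top)
    then show "(\<lambda>n. C - C / real (r n + 2)) \<longlonglongrightarrow> C"
      using LIMSEQ_subseq_LIMSEQ[OF _ r(1)] by (fastforce simp: o_def)
    show "0 \<le> C - C / real (r n + 2)" for n using C by (simp add: field_simps)
    show "(C - C / real (r n + 2)) * (gint (infconv \<mu> (fst (p (r n))) (snd (p (r n)))))\<^sup>2 \<le> gint (fst (p (r n))) * gint (snd (p (r n)))" for n
      using p(2)[of "r n"] ipos[OF p(1), of "r n"] by (simp add: R_def pos_less_divide_eq less_imp_le)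
  qed
  then have "extremal A \<mu> C \<psi> \<phi>" unfolding extremal_def
    using potential_limit[of A "\<lambda>n. fst (p (r n))", OF pp(1) r(2)] potential_limit[of A "\<lambda>n. snd (p (r n))", OF pp(2) r(3)] by simp
  moreover have "gint \<psi> * gint \<phi> \<le> C * (gint (infconv \<mu> \<psi> \<phi>))\<^sup>2" if "potential A \<psi>" "potential A \<phi>" for \<psi> \<phi> :: "'a \<Rightarrow> real"
    using RC[of "(\<psi>, \<phi>)"] ipos[of "(\<psi>, \<phi>)"] that by (simp add: R_def S_def pos_divide_le_eq)
  ultimately show ?thesis using that C by blast
qed

lemma zero_if_integral_zero:
  fixes f :: "'a::euclidean_space \<Rightarrow> real"
  assumes cont: "continuous_on UNIV f" and nn: "\<And>x. 0 \<le> f x" and int: "integrable lborel f" and z: "(\<integral>x. f x \<partial>lborel) = 0"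
  shows "f x = 0"
proof -
  have "AE x in lborel. f x = 0"
    using z nn by (subst (asm) integral_nonneg_eq_0_iff_AE[OF int]) auto
  then have "AE x in lebesgue. x \<in> {x. f x = 0}" by (simp add: AE_completion)
  moreover have "closed {x. f x = 0}"
    using cont by (intro closed_Collect_eq) auto
  ultimately show ?thesis using mem_closed_if_AE_lebesgue by blast
qed

text \<open>Two opposite estimates meet. The extremal bound for slices, integrated over the heights,
  gives \<open>k * gint m' \<le> (gint m)\<^sup>2\<close>; the extremal bound for the self-convolved
  pair, combined with extremality of the given pair, gives the reverse. Equality yields the first
  claim and forces the two continuous integrands to agree; their value at 0 yields the
  second.\<close>

lemma extremal_step:
  fixes \<psi> \<phi> :: "'a::euclidean_space \<Rightarrow> real"
  assumes mu: "\<mu> > 0" and C: "C > 0" and ex: "extremal A \<mu> C \<psi> \<phi>"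
    and max: "\<And>\<psi> \<phi> :: 'a \<Rightarrow> real. potential A \<psi> \<Longrightarrow> potential A \<phi> \<Longrightarrow> gint \<psi> * gint \<phi> \<le> C * (gint (infconv \<mu> \<psi> \<phi>))\<^sup>2"
  shows "extremal A \<mu> C (spot \<psi>) (spot \<phi>)" (is ?spot)
    and "extremal A \<mu> C (\<lambda>x. 2 * \<psi> ((1 / sqrt 2) *\<^sub>R x)) (\<lambda>x. 2 * \<phi> ((1 / sqrt 2) *\<^sub>R x))" (is ?scaled)
proof -
  have p: "potential A \<psi>" and q: "potential A \<phi>" and exle: "C * (gint (infconv \<mu> \<psi> \<phi>))\<^sup>2 \<le> gint \<psi> * gint \<phi>"
    using ex by (auto simp: extremal_def)
  let ?B = "A * (1 / \<mu>\<^sup>2 + \<mu>\<^sup>2) / 2"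
  define m where "m = infconv \<mu> \<psi> \<phi>"
  define m' where "m' = infconv \<mu> (spot \<psi>) (spot \<phi>)"
  \<comment> \<open>\<open>c\<close> collects the normalisations separating \<open>sconv\<close>
    from \<open>exp (- spot)\<close>; \<open>k\<close> is determined by
    \<open>C * k\<^sup>2 = c\<close>.\<close>
  define c where "c = sconv \<psi> 0 * sconv \<phi> 0"
  define k where "k = sqrt (c / C)"
  have pm: "potential ?B m" unfolding m_def by (rule potential_infconv[OF p q mu])
  have ps: "potential A (spot \<psi>)" "potential A (spot \<phi>)" using p q by (auto intro: potential_spot)
  have pm': "potential ?B m'" unfolding m'_def by (rule potential_infconv[OF ps mu])
  have c: "0 < c" unfolding c_def using sconv_pos[OF p] sconv_pos[OF q] by simp
  have k: "0 < k" "C * k\<^sup>2 = c" using c C by (simp_all add: k_def)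
  let ?r = "\<lambda>x. (1 / sqrt 2) *\<^sub>R x"
  note mle = infconv_le[of \<psi> \<phi> \<mu>, OF potential_nonneg[OF p] potential_nonneg[OF q] mu, folded m_def]
  have claim1: "sconv \<psi> x * sconv \<phi> y \<le> C * (sconv m z)\<^sup>2" if xy: "\<mu> *\<^sub>R x + (1 / \<mu>) *\<^sub>R y = 2 *\<^sub>R z" for x y z
  proof -
    define n where "n = infconv \<mu> (slice \<psi> x) (slice \<phi> y)"
    have sl: "potential A (slice \<psi> x)" "potential A (slice \<phi> y)" using p q by (auto intro: potential_slice)
    have pn: "potential ?B n" unfolding n_def by (rule potential_infconv[OF sl mu])
    \<comment> \<open>Rotation of admissible pairs: if \<open>(a, b)\<close> is admissible for
      \<open>s\<close> and \<open>(x, y)\<close> for \<open>z\<close>, their scaled sum and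
      difference are admissible for \<open>?r (s + z)\<close> and \<open>?r (s - z)\<close>.\<close>
    have le: "m (?r (s + z)) + m (?r (s - z)) - \<psi> (?r x) - \<phi> (?r y) \<le> n s" for s
      unfolding n_def
    proof (rule infconv_greatest[OF potential_nonneg[OF sl(1)] potential_nonneg[OF sl(2)] mu])
      fix a b assume ab: "\<mu> *\<^sub>R a + (1 / \<mu>) *\<^sub>R b = 2 *\<^sub>R s"
      have "\<mu> *\<^sub>R ?r (a + x) + (1 / \<mu>) *\<^sub>R ?r (b + y) = ?r ((\<mu> *\<^sub>R a + (1 / \<mu>) *\<^sub>R b) + (\<mu> *\<^sub>R x + (1 / \<mu>) *\<^sub>R y))"
        "\<mu> *\<^sub>R ?r (a - x) + (1 / \<mu>) *\<^sub>R ?r (b - y) = ?r ((\<mu> *\<^sub>R a + (1 / \<mu>) *\<^sub>R b) - (\<mu> *\<^sub>R x + (1 / \<mu>) *\<^sub>R y))"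
        by (simp_all add: algebra_simps)
      then have 1: "\<mu> *\<^sub>R ?r (a + x) + (1 / \<mu>) *\<^sub>R ?r (b + y) = 2 *\<^sub>R ?r (s + z)"
        and 2: "\<mu> *\<^sub>R ?r (a - x) + (1 / \<mu>) *\<^sub>R ?r (b - y) = 2 *\<^sub>R ?r (s - z)"
        unfolding ab xy by (simp_all add: algebra_simps)
      show "m (?r (s + z)) + m (?r (s - z)) - \<psi> (?r x) - \<phi> (?r y) \<le> (slice \<psi> x a + slice \<phi> y b) / 2"
        using mle[OF 1] mle[OF 2] unfolding slice_def by argo
    qed
    have "exp (- (\<psi> (?r x) + \<phi> (?r y))) * gint n \<le> sconv m z"
    proof -
      have "exp (- (\<psi> (?r x) + \<phi> (?r y))) * gint n = (\<integral>s. exp (- (\<psi> (?r x) + \<phi> (?r y))) * exp (- n s - (norm s)\<^sup>2 / 2) \<partial>lborel)"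
        unfolding gint_def by simp
      also have "\<dots> \<le> sconv m z" unfolding sconv_def
      proof (rule integral_mono)
        show "integrable lborel (\<lambda>s. exp (- (\<psi> (?r x) + \<phi> (?r y))) * exp (- n s - (norm s)\<^sup>2 / 2))"
          by (intro integrable_mult_right gint_integrable potential_measurable[OF pn] potential_nonneg[OF pn])
        show "exp (- (\<psi> (?r x) + \<phi> (?r y))) * exp (- n s - (norm s)\<^sup>2 / 2) \<le> exp (- (m (?r (s + z)) + m (?r (s - z)) + (norm s)\<^sup>2 / 2))" for s
          unfolding exp_add[symmetric] exp_le_cancel_iff using le[of s] by argo
      qed (rule sconv_integrable[OF pm])
      finally show ?thesis .
    qed
    then have "(exp (- (\<psi> (?r x) + \<phi> (?r y))) * gint n)\<^sup>2 \<le> (sconv m z)\<^sup>2"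
      using less_imp_le[OF potential_gint_pos[OF pn pn]] by (intro power_mono) auto
    then have "(exp (- (\<psi> (?r x) + \<phi> (?r y))))\<^sup>2 * (C * (gint n)\<^sup>2) \<le> C * (sconv m z)\<^sup>2"
      using C by (simp add: power_mult_distrib)
    moreover have "(exp (- (\<psi> (?r x) + \<phi> (?r y))))\<^sup>2 * (gint (slice \<psi> x) * gint (slice \<phi> y)) \<le> (exp (- (\<psi> (?r x) + \<phi> (?r y))))\<^sup>2 * (C * (gint n)\<^sup>2)"
      using max[OF sl] unfolding n_def by (intro mult_left_mono) auto
    moreover have "sconv \<psi> x * sconv \<phi> y = (exp (- (\<psi> (?r x) + \<phi> (?r y))))\<^sup>2 * (gint (slice \<psi> x) * gint (slice \<phi> y))"
      unfolding sconv_eq_slice[OF p] sconv_eq_slice[OF q] exp_double[symmetric] by (simp add: exp_add[symmetric] algebra_simps)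
    ultimately show ?thesis by linarith
  qed
  \<comment> \<open>Taking the infimum over all admissible \<open>x\<close>, \<open>y\<close> in the
    previous claim replaces the product of self-convolutions by the infimal convolution of their
    potentials.\<close>
  have claim2: "k * exp (- m' z) \<le> sconv m z" for z
  proof -
    have sm: "0 < sconv m z" by (rule sconv_pos[OF pm])
    have "- ln (sconv m z / k) \<le> m' z" unfolding m'_def
    proof (rule infconv_greatest[OF potential_nonneg[OF ps(1)] potential_nonneg[OF ps(2)] mu])
      fix x y assume xy: "\<mu> *\<^sub>R x + (1 / \<mu>) *\<^sub>R y = 2 *\<^sub>R z"
      have "sconv \<psi> x = sconv \<psi> 0 * exp (- spot \<psi> x)" "sconv \<phi> y = sconv \<phi> 0 * exp (- spot \<phi> y)"
        using exp_spot[OF p, of x] exp_spot[OF q, of y] sconv_pos[OF p, of 0] sconv_pos[OF q, of 0] by simp_all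
      moreover have "exp (- (spot \<psi> x + spot \<phi> y)) = exp (- spot \<psi> x) * exp (- spot \<phi> y)"
        by (simp add: exp_add[symmetric])
      ultimately have "c * exp (- (spot \<psi> x + spot \<phi> y)) = sconv \<psi> x * sconv \<phi> y"
        unfolding c_def by (simp only: mult_ac)
      then have "C * k\<^sup>2 * exp (- (spot \<psi> x + spot \<phi> y)) \<le> C * (sconv m z)\<^sup>2"
        using claim1[OF xy] unfolding k(2) by simp
      then have "k\<^sup>2 * exp (- (spot \<psi> x + spot \<phi> y)) \<le> (sconv m z)\<^sup>2" using C by simp
      then have "exp (- (spot \<psi> x + spot \<phi> y)) \<le> (sconv m z / k)\<^sup>2"
        using k(1) by (simp add: power_divide pos_le_divide_eq mult.commute)
      then have "ln (exp (- (spot \<psi> x + spot \<phi> y))) \<le> ln ((sconv m z / k)\<^sup>2)"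
        by (intro ln_mono) auto
      also have "\<dots> = 2 * ln (sconv m z / k)" using sm k(1) by (simp add: ln_realpow)
      finally show "- ln (sconv m z / k) \<le> (spot \<psi> x + spot \<phi> y) / 2" by simp
    qed
    then have "exp (- m' z) \<le> exp (ln (sconv m z / k))" by simp
    also have "\<dots> = sconv m z / k" using sm k(1) by simp
    finally show ?thesis using k(1) by (simp add: pos_le_divide_eq mult.commute)
  qed
  have sc: "sconv m z = sconv m 0 * exp (- spot m z)" for z
    using exp_spot[OF pm, of z] sconv_pos[OF pm, of 0] by simp
  have psm: "potential ?B (spot m)" by (rule potential_spot[OF pm])
  let ?w = "\<lambda>z::'a. exp (- (norm z)\<^sup>2 / 2)"
  have i1: "integrable lborel (\<lambda>z. sconv m z * ?w z)" "(\<integral>z. sconv m z * ?w z \<partial>lborel) = (gint m)\<^sup>2"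
  proof -
    have e: "sconv m z * ?w z = sconv m 0 * exp (- spot m z - (norm z)\<^sup>2 / 2)" for z
      unfolding sc[of z] by (simp add: exp_add[symmetric])
    show "integrable lborel (\<lambda>z. sconv m z * ?w z)" unfolding e
      by (intro integrable_mult_right gint_integrable potential_measurable[OF psm] potential_nonneg[OF psm])
    show "(\<integral>z. sconv m z * ?w z \<partial>lborel) = (gint m)\<^sup>2" unfolding e
      using gint_spot[OF pm] by (simp add: gint_def[of "spot m"] mult.commute)
  qed
  have i2: "integrable lborel (\<lambda>z. k * exp (- m' z) * ?w z)" "(\<integral>z. k * exp (- m' z) * ?w z \<partial>lborel) = k * gint m'"
  proof -
    have e: "k * exp (- m' z) * ?w z = k * exp (- m' z - (norm z)\<^sup>2 / 2)" for z by (simp add: exp_add[symmetric])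
    show "integrable lborel (\<lambda>z. k * exp (- m' z) * ?w z)" unfolding e
      by (intro integrable_mult_right gint_integrable potential_measurable[OF pm'] potential_nonneg[OF pm'])
    show "(\<integral>z. k * exp (- m' z) * ?w z \<partial>lborel) = k * gint m'" unfolding e by (simp add: gint_def)
  qed
  have gm: "0 < gint m" "0 < gint m'" using potential_gint_pos[OF pm pm] potential_gint_pos[OF pm' pm'] by auto
  have ub: "k * gint m' \<le> (gint m)\<^sup>2"
    unfolding i1(2)[symmetric] i2(2)[symmetric]
    by (rule integral_mono[OF i2(1) i1(1)]) (use claim2 in auto)
  have cs: "c * (gint (spot \<psi>) * gint (spot \<phi>)) = (gint \<psi> * gint \<phi>)\<^sup>2"
    using gint_spot[OF p] gint_spot[OF q] by (simp add: c_def power_mult_distrib mult_ac)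
  have gg: "0 \<le> gint \<psi> * gint \<phi>" by (simp add: gint_def)
  \<comment> \<open>The reverse estimate: extremality of the given pair on the left, the bound
    \<open>max\<close> for the self-convolved pair on the right.\<close>
  have "(C * (gint m)\<^sup>2)\<^sup>2 \<le> (gint \<psi> * gint \<phi>)\<^sup>2"
    using exle C unfolding m_def[symmetric] by (intro power_mono) auto
  also have "\<dots> \<le> c * (C * (gint m')\<^sup>2)"
    unfolding cs[symmetric] using max[OF ps] c unfolding m'_def by (intro mult_left_mono) auto
  also have "\<dots> = (C * (k * gint m'))\<^sup>2" unfolding k(2)[symmetric] by (simp add: power2_eq_square)
  finally have "C * (gint m)\<^sup>2 \<le> C * (k * gint m')"
    by (rule power2_le_imp_le) (use C k gm in auto)
  then have eq: "k * gint m' = (gint m)\<^sup>2" using ub C by simp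
  have "c * (C * (gint m')\<^sup>2) = (C * (gint m)\<^sup>2)\<^sup>2"
    unfolding eq[symmetric] k(2)[symmetric] by (simp add: power2_eq_square)
  also have "\<dots> \<le> (gint \<psi> * gint \<phi>)\<^sup>2"
    using exle C unfolding m_def[symmetric] by (intro power_mono) auto
  finally have "C * (gint m')\<^sup>2 \<le> gint (spot \<psi>) * gint (spot \<phi>)"
    unfolding cs[symmetric] using c by simp
  then show ?spot using ps by (simp add: extremal_def m'_def)

  \<comment> \<open>The difference of the two integrands is continuous, nonnegative and of integral
    zero, hence vanishes at 0.\<close>
  have "sconv m 0 * ?w 0 - k * exp (- m' 0) * ?w 0 = 0"
  proof (rule zero_if_integral_zero[of "\<lambda>z. sconv m z * ?w z - k * exp (- m' z) * ?w z"])
    show "continuous_on UNIV (\<lambda>z. sconv m z * ?w z - k * exp (- m' z) * ?w z)"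
    proof -
      have "continuous_on UNIV (\<lambda>z. sconv m 0 * exp (- spot m z))"
        by (intro continuous_intros potential_continuous[OF psm])
      then have "continuous_on UNIV (\<lambda>z. sconv m z)" by (simp add: sc[symmetric])
      then show ?thesis by (intro continuous_intros potential_continuous[OF pm']) auto
    qed
    show "0 \<le> sconv m z * ?w z - k * exp (- m' z) * ?w z" for z
      using mult_right_mono[OF claim2[of z], of "?w z"] by simp
    show "integrable lborel (\<lambda>z. sconv m z * ?w z - k * exp (- m' z) * ?w z)"
      by (rule Bochner_Integration.integrable_diff[OF i1(1) i2(1)])
    show "(\<integral>z. sconv m z * ?w z - k * exp (- m' z) * ?w z \<partial>lborel) = 0"
      by (subst Bochner_Integration.integral_diff[OF i1(1) i2(1)]) (simp only: i1(2) i2(2) eq diff_self)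
  qed
  then have s0: "sconv m 0 = k" using potential_zero[OF pm'] by simp
  have rescale: "potential A (\<lambda>x. 2 * \<theta> (?r x))" if "potential A \<theta>" for \<theta> :: "'a \<Rightarrow> real"
    using potential_rescale[OF that, of "sqrt 2"] by simp
  \<comment> \<open>At height 0 the slice is the rescaled potential itself; this is how rescaling
    enters.\<close>
  have sg: "sconv \<theta> 0 = gint (\<lambda>x. 2 * \<theta> (?r x))" for \<theta> :: "'a \<Rightarrow> real"
    unfolding sconv_def gint_def by (rule Bochner_Integration.integral_cong) (auto simp: algebra_simps)
  let ?S = "infconv \<mu> (\<lambda>x. 2 * \<psi> (?r x)) (\<lambda>x. 2 * \<phi> (?r x))"
  have pS: "potential ?B ?S" by (rule potential_infconv[OF rescale[OF p] rescale[OF q] mu])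
  have rB: "potential ?B (\<lambda>x. 2 * m (?r x))" using potential_rescale[OF pm, of "sqrt 2"] by simp
  have "2 * m (?r z) \<le> ?S z" for z
  proof (rule infconv_greatest[OF potential_nonneg[OF rescale[OF p]] potential_nonneg[OF rescale[OF q]] mu])
    fix x y assume xy: "\<mu> *\<^sub>R x + (1 / \<mu>) *\<^sub>R y = 2 *\<^sub>R z"
    have "\<mu> *\<^sub>R ?r x + (1 / \<mu>) *\<^sub>R ?r y = ?r (\<mu> *\<^sub>R x + (1 / \<mu>) *\<^sub>R y)" by (simp add: algebra_simps)
    then have "\<mu> *\<^sub>R ?r x + (1 / \<mu>) *\<^sub>R ?r y = 2 *\<^sub>R ?r z" unfolding xy by simp
    from mle[OF this] show "2 * m (?r z) \<le> (2 * \<psi> (?r x) + 2 * \<phi> (?r y)) / 2" by simp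
  qed
  then have "gint ?S \<le> sconv m 0"
    unfolding sg by (intro gint_mono potential_measurable[OF pS] potential_measurable[OF rB] potential_nonneg[OF rB])
  then have "C * (gint ?S)\<^sup>2 \<le> C * (sconv m 0)\<^sup>2"
    using C by (intro mult_left_mono power_mono) (auto simp: gint_def)
  also have "\<dots> = sconv \<psi> 0 * sconv \<phi> 0" unfolding s0 k(2) c_def ..
  finally show ?scaled using rescale[OF p] rescale[OF q] unfolding sg by (simp add: extremal_def)
qed

section \<open>Quadratic potentials\<close>

definition selfadjoint :: "('a::euclidean_space \<Rightarrow> 'a) \<Rightarrow> bool" where
  "selfadjoint X \<longleftrightarrow> linear X \<and> (\<forall>x y. X x \<bullet> y = x \<bullet> X y)"

lemma selfadjointD: "selfadjoint X \<Longrightarrow> linear X" "selfadjoint X \<Longrightarrow> X x \<bullet> y = x \<bullet> X y"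
  by (auto simp: selfadjoint_def)

lemma selfadjoint_combination:
  assumes "selfadjoint X" "selfadjoint Z" shows "selfadjoint (\<lambda>x. a *\<^sub>R X x + b *\<^sub>R Z x)"
  using assms unfolding selfadjoint_def
  by (auto intro!: linear_compose_add linear_compose_scale_right simp: inner_add_left inner_add_right)

lemma selfadjoint_id: "selfadjoint (\<lambda>x. x)"
  by (auto simp: selfadjoint_def linear_iff)

lemma selfadjoint_square:
  assumes "selfadjoint X"
  shows "X (x + y) \<bullet> (x + y) = X x \<bullet> x + 2 * (X x \<bullet> y) + X y \<bullet> y"
    "X (x - y) \<bullet> (x - y) = X x \<bullet> x - 2 * (X x \<bullet> y) + X y \<bullet> y"
  using selfadjointD(2)[OF assms, of y x]
  by (simp_all add: linear_add[OF selfadjointD(1)[OF assms]] linear_diff[OF selfadjointD(1)[OF assms]]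
      inner_add_left inner_add_right inner_diff_left inner_diff_right inner_commute)

lemma selfadjoint_bound:
  assumes "selfadjoint X" obtains K where "0 < K" "\<And>x. X x \<bullet> x \<le> K * (norm x)\<^sup>2"
proof -
  obtain K where K: "K > 0" "\<And>x. norm (X x) \<le> norm x * K"
    using bounded_linear.pos_bounded[OF linear_conv_bounded_linear[THEN iffD1, OF selfadjointD(1)[OF assms]]] by blast
  have "X x \<bullet> x \<le> K * (norm x)\<^sup>2" for x
  proof -
    have "X x \<bullet> x \<le> norm (X x) * norm x" by (rule norm_cauchy_schwarz)
    also have "\<dots> \<le> (norm x * K) * norm x" by (intro mult_right_mono K) simp
    finally show ?thesis by (simp add: power2_eq_square mult_ac)
  qed
  with K show ?thesis using that by blast
qed

section \<open>Gaussian integrals of quadratic forms and the arithmetic-harmonic mean\<close>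

lemma positive_inverse:
  fixes A :: "'a::euclidean_space \<Rightarrow> 'a"
  assumes A: "linear A" and pos: "\<And>x. x \<noteq> 0 \<Longrightarrow> 0 < A x \<bullet> x"
  obtains A' where "linear A'" "\<And>x. A (A' x) = x"
proof -
  have "inj A"
    unfolding linear_injective_0[OF A] using pos by (metis inner_zero_left less_irrefl)
  then have "surj A" using A by (simp add: linear_injective_imp_surjective)
  then obtain A' where "linear A'" "A \<circ> A' = id" using linear_surjective_right_inverse[OF A] by blast
  then show ?thesis using that by (metis comp_apply id_apply)
qed

text \<open>For positive definite X this is a constant times the determinant of X to the power -1/2,
  so comparisons of determinants are phrased through these integrals. Values in
  \<open>ennreal\<close> spare integrability conditions.\<close>

definition gquad :: "('a::euclidean_space \<Rightarrow> 'a) \<Rightarrow> ennreal" where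
  "gquad X = (\<integral>\<^sup>+u. ennreal (exp (- (X u \<bullet> u) / 2)) \<partial>lborel)"

lemma linear_borel[measurable_dest]: "linear (X :: 'a::euclidean_space \<Rightarrow> 'a) \<Longrightarrow> X \<in> borel_measurable borel"
  by (simp add: borel_measurable_continuous_onI linear_continuous_on linear_conv_bounded_linear)

lemma gquad_mono:
  assumes "\<And>x. Y x \<bullet> x \<le> X x \<bullet> x" shows "gquad X \<le> gquad Y"
  unfolding gquad_def using assms by (intro nn_integral_mono) (simp add: ennreal_leI)

lemma gquad_finite:
  fixes X :: "'a::euclidean_space \<Rightarrow> 'a"
  assumes "\<And>x. (norm x)\<^sup>2 \<le> X x \<bullet> x" shows "gquad X < \<top>"
proof -
  have "gquad X \<le> gquad (\<lambda>x::'a. x)" by (rule gquad_mono) (use assms in \<open>simp add: power2_norm_eq_inner\<close>)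
  also have "\<dots> = ennreal (sqrt (2 * pi) ^ DIM('a))"
    unfolding gquad_def nn_integral_gauss[symmetric] by (simp add: power2_norm_eq_inner)
  also have "\<dots> < \<top>" by simp
  finally show ?thesis .
qed

text \<open>\<open>H\<close> is the harmonic mean of \<open>X\<close> and \<open>Z\<close>: rotating by 45 degrees and completing the square
  replaces a pair of forms by its arithmetic and harmonic means.\<close>
lemma gquad_means:
  fixes X Z :: "'a::euclidean_space \<Rightarrow> 'a"
  assumes X: "selfadjoint X" "\<And>x. (norm x)\<^sup>2 \<le> X x \<bullet> x" and Z: "selfadjoint Z" "\<And>x. (norm x)\<^sup>2 \<le> Z x \<bullet> x"
  obtains H where "selfadjoint H"
    "\<And>v w. H v \<bullet> v \<le> (X (v + w) \<bullet> (v + w) + Z (v - w) \<bullet> (v - w)) / 2"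
    "\<And>v. \<exists>w. H v \<bullet> v = (X (v + w) \<bullet> (v + w) + Z (v - w) \<bullet> (v - w)) / 2"
    "gquad X * gquad Z = gquad (\<lambda>x. (1/2) *\<^sub>R X x + (1/2) *\<^sub>R Z x) * gquad H"
proof -
  \<comment> \<open>Here X = A + B and Z = A - B. Minimising over w gives w = -\<open>M v\<close>
    with \<open>M\<close> the inverse of \<open>A\<close> applied after \<open>B\<close>, and the
    Schur complement \<open>H\<close> of A is the harmonic mean of X and Z.\<close>
  define A where "A = (\<lambda>x. (1/2) *\<^sub>R X x + (1/2) *\<^sub>R Z x)"
  define B where "B = (\<lambda>x. (1/2) *\<^sub>R X x + (-1/2) *\<^sub>R Z x)"
  have A: "selfadjoint A" and B: "selfadjoint B" unfolding A_def B_def by (rule selfadjoint_combination[OF X(1) Z(1)])+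
  have A1: "(norm x)\<^sup>2 \<le> A x \<bullet> x" for x using X(2)[of x] Z(2)[of x] by (simp add: A_def inner_add_left)
  have "0 < A x \<bullet> x" if "x \<noteq> 0" for x using A1[of x] that by (meson less_le_trans zero_less_norm_iff zero_less_power)
  then obtain A' where A': "linear A'" "\<And>x. A (A' x) = x" using positive_inverse[OF selfadjointD(1)[OF A]] by blast
  define M where "M = (\<lambda>v. A' (B v))"
  have M: "linear M" unfolding M_def using linear_compose[OF selfadjointD(1)[OF B] A'(1)] by (simp add: o_def)
  have AM: "A (M v) = B v" for v by (simp add: M_def A'(2))
  define H where "H = (\<lambda>v. A v - B (M v))"
  have BM: "B (M v) \<bullet> u = v \<bullet> B (M u)" for u v
  proof -
    have "B (M v) \<bullet> u = M v \<bullet> A (M u)" by (simp add: selfadjointD(2)[OF B] AM)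
    also have "\<dots> = B v \<bullet> M u" by (subst selfadjointD(2)[OF A, symmetric]) (simp only: AM)
    finally show ?thesis by (simp add: selfadjointD(2)[OF B])
  qed
  have H: "selfadjoint H" unfolding selfadjoint_def
  proof
    show "linear H" unfolding H_def
      using linear_compose_sub[OF selfadjointD(1)[OF A] linear_compose[OF M selfadjointD(1)[OF B]]] by (simp add: o_def)
    show "\<forall>x y. H x \<bullet> y = x \<bullet> H y"
      by (simp add: H_def inner_diff_left inner_diff_right BM selfadjointD(2)[OF A])
  qed
  have key: "(X (v + w) \<bullet> (v + w) + Z (v - w) \<bullet> (v - w)) / 2 = H v \<bullet> v + A (w + M v) \<bullet> (w + M v)" for v w
  proof -
    have 1: "A (w + M v) \<bullet> (w + M v) = A w \<bullet> w + 2 * (B v \<bullet> w) + B v \<bullet> M v"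
      unfolding selfadjoint_square(1)[OF A] AM
      using selfadjointD(2)[OF A, of w "M v"] by (simp add: AM inner_commute)
    have 2: "H v \<bullet> v = A v \<bullet> v - B v \<bullet> M v"
      by (simp add: H_def inner_diff_left inner_diff_right selfadjointD(2)[OF B] inner_commute)
    show ?thesis
      unfolding 1 2 selfadjoint_square(1)[OF X(1)] selfadjoint_square(2)[OF Z(1)]
      by (simp add: A_def B_def inner_add_left inner_diff_left field_simps)
  qed
  have A0: "0 \<le> A x \<bullet> x" for x using A1[of x] zero_le_power2[of "norm x"] by linarith
  have e1: "H v \<bullet> v \<le> (X (v + w) \<bullet> (v + w) + Z (v - w) \<bullet> (v - w)) / 2" for v w
    unfolding key using A0[of "w + M v"] by simp
  have e2: "\<exists>w. H v \<bullet> v = (X (v + w) \<bullet> (v + w) + Z (v - w) \<bullet> (v - w)) / 2" for v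
    unfolding key using linear_0[OF selfadjointD(1)[OF A]] by (intro exI[of _ "- M v"]) simp
  note [measurable] = linear_borel[OF selfadjointD(1)[OF X(1)]] linear_borel[OF selfadjointD(1)[OF Z(1)]]
    linear_borel[OF selfadjointD(1)[OF A]] linear_borel[OF selfadjointD(1)[OF H]]
  let ?G = "\<lambda>s t. ennreal (exp (- (X s \<bullet> s) / 2)) * ennreal (exp (- (Z t \<bullet> t) / 2))"
  have "gquad X * gquad Z = (\<integral>\<^sup>+s. (\<integral>\<^sup>+t. ?G s t \<partial>lborel) \<partial>lborel)"
    unfolding gquad_def by (simp add: nn_integral_cmult nn_integral_multc)
  also have "\<dots> = (\<integral>\<^sup>+x. (\<integral>\<^sup>+y. ?G ((1 / sqrt 2) *\<^sub>R (y + x)) ((1 / sqrt 2) *\<^sub>R (y - x)) \<partial>lborel) \<partial>lborel)"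
    by (rule nn_integral_rotate[symmetric]) measurable
  also have "\<dots> = (\<integral>\<^sup>+x. ennreal (exp (- (H x \<bullet> x) / 2)) * (\<integral>\<^sup>+y. ennreal (exp (- (A (M x + y) \<bullet> (M x + y)) / 2)) \<partial>lborel) \<partial>lborel)"
  proof (rule nn_integral_cong)
    fix x :: 'a
    have "?G ((1 / sqrt 2) *\<^sub>R (y + x)) ((1 / sqrt 2) *\<^sub>R (y - x))
      = ennreal (exp (- (H x \<bullet> x) / 2)) * ennreal (exp (- (A (M x + y) \<bullet> (M x + y)) / 2))" for y
    proof -
      have s: "X (c *\<^sub>R u) \<bullet> (c *\<^sub>R u) = c * c * (X u \<bullet> u)" "Z (c *\<^sub>R u) \<bullet> (c *\<^sub>R u) = c * c * (Z u \<bullet> u)" for c u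
        by (simp_all add: linear_scale[OF selfadjointD(1)[OF X(1)]] linear_scale[OF selfadjointD(1)[OF Z(1)]])
      have z: "Z (y - x) \<bullet> (y - x) = Z (x - y) \<bullet> (x - y)"
        by (metis inner_minus_left inner_minus_right linear_neg[OF selfadjointD(1)[OF Z(1)]] minus_diff_eq minus_minus)
      have "X ((1 / sqrt 2) *\<^sub>R (y + x)) \<bullet> ((1 / sqrt 2) *\<^sub>R (y + x)) + Z ((1 / sqrt 2) *\<^sub>R (y - x)) \<bullet> ((1 / sqrt 2) *\<^sub>R (y - x))
        = (X (x + y) \<bullet> (x + y) + Z (x - y) \<bullet> (x - y)) / 2"
        unfolding s z by (simp add: add.commute add_divide_distrib)
      also have "\<dots> = H x \<bullet> x + A (M x + y) \<bullet> (M x + y)" unfolding key by (simp add: add.commute)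
      finally have e: "X ((1 / sqrt 2) *\<^sub>R (y + x)) \<bullet> ((1 / sqrt 2) *\<^sub>R (y + x)) + Z ((1 / sqrt 2) *\<^sub>R (y - x)) \<bullet> ((1 / sqrt 2) *\<^sub>R (y - x)) = \<dots>" .
      have arith: "- a / 2 + - b / 2 = - c / 2 + - d / 2" if "a + b = c + d" for a b c d :: real using that by argo
      show ?thesis
        unfolding ennreal_mult[OF exp_ge_zero exp_ge_zero, symmetric] exp_add[symmetric] arith[OF e] ..
    qed
    then show "(\<integral>\<^sup>+y. ?G ((1 / sqrt 2) *\<^sub>R (y + x)) ((1 / sqrt 2) *\<^sub>R (y - x)) \<partial>lborel)
      = ennreal (exp (- (H x \<bullet> x) / 2)) * (\<integral>\<^sup>+y. ennreal (exp (- (A (M x + y) \<bullet> (M x + y)) / 2)) \<partial>lborel)"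
      by (simp only:) (rule nn_integral_cmult, measurable)
  qed
  also have "\<dots> = (\<integral>\<^sup>+x. ennreal (exp (- (H x \<bullet> x) / 2)) * gquad A \<partial>lborel)"
  proof (rule nn_integral_cong)
    fix x :: 'a
    have "(\<integral>\<^sup>+y. ennreal (exp (- (A (M x + y) \<bullet> (M x + y)) / 2)) \<partial>lborel) = gquad A"
      unfolding gquad_def by (rule nn_integral_lborel_shift) measurable
    then show "ennreal (exp (- (H x \<bullet> x) / 2)) * (\<integral>\<^sup>+y. ennreal (exp (- (A (M x + y) \<bullet> (M x + y)) / 2)) \<partial>lborel)
      = ennreal (exp (- (H x \<bullet> x) / 2)) * gquad A" by simp
  qed
  also have "\<dots> = gquad H * gquad A" unfolding gquad_def by (rule nn_integral_multc) measurable
  finally have "gquad X * gquad Z = gquad A * gquad H" by (simp add: mult.commute)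
  then show ?thesis using that[OF H e1 e2] unfolding A_def by blast
qed

text \<open>Each step to the arithmetic and harmonic means keeps the product of the Gaussian
  integrals, the lower bound by the identity and the block inequality. Once Z \<le> X holds, the
  harmonic mean lies above Z, so the gap is at most the distance from the arithmetic mean to Z,
  which is half of the old gap.\<close>

lemma gquad_means_iterate:
  fixes X Z Y :: "'a::euclidean_space \<Rightarrow> 'a"
  assumes X: "selfadjoint X" "\<And>x. (norm x)\<^sup>2 \<le> X x \<bullet> x" and Z: "selfadjoint Z" "\<And>x. (norm x)\<^sup>2 \<le> Z x \<bullet> x"
    and Y: "selfadjoint Y" and block: "\<And>x y. 2 * (Y x \<bullet> y) \<le> X x \<bullet> x + Z y \<bullet> y"
    and g: "\<And>x. X x \<bullet> x \<le> g * (norm x)\<^sup>2" "\<And>x. Z x \<bullet> x \<le> g * (norm x)\<^sup>2"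
  shows "\<exists>X' Z'. gquad X' * gquad Z' = gquad X * gquad Z \<and> selfadjoint X' \<and> selfadjoint Z'
    \<and> (\<forall>x. (norm x)\<^sup>2 \<le> X' x \<bullet> x) \<and> (\<forall>x. (norm x)\<^sup>2 \<le> Z' x \<bullet> x)
    \<and> (\<forall>x y. 2 * (Y x \<bullet> y) \<le> X' x \<bullet> x + Z' y \<bullet> y)
    \<and> (\<forall>x. Z' x \<bullet> x \<le> X' x \<bullet> x) \<and> (\<forall>x. X' x \<bullet> x - Z' x \<bullet> x \<le> g / 2 ^ n * (norm x)\<^sup>2)"
proof -
  have step: "\<exists>X' Z'. gquad X' * gquad Z' = gquad X1 * gquad Z1 \<and> selfadjoint X' \<and> selfadjoint Z'
    \<and> (\<forall>x. (norm x)\<^sup>2 \<le> X' x \<bullet> x) \<and> (\<forall>x. (norm x)\<^sup>2 \<le> Z' x \<bullet> x)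
    \<and> (\<forall>x y. 2 * (Y x \<bullet> y) \<le> X' x \<bullet> x + Z' y \<bullet> y) \<and> (\<forall>x. Z' x \<bullet> x \<le> X' x \<bullet> x)
    \<and> (\<forall>x. X' x \<bullet> x = (X1 x \<bullet> x + Z1 x \<bullet> x) / 2)
    \<and> ((\<forall>x. Z1 x \<bullet> x \<le> X1 x \<bullet> x) \<longrightarrow> (\<forall>x. Z1 x \<bullet> x \<le> Z' x \<bullet> x))"
    if X1: "selfadjoint X1" "\<And>x. (norm x)\<^sup>2 \<le> X1 x \<bullet> x" and Z1: "selfadjoint Z1" "\<And>x. (norm x)\<^sup>2 \<le> Z1 x \<bullet> x"
    and bl: "\<And>x y. 2 * (Y x \<bullet> y) \<le> X1 x \<bullet> x + Z1 y \<bullet> y" for X1 Z1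
  proof -
    obtain H where H: "selfadjoint H"
    "\<And>v w. H v \<bullet> v \<le> (X1 (v + w) \<bullet> (v + w) + Z1 (v - w) \<bullet> (v - w)) / 2"
    "\<And>v. \<exists>w. H v \<bullet> v = (X1 (v + w) \<bullet> (v + w) + Z1 (v - w) \<bullet> (v - w)) / 2"
    "gquad X1 * gquad Z1 = gquad (\<lambda>x. (1/2) *\<^sub>R X1 x + (1/2) *\<^sub>R Z1 x) * gquad H"
      using gquad_means[OF X1 Z1] by blast
    define A where "A = (\<lambda>x. (1/2) *\<^sub>R X1 x + (1/2) *\<^sub>R Z1 x)"
    have Ax: "A x \<bullet> x = (X1 x \<bullet> x + Z1 x \<bullet> x) / 2" for x by (simp add: A_def inner_add_left)
    have A: "selfadjoint A" unfolding A_def by (rule selfadjoint_combination[OF X1(1) Z1(1)])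
    have A1: "(norm x)\<^sup>2 \<le> A x \<bullet> x" for x using X1(2)[of x] Z1(2)[of x] by (simp add: Ax)
    have H1: "(norm v)\<^sup>2 \<le> H v \<bullet> v" for v
    proof -
      obtain w where w: "H v \<bullet> v = (X1 (v + w) \<bullet> (v + w) + Z1 (v - w) \<bullet> (v - w)) / 2" using H(3) by blast
      have "(norm (v + w))\<^sup>2 + (norm (v - w))\<^sup>2 = 2 * (norm v)\<^sup>2 + 2 * (norm w)\<^sup>2"
        by (simp add: power2_norm_eq_inner inner_add_left inner_add_right inner_diff_left inner_diff_right)
      then show ?thesis using X1(2)[of "v + w"] Z1(2)[of "v - w"] zero_le_power2[of "norm w"] unfolding w by argo
    qed
    \<comment> \<open>Average of the old inequality at \<open>(y + w, x)\<close> and at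
      \<open>(x, y - w)\<close>, with \<open>w\<close> the minimiser for the harmonic mean; the
      terms with \<open>w\<close> cancel because \<open>Y\<close> is self-adjoint.\<close>
    have bl': "2 * (Y x \<bullet> y) \<le> A x \<bullet> x + H y \<bullet> y" for x y
    proof -
      obtain w where w: "H y \<bullet> y = (X1 (y + w) \<bullet> (y + w) + Z1 (y - w) \<bullet> (y - w)) / 2" using H(3) by blast
      have "Y (y + w) \<bullet> x + Y x \<bullet> (y - w) = 2 * (Y x \<bullet> y)"
        using selfadjointD(2)[OF Y, of y x] selfadjointD(2)[OF Y, of w x]
        by (simp add: linear_add[OF selfadjointD(1)[OF Y]] inner_add_left inner_add_right inner_diff_right inner_commute)
      then show ?thesis unfolding w Ax using bl[of "y + w" x] bl[of x "y - w"] by argo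
    qed
    have HA: "H x \<bullet> x \<le> A x \<bullet> x" for x using H(2)[of x 0] by (simp add: Ax)
    have ZH: "Z1 v \<bullet> v \<le> H v \<bullet> v" if le: "\<forall>x. Z1 x \<bullet> x \<le> X1 x \<bullet> x" for v
    proof -
      obtain w where w: "H v \<bullet> v = (X1 (v + w) \<bullet> (v + w) + Z1 (v - w) \<bullet> (v - w)) / 2" using H(3) by blast
      have "(Z1 (v + w) \<bullet> (v + w) + Z1 (v - w) \<bullet> (v - w)) / 2 = Z1 v \<bullet> v + Z1 w \<bullet> w"
        unfolding selfadjoint_square[OF Z1(1)] by simp
      then show ?thesis using le[rule_format, of "v + w"] Z1(2)[of w] zero_le_power2[of "norm w"] unfolding w by argo
    qed
    have "gquad A * gquad H = gquad X1 * gquad Z1" using H(4) unfolding A_def by simp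
    then show ?thesis using A H(1) A1 H1 bl' HA Ax ZH by - (rule exI[of _ A], rule exI[of _ H], blast)
  qed
  show ?thesis
  proof (induction n)
    \<comment> \<open>One step is taken already here, since only then the pair is ordered; from the
      ordered pair on, the gap halves.\<close>
    case 0
    obtain X' Z' where s: "gquad X' * gquad Z' = gquad X * gquad Z" "selfadjoint X'" "selfadjoint Z'"
      "\<forall>x. (norm x)\<^sup>2 \<le> X' x \<bullet> x" "\<forall>x. (norm x)\<^sup>2 \<le> Z' x \<bullet> x"
      "\<forall>x y. 2 * (Y x \<bullet> y) \<le> X' x \<bullet> x + Z' y \<bullet> y" "\<forall>x. Z' x \<bullet> x \<le> X' x \<bullet> x"
      "\<forall>x. X' x \<bullet> x = (X x \<bullet> x + Z x \<bullet> x) / 2"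
      using step[OF X Z block] by blast
    have "X' x \<bullet> x - Z' x \<bullet> x \<le> g * (norm x)\<^sup>2" for x
      using s(8)[rule_format, of x] s(5)[rule_format, of x] g(1)[of x] g(2)[of x] zero_le_power2[of "norm x"] by argo
    then show ?case using s(1-7) by - (rule exI[of _ X'], rule exI[of _ Z'], simp)
  next
    case (Suc n)
    then obtain X1 Z1 where s: "gquad X1 * gquad Z1 = gquad X * gquad Z" "selfadjoint X1" "selfadjoint Z1"
      "\<And>x. (norm x)\<^sup>2 \<le> X1 x \<bullet> x" "\<And>x. (norm x)\<^sup>2 \<le> Z1 x \<bullet> x"
      "\<And>x y. 2 * (Y x \<bullet> y) \<le> X1 x \<bullet> x + Z1 y \<bullet> y" "\<forall>x. Z1 x \<bullet> x \<le> X1 x \<bullet> x"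
      "\<And>x. X1 x \<bullet> x - Z1 x \<bullet> x \<le> g / 2 ^ n * (norm x)\<^sup>2" by blast
    obtain X' Z' where t: "gquad X' * gquad Z' = gquad X1 * gquad Z1" "selfadjoint X'" "selfadjoint Z'"
      "\<forall>x. (norm x)\<^sup>2 \<le> X' x \<bullet> x" "\<forall>x. (norm x)\<^sup>2 \<le> Z' x \<bullet> x"
      "\<forall>x y. 2 * (Y x \<bullet> y) \<le> X' x \<bullet> x + Z' y \<bullet> y" "\<forall>x. Z' x \<bullet> x \<le> X' x \<bullet> x"
      "\<forall>x. X' x \<bullet> x = (X1 x \<bullet> x + Z1 x \<bullet> x) / 2" "\<forall>x. Z1 x \<bullet> x \<le> Z' x \<bullet> x"
      using step[OF s(2,4,3,5,6)] s(7) by blast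
    have "X' x \<bullet> x - Z' x \<bullet> x \<le> g / 2 ^ Suc n * (norm x)\<^sup>2" for x
    proof -
      have "g / 2 ^ Suc n * (norm x)\<^sup>2 = (g / 2 ^ n * (norm x)\<^sup>2) / 2" by simp
      then show ?thesis using t(8)[rule_format, of x] t(9)[rule_format, of x] s(8)[of x] by argo
    qed
    then show ?case using s(1) t(1-7) by - (rule exI[of _ X'], rule exI[of _ Z'], simp)
  qed
qed

lemma gquad_scale:
  fixes Y :: "'a::euclidean_space \<Rightarrow> 'a"
  assumes Y: "linear Y" and c: "0 < c"
  shows "gquad (\<lambda>x. c *\<^sub>R Y x) = ennreal ((1 / sqrt c) ^ DIM('a)) * gquad Y"
proof -
  note [measurable] = linear_borel[OF Y]
  have "gquad (\<lambda>x. c *\<^sub>R Y x) = ennreal (\<bar>1 / sqrt c\<bar> ^ DIM('a)) * (\<integral>\<^sup>+u. ennreal (exp (- (c *\<^sub>R Y (0 + (1 / sqrt c) *\<^sub>R u) \<bullet> (0 + (1 / sqrt c) *\<^sub>R u)) / 2)) \<partial>lborel)"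
    unfolding gquad_def by (rule nn_integral_lborel_affine) (measurable, use c in simp)
  also have "(\<lambda>u. ennreal (exp (- (c *\<^sub>R Y (0 + (1 / sqrt c) *\<^sub>R u) \<bullet> (0 + (1 / sqrt c) *\<^sub>R u)) / 2))) = (\<lambda>u. ennreal (exp (- (Y u \<bullet> u) / 2)))"
  proof
    fix u
    have "c *\<^sub>R Y (0 + (1 / sqrt c) *\<^sub>R u) \<bullet> (0 + (1 / sqrt c) *\<^sub>R u) = (c * (1 / sqrt c * (1 / sqrt c))) * (Y u \<bullet> u)"
      by (simp add: linear_scale[OF Y])
    also have "c * (1 / sqrt c * (1 / sqrt c)) = 1" using c by simp
    finally show "ennreal (exp (- (c *\<^sub>R Y (0 + (1 / sqrt c) *\<^sub>R u) \<bullet> (0 + (1 / sqrt c) *\<^sub>R u)) / 2)) = ennreal (exp (- (Y u \<bullet> u) / 2))"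
      by simp
  qed
  finally show ?thesis using c by (simp add: gquad_def)
qed

text \<open>On the diagonal the block inequality reads 2 Y \<le> X' + Z'. With Z' \<le> X' and a gap
  of at most \<epsilon> times the squared norm it gives Y \<le> X' and (1 - \<epsilon>/2) Y \<le>
  Z'. Both iterates are thus compared with Y directly instead of with their common limit, the
  geometric mean.\<close>

lemma gquad_block:
  fixes X Z Y :: "'a::euclidean_space \<Rightarrow> 'a"
  assumes X: "selfadjoint X" "\<And>x. (norm x)\<^sup>2 \<le> X x \<bullet> x" and Z: "selfadjoint Z" "\<And>x. (norm x)\<^sup>2 \<le> Z x \<bullet> x"
    and Y: "selfadjoint Y" "\<And>x. (norm x)\<^sup>2 \<le> Y x \<bullet> x" and block: "\<And>x y. 2 * (Y x \<bullet> y) \<le> X x \<bullet> x + Z y \<bullet> y"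
  shows "gquad X * gquad Z \<le> (gquad Y)\<^sup>2"
proof -
  obtain K1 K2 where K: "0 < K1" "\<And>x. X x \<bullet> x \<le> K1 * (norm x)\<^sup>2" "0 < K2" "\<And>x. Z x \<bullet> x \<le> K2 * (norm x)\<^sup>2"
    using selfadjoint_bound[OF X(1)] selfadjoint_bound[OF Z(1)] by metis
  define g where "g = max K1 K2"
  have g: "0 < g" "X x \<bullet> x \<le> g * (norm x)\<^sup>2" "Z x \<bullet> x \<le> g * (norm x)\<^sup>2" for x
    using K(1) order_trans[OF K(2) mult_right_mono[of K1 g]] order_trans[OF K(4) mult_right_mono[of K2 g]]
    by (auto simp: g_def)
  obtain a b d where abd: "gquad X = ennreal a" "gquad Z = ennreal b" "gquad Y = ennreal d" "0 \<le> a" "0 \<le> b" "0 \<le> d"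
    using gquad_finite[OF X(2)] gquad_finite[OF Z(2)] gquad_finite[OF Y(2)]
    by (cases "gquad X"; cases "gquad Z"; cases "gquad Y") auto
  have ineq: "a * b \<le> d * ((1 / sqrt (1 - g / 2 ^ n / 2)) ^ DIM('a) * d)" if small: "g / 2 ^ n < 1" for n
  proof -
    obtain X' Z' where s: "gquad X' * gquad Z' = gquad X * gquad Z" "selfadjoint X'" "selfadjoint Z'"
      "\<And>x. (norm x)\<^sup>2 \<le> X' x \<bullet> x" "\<And>x. (norm x)\<^sup>2 \<le> Z' x \<bullet> x"
      "\<And>x y. 2 * (Y x \<bullet> y) \<le> X' x \<bullet> x + Z' y \<bullet> y" "\<And>x. Z' x \<bullet> x \<le> X' x \<bullet> x"
      "\<And>x. X' x \<bullet> x - Z' x \<bullet> x \<le> g / 2 ^ n * (norm x)\<^sup>2"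
      using gquad_means_iterate[OF X Z Y(1) block g(2,3), of n] by blast
    let ?c = "1 - g / 2 ^ n / 2"
    have "0 < 1 - t / 2" if "t < 1" for t :: real using that by simp
    from this[OF small] have c: "0 < ?c" .
    have 1: "gquad X' \<le> gquad Y" 
    proof (rule gquad_mono)
      show "Y x \<bullet> x \<le> X' x \<bullet> x" for x using s(6)[of x x] s(7)[of x] by linarith
    qed
    have 2: "gquad Z' \<le> gquad (\<lambda>x. ?c *\<^sub>R Y x)"
    proof (rule gquad_mono)
      fix x
      have "g / 2 ^ n * (norm x)\<^sup>2 \<le> g / 2 ^ n * (Y x \<bullet> x)" using Y(2)[of x] g(1) by (intro mult_left_mono) auto
      then show "?c *\<^sub>R Y x \<bullet> x \<le> Z' x \<bullet> x" using s(6)[of x x] s(8)[of x] by (simp add: algebra_simps)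
    qed
    have "gquad X * gquad Z \<le> gquad Y * (ennreal ((1 / sqrt ?c) ^ DIM('a)) * gquad Y)"
      unfolding s(1)[symmetric] gquad_scale[OF selfadjointD(1)[OF Y(1)] c, symmetric] by (intro mult_mono 1 2) auto
    then show ?thesis
      using abd c by (simp add: ennreal_mult[symmetric] ennreal_le_iff)
  qed
  have lim: "(\<lambda>n. g / 2 ^ n) \<longlonglongrightarrow> 0"
    using LIMSEQ_divide_realpow_zero[of 2 g] by simp
  have "(\<lambda>n. d * ((1 / sqrt (1 - g / 2 ^ n / 2)) ^ DIM('a) * d)) \<longlonglongrightarrow> d * ((1 / sqrt (1 - 0 / 2)) ^ DIM('a) * d)"
    by (intro tendsto_intros lim) auto
  moreover have "eventually (\<lambda>n. a * b \<le> d * ((1 / sqrt (1 - g / 2 ^ n / 2)) ^ DIM('a) * d)) sequentially"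
    by (rule eventually_mono[OF order_tendstoD(2)[OF lim zero_less_one]]) (rule ineq)
  ultimately have "a * b \<le> d * ((1 / sqrt (1 - 0 / 2)) ^ DIM('a) * d)"
    by (intro tendsto_lowerbound[of _ _ sequentially]) auto
  then have "a * b \<le> d\<^sup>2" by (simp add: power2_eq_square)
  then show ?thesis using abd by (simp add: ennreal_mult[symmetric] ennreal_power ennreal_leI)
qed

section \<open>Blow-up of a self-convolution at the origin\<close>

text \<open>Since \<open>N\<close> diverges while \<open>N k * t k\<close> converges,
  \<open>t\<close> tends to 0, and the Caratheodory slope of \<open>f\<close> tends to
  \<open>c\<close>.\<close>

lemma tendsto_mult_at_zero:
  fixes f :: "real \<Rightarrow> real"
  assumes f: "(f has_real_derivative c) (at 0)" "f 0 = 0"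
    and N: "filterlim N at_top sequentially" and t: "(\<lambda>k. N k * t k) \<longlonglongrightarrow> L"
  shows "(\<lambda>k. N k * f (t k)) \<longlonglongrightarrow> c * L"
proof -
  obtain g where g: "\<And>z. f z = g z * z" "isCont g 0" "g 0 = c"
    using f unfolding CARAT_DERIV by auto
  have "(\<lambda>k. (N k * t k) / N k) \<longlonglongrightarrow> 0"
    by (rule tendsto_divide_0[OF t filterlim_at_top_imp_at_infinity[OF N]])
  moreover have "eventually (\<lambda>k. (N k * t k) / N k = t k) sequentially"
    using filterlim_at_top_dense[THEN iffD1, OF N, rule_format, of 0] by eventually_elim simp
  ultimately have "t \<longlonglongrightarrow> 0" by (simp add: filterlim_cong)
  then have "(\<lambda>k. g (t k)) \<longlonglongrightarrow> c" using g(2,3) isCont_tendsto_compose by metis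
  then have "(\<lambda>k. g (t k) * (N k * t k)) \<longlonglongrightarrow> c * L" by (intro tendsto_mult t)
  then show ?thesis unfolding g(1) by (simp add: mult_ac)
qed

text \<open>An additive function is exact on integer multiples, so for every n the quantity n times
  the defect \<open>\<bar>f (c *\<^sub>R x) - c * f x\<bar>\<close> comes only from the fractional
  part of n c and stays below a fixed bound. Hence the defect is 0.\<close>

lemma additive_bounded_imp_linear:
  fixes f :: "'a::real_normed_vector \<Rightarrow> real"
  assumes add: "\<And>x y. f (x + y) = f x + f y" and bound: "\<And>x. \<bar>f x\<bar> \<le> K * norm x"
  shows "linear f"
proof (rule linearI)
  show "f (x + y) = f x + f y" for x y by (rule add)
  fix c :: real and x :: 'a
  have f0: "f 0 = 0" using add[of 0 0] by simp
  have neg: "f (- y) = - f y" for y using add[of y "- y"] f0 by simp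
  have nat: "f (real n *\<^sub>R y) = real n * f y" for n y
    by (induction n) (simp_all add: f0 algebra_simps add)
  have int: "f (real_of_int z *\<^sub>R y) = real_of_int z * f y" for z y
    using nat[of "nat z" y] nat[of "nat (- z)" "- y"] by (cases "0 \<le> z") (simp_all add: neg)
  have K: "0 \<le> K * norm x" using bound[of x] by (meson abs_ge_zero order_trans)
  have "real n * \<bar>f (c *\<^sub>R x) - c * f x\<bar> \<le> 2 * (K * norm x)" for n
  proof -
    define z where "z = \<lfloor>real n * c\<rfloor>"
    define e where "e = real n * c - real_of_int z"
    have e: "0 \<le> e" "e \<le> 1" unfolding e_def z_def by linarith+
    have "real n *\<^sub>R (c *\<^sub>R x) = real_of_int z *\<^sub>R x + e *\<^sub>R x" by (simp add: e_def algebra_simps)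
    then have "real n * f (c *\<^sub>R x) = real_of_int z * f x + f (e *\<^sub>R x)"
      by (metis add int nat)
    then have "real n * (f (c *\<^sub>R x) - c * f x) = f (e *\<^sub>R x) - e * f x"
      by (simp add: e_def algebra_simps)
    then have "real n * \<bar>f (c *\<^sub>R x) - c * f x\<bar> = \<bar>f (e *\<^sub>R x) - e * f x\<bar>"
      by (metis abs_mult abs_of_nat)
    also have "\<dots> \<le> \<bar>f (e *\<^sub>R x)\<bar> + e * \<bar>f x\<bar>" using e by (metis abs_mult abs_of_nonneg abs_triangle_ineq4)
    also have "\<bar>f (e *\<^sub>R x)\<bar> \<le> K * norm x"
    proof -
      have "\<bar>f (e *\<^sub>R x)\<bar> \<le> e * (K * norm x)" using bound[of "e *\<^sub>R x"] e by (simp add: mult_ac)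
      also have "\<dots> \<le> 1 * (K * norm x)" using e K by (intro mult_right_mono)
      finally show ?thesis by simp
    qed
    also have "e * \<bar>f x\<bar> \<le> 1 * (K * norm x)" using e bound[of x] by (intro mult_mono) auto
    finally show ?thesis by simp
  qed
  then have "\<bar>f (c *\<^sub>R x) - c * f x\<bar> = 0"
  proof (rule_tac ccontr)
    assume *: "\<And>n. real n * \<bar>f (c *\<^sub>R x) - c * f x\<bar> \<le> 2 * (K * norm x)" and "\<bar>f (c *\<^sub>R x) - c * f x\<bar> \<noteq> 0"
    then have "0 < \<bar>f (c *\<^sub>R x) - c * f x\<bar>" by simp
    then obtain n where "2 * (K * norm x) < real n * \<bar>f (c *\<^sub>R x) - c * f x\<bar>"
      using reals_Archimedean3 by blast
    with *[of n] show False by simp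
  qed
  then show "f (c *\<^sub>R x) = c *\<^sub>R f x" by simp
qed

text \<open>Along dyadic steps midpoint convexity alone makes the difference quotients decrease, so
  the limit exists; as a limit of a sequence it is also measurable in the base point.\<close>

definition dirderiv :: "('a::euclidean_space \<Rightarrow> real) \<Rightarrow> 'a \<Rightarrow> 'a \<Rightarrow> real" where
  "dirderiv \<psi> v s = lim (\<lambda>k. 2 ^ k * (\<psi> (v + (1 / 2 ^ k) *\<^sub>R s) - \<psi> v))"

context
  fixes A and \<psi> :: "'a::euclidean_space \<Rightarrow> real"
  assumes pot: "potential A \<psi>"
begin

lemma dirderiv_lim: "(\<lambda>k. 2 ^ k * (\<psi> (v + (1 / 2 ^ k) *\<^sub>R s) - \<psi> v)) \<longlonglongrightarrow> dirderiv \<psi> v s"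
proof -
  define h where "h s k = 2 ^ k * (\<psi> (v + (1 / 2 ^ k) *\<^sub>R s) - \<psi> v)" for s and k :: nat
  have dec: "h s (Suc k) \<le> h s k" for s k
  proof -
    have "(1 / 2) *\<^sub>R ((v + (1 / 2 ^ k) *\<^sub>R s) + v) = v + (1 / 2 ^ Suc k) *\<^sub>R s"
      by (simp add: algebra_simps) (simp flip: scaleR_add_left)
    then have "2 * \<psi> (v + (1 / 2 ^ Suc k) *\<^sub>R s) \<le> \<psi> (v + (1 / 2 ^ k) *\<^sub>R s) + \<psi> v"
      using potential_midpoint[OF pot, of "v + (1 / 2 ^ k) *\<^sub>R s" v] by simp
    then have "2 ^ k * (2 * \<psi> (v + (1 / 2 ^ Suc k) *\<^sub>R s)) \<le> 2 ^ k * (\<psi> (v + (1 / 2 ^ k) *\<^sub>R s) + \<psi> v)"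
      by (intro mult_left_mono) auto
    then show ?thesis by (simp add: h_def algebra_simps)
  qed
  then have "decseq (h s)" for s by (auto intro: decseq_SucI)
  \<comment> \<open>Convexity bounds the quotient in direction \<open>s\<close> from below by minus
    the quotient in direction \<open>- s\<close>, which is largest at its first term.\<close>
  moreover have "- h (- s) 0 \<le> h s k" for k
  proof -
    have "2 * \<psi> v \<le> \<psi> (v + (1 / 2 ^ k) *\<^sub>R s) + \<psi> (v - (1 / 2 ^ k) *\<^sub>R s)" by (rule potential_lower[OF pot])
    then have "2 ^ k * (2 * \<psi> v) \<le> 2 ^ k * (\<psi> (v + (1 / 2 ^ k) *\<^sub>R s) + \<psi> (v - (1 / 2 ^ k) *\<^sub>R s))" by (intro mult_left_mono) auto
    then have "- h (- s) k \<le> h s k" by (simp add: h_def algebra_simps)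
    moreover have "h (- s) k \<le> h (- s) 0" using \<open>decseq (h (- s))\<close> by (simp add: decseqD)
    ultimately show ?thesis by simp
  qed
  ultimately have "convergent (h s)" by (metis decseq_convergent convergentI)
  then show ?thesis unfolding dirderiv_def h_def by (simp add: convergent_LIMSEQ_iff)
qed

lemma dirderiv_bound: "\<bar>dirderiv \<psi> v s\<bar> \<le> A * (norm v + 3)\<^sup>2 * norm s"
proof (rule LIMSEQ_le_const2[OF tendsto_rabs[OF dirderiv_lim]])
  obtain N :: nat where N: "norm s < 2 ^ N" using real_arch_pow[of 2 "norm s"] by auto
  have "\<bar>2 ^ k * (\<psi> (v + (1 / 2 ^ k) *\<^sub>R s) - \<psi> v)\<bar> \<le> A * (norm v + 3)\<^sup>2 * norm s" if "N \<le> k" for k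
  proof -
    have "norm s < 2 ^ k" by (rule less_le_trans[OF N power_increasing[OF that]]) simp
    then have "norm ((1 / 2 ^ k) *\<^sub>R s) \<le> 1" by simp
    from potential_lipschitz[OF pot this, of v]
    have "2 ^ k * \<bar>\<psi> (v + (1 / 2 ^ k) *\<^sub>R s) - \<psi> v\<bar> \<le> 2 ^ k * (A * (norm v + 3)\<^sup>2 * norm ((1 / 2 ^ k) *\<^sub>R s))"
      by (intro mult_left_mono) auto
    then show ?thesis by (simp add: abs_mult)
  qed
  then show "\<exists>N. \<forall>k\<ge>N. \<bar>2 ^ k * (\<psi> (v + (1 / 2 ^ k) *\<^sub>R s) - \<psi> v)\<bar> \<le> A * (norm v + 3)\<^sup>2 * norm s" by blast
qed

text \<open>Convexity gives subadditivity of the one-sided derivative. The upper second-difference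
  bound gives the reverse inequality with an error of order \<open>(1 / 2) ^ k\<close>; this is
  where the bounded Hessian makes \<psi> differentiable.\<close>

lemma dirderiv_add: "dirderiv \<psi> v (s + s') = dirderiv \<psi> v s + dirderiv \<psi> v s'"
proof -
  define h where "h s k = 2 ^ k * (\<psi> (v + (1 / 2 ^ k) *\<^sub>R s) - \<psi> v)" for s and k :: nat
  have lim: "h s \<longlonglongrightarrow> dirderiv \<psi> v s" for s unfolding h_def by (rule dirderiv_lim)
  have mid: "(1 / 2) *\<^sub>R ((v + (1 / 2 ^ k) *\<^sub>R s) + (v + (1 / 2 ^ k) *\<^sub>R s')) = v + (1 / 2 ^ Suc k) *\<^sub>R (s + s')" for k :: nat
    by (simp add: algebra_simps) (simp flip: scaleR_add_left)
  have lo: "h (s + s') (Suc k) \<le> h s k + h s' k" for k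
    using mult_left_mono[OF potential_midpoint[OF pot, of "v + (1 / 2 ^ k) *\<^sub>R s" "v + (1 / 2 ^ k) *\<^sub>R s'"], of "2 ^ k"]
    unfolding mid by (simp add: h_def algebra_simps)
  have up: "h s k + h s' k \<le> h (s + s') (Suc k) + (A / 4 * (norm (s - s'))\<^sup>2) * (1 / 2) ^ k" for k
  proof -
    have d: "(v + (1 / 2 ^ k) *\<^sub>R s) - (v + (1 / 2 ^ k) *\<^sub>R s') = (1 / 2 ^ k) *\<^sub>R (s - s')" by (simp add: algebra_simps)
    have "2 ^ k * (A / 4 * (norm ((1 / 2 ^ k) *\<^sub>R (s - s')))\<^sup>2) = (A / 4 * (norm (s - s'))\<^sup>2) * (1 / 2) ^ k"
      by (simp add: power_divide power2_eq_square power_one_over)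
    moreover have "2 ^ k * (\<psi> (v + (1 / 2 ^ k) *\<^sub>R s) + \<psi> (v + (1 / 2 ^ k) *\<^sub>R s'))
        \<le> 2 ^ k * (2 * \<psi> (v + (1 / 2 ^ Suc k) *\<^sub>R (s + s')) + A / 4 * (norm ((1 / 2 ^ k) *\<^sub>R (s - s')))\<^sup>2)"
      using potential_midpoint_upper[OF pot, of "v + (1 / 2 ^ k) *\<^sub>R s" "v + (1 / 2 ^ k) *\<^sub>R s'"]
      unfolding mid d by (intro mult_left_mono) auto
    moreover have "q * (a - c) + q * (b - c) \<le> 2 * q * (m - c) + E"
      if "q * e = E" "q * (a + b) \<le> q * (2 * m + e)" for q a b c m e E :: real
      using that by (simp add: algebra_simps)
    ultimately show ?thesis unfolding h_def power_Suc by blast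
  qed
  have e: "(\<lambda>k. (A / 4 * (norm (s - s'))\<^sup>2) * (1 / 2) ^ k) \<longlonglongrightarrow> 0"
    by (intro tendsto_mult_right_zero LIMSEQ_power_zero) simp
  have "dirderiv \<psi> v (s + s') \<le> dirderiv \<psi> v s + dirderiv \<psi> v s'"
    by (rule LIMSEQ_le[OF LIMSEQ_Suc[OF lim] tendsto_add[OF lim lim]]) (use lo in blast)
  moreover have "dirderiv \<psi> v s + dirderiv \<psi> v s' \<le> dirderiv \<psi> v (s + s') + 0"
    by (rule LIMSEQ_le[OF tendsto_add[OF lim lim] tendsto_add[OF LIMSEQ_Suc[OF lim] e]]) (use up in blast)
  ultimately show ?thesis by simp
qed

lemma dirderiv_linear: "linear (dirderiv \<psi> v)"
  by (rule additive_bounded_imp_linear[OF dirderiv_add dirderiv_bound])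

lemma dirderiv_measurable: "(\<lambda>v. dirderiv \<psi> v s) \<in> borel_measurable borel"
proof (rule borel_measurable_LIMSEQ_real[OF dirderiv_lim])
  note [measurable] = potential_measurable[OF pot]
  show "(\<lambda>v. 2 ^ k * (\<psi> (v + (1 / 2 ^ k) *\<^sub>R s) - \<psi> v)) \<in> borel_measurable borel" for k by measurable
qed

section \<open>Integrable bounds for the density and its differences\<close>

text \<open>\<open>slope v\<close> is minus the logarithmic gradient of \<open>dens\<close> at v.\<close>
definition dens :: "'a \<Rightarrow> real" where "dens v = exp (- \<psi> v - (norm v)\<^sup>2 / 2)"

definition slope :: "'a \<Rightarrow> 'a \<Rightarrow> real" where "slope v s = dirderiv \<psi> v s + v \<bullet> s"

lemma slope_linear: "linear (slope v)"
  unfolding slope_def by (intro linear_compose_add dirderiv_linear bounded_linear.linear bounded_linear_inner_right)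

lemma slope_bound: "\<bar>slope v s\<bar> \<le> (A + 1) * (norm v + 3)\<^sup>2 * norm s"
proof -
  have "\<bar>v \<bullet> s\<bar> \<le> norm v * norm s" by (rule Cauchy_Schwarz_ineq2)
  also have "\<dots> \<le> (norm v + 3)\<^sup>2 * norm s"
    by (intro mult_right_mono) (auto simp: power2_eq_square algebra_simps add_nonneg_nonneg)
  finally show ?thesis using dirderiv_bound[of v s] abs_triangle_ineq[of "dirderiv \<psi> v s" "v \<bullet> s"]
    by (simp add: slope_def algebra_simps)
qed

lemma slope_measurable: "(\<lambda>v. slope v s) \<in> borel_measurable borel"
  unfolding slope_def using dirderiv_measurable by measurable

lemma dens_measurable: "dens \<in> borel_measurable borel"
  unfolding dens_def using potential_measurable[OF pot] by measurable

lemma dens_le: "dens v \<le> exp (- (norm v)\<^sup>2 / 2)" "0 < dens v"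
  using potential_nonneg[OF pot, of v] by (auto simp: dens_def)

lemma dens_diff_lim:
  "(\<lambda>k. 2 ^ k * (dens (v + (1 / 2 ^ k) *\<^sub>R s) - dens v)) \<longlonglongrightarrow> - dens v * slope v s"
proof -
  define t where "t k = - (\<psi> (v + (1 / 2 ^ k) *\<^sub>R s) - \<psi> v) - ((norm (v + (1 / 2 ^ k) *\<^sub>R s))\<^sup>2 - (norm v)\<^sup>2) / 2" for k :: nat
  have "((norm (v + (1 / 2 ^ k) *\<^sub>R s))\<^sup>2 - (norm v)\<^sup>2) / 2 = (1 / 2 ^ k) * (v \<bullet> s + (norm s)\<^sup>2 / 2 * (1 / 2) ^ k)" for k :: nat
    by (simp add: power2_norm_eq_inner inner_add_left inner_add_right inner_commute power_one_over) (simp add: field_simps)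
  then have "2 ^ k * t k = - (2 ^ k * (\<psi> (v + (1 / 2 ^ k) *\<^sub>R s) - \<psi> v)) - (v \<bullet> s + (norm s)\<^sup>2 / 2 * (1 / 2) ^ k)" for k
    by (simp add: t_def algebra_simps)
  moreover have "(\<lambda>k. - (2 ^ k * (\<psi> (v + (1 / 2 ^ k) *\<^sub>R s) - \<psi> v)) - (v \<bullet> s + (norm s)\<^sup>2 / 2 * (1 / 2) ^ k))
      \<longlonglongrightarrow> - dirderiv \<psi> v s - (v \<bullet> s + (norm s)\<^sup>2 / 2 * 0)"
    by (intro tendsto_intros dirderiv_lim LIMSEQ_power_zero) simp
  ultimately have "(\<lambda>k. 2 ^ k * t k) \<longlonglongrightarrow> - slope v s" by (simp add: slope_def)
  moreover have "((\<lambda>t. exp t - 1) has_real_derivative 1) (at 0)" by (auto intro!: derivative_eq_intros)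
  moreover have "filterlim (\<lambda>k. 2 ^ k :: real) at_top sequentially" by (rule filterlim_at_infinity_imp_filterlim_at_top[OF filterlim_realpow_sequentially_gt1]) auto
  ultimately have "(\<lambda>k. 2 ^ k * (exp (t k) - 1)) \<longlonglongrightarrow> 1 * (- slope v s)"
    by (intro tendsto_mult_at_zero[where f = "\<lambda>t. exp t - 1"]) auto
  then have "(\<lambda>k. dens v * (2 ^ k * (exp (t k) - 1))) \<longlonglongrightarrow> dens v * (1 * (- slope v s))" by (rule tendsto_mult[OF tendsto_const])
  moreover have "dens v * (2 ^ k * (exp (t k) - 1)) = 2 ^ k * (dens (v + (1 / 2 ^ k) *\<^sub>R s) - dens v)" for k
  proof -
    have "dens v * exp (t k) = dens (v + (1 / 2 ^ k) *\<^sub>R s)" by (simp add: dens_def t_def exp_add[symmetric] field_simps)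
    then show ?thesis by (simp add: algebra_simps)
  qed
  ultimately show ?thesis by simp
qed

text \<open>Supplies the dominating function for dominated convergence: the exponents differ by a
  Lipschitz amount, and for a step of norm at most 1 the density at the moved point decays uniformly
  in the step.\<close>

lemma dens_diff_bound:
  assumes h: "norm h \<le> 1"
  shows "\<bar>dens (v + h) - dens (v - h)\<bar> \<le> 2 * (A + 1) * (norm v + 3)\<^sup>2 * norm h * exp (1 / 2 - (norm v)\<^sup>2 / 4)"
proof -
  have *: "exp (- a) - exp (- b) \<le> \<bar>a - b\<bar> * e" if "exp (- a) \<le> e" for a b e :: real
  proof -
    have "exp (- b) = exp (- a) * exp (a - b)" by (simp add: exp_add[symmetric])
    moreover have "exp (- a) * (1 + (a - b)) \<le> exp (- a) * exp (a - b)" by (intro mult_left_mono exp_ge_add_one_self) auto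
    ultimately have "exp (- a) - exp (- b) \<le> exp (- a) * (b - a)" by (simp add: algebra_simps)
    also have "\<dots> \<le> exp (- a) * \<bar>a - b\<bar>" by (intro mult_left_mono) auto
    also have "\<dots> \<le> e * \<bar>a - b\<bar>" using that by (intro mult_right_mono) auto
    finally show ?thesis by (simp add: mult.commute)
  qed
  define a where "a k = \<psi> (v + k) + (norm (v + k))\<^sup>2 / 2" for k
  have da: "dens (v + k) = exp (- a k)" for k by (simp add: dens_def a_def)
  \<comment> \<open>From |v + 2 k|^2 \<ge> 0 one gets |v + k|^2 \<ge> |v|^2 / 2 - |k|^2, which
    explains the exponent \<open>1 / 2 - (norm v)\<^sup>2 / 4\<close>.\<close>
  have e: "exp (- a k) \<le> exp (1 / 2 - (norm v)\<^sup>2 / 4)" if k: "norm k \<le> 1" for k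
  proof -
    have "2 * (norm (v + k))\<^sup>2 + 2 * (norm k)\<^sup>2 - (norm v)\<^sup>2 = (norm (v + 2 *\<^sub>R k))\<^sup>2"
      by (simp add: power2_norm_eq_inner inner_add_left inner_add_right inner_commute)
    then have "0 \<le> 2 * (norm (v + k))\<^sup>2 + 2 * (norm k)\<^sup>2 - (norm v)\<^sup>2" by simp
    moreover have "(norm k)\<^sup>2 \<le> 1" using k by (simp add: power_le_one)
    ultimately show ?thesis using potential_nonneg[OF pot, of "v + k"] by (simp add: a_def)
  qed
  have "a h - a (- h) = (\<psi> (v + h) - \<psi> v) - (\<psi> (v + - h) - \<psi> v) + 2 * (v \<bullet> h)"
    by (simp add: a_def power2_norm_eq_inner inner_add_left inner_add_right inner_diff_left inner_diff_right inner_commute) argo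
  moreover have "\<bar>\<psi> (v + h) - \<psi> v\<bar> \<le> A * (norm v + 3)\<^sup>2 * norm h" by (rule potential_lipschitz[OF pot h])
  moreover have "\<bar>\<psi> (v + - h) - \<psi> v\<bar> \<le> A * (norm v + 3)\<^sup>2 * norm h" using potential_lipschitz[OF pot, of "- h" v] h by simp
  moreover have "\<bar>v \<bullet> h\<bar> \<le> (norm v + 3)\<^sup>2 * norm h"
  proof -
    have "\<bar>v \<bullet> h\<bar> \<le> norm v * norm h" by (rule Cauchy_Schwarz_ineq2)
    also have "\<dots> \<le> (norm v + 3)\<^sup>2 * norm h"
      by (intro mult_right_mono) (auto simp: power2_eq_square algebra_simps add_nonneg_nonneg)
    finally show ?thesis .
  qed
  ultimately have ad: "\<bar>a h - a (- h)\<bar> \<le> 2 * (A + 1) * (norm v + 3)\<^sup>2 * norm h" by (simp add: algebra_simps)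
  have "\<bar>dens (v + h) - dens (v - h)\<bar> \<le> \<bar>a h - a (- h)\<bar> * exp (1 / 2 - (norm v)\<^sup>2 / 4)"
    using *[OF e[OF h], of "a (- h)"] *[OF e[of "- h"], of "a h"] h da[of h] da[of "- h"] by (simp add: abs_le_iff abs_minus_commute)
  also have "\<dots> \<le> 2 * (A + 1) * (norm v + 3)\<^sup>2 * norm h * exp (1 / 2 - (norm v)\<^sup>2 / 4)"
    using ad by (intro mult_right_mono) auto
  finally show ?thesis .
qed

text \<open>With the chosen \<open>u\<close> the square \<open>(norm v + 3)\<^sup>2\<close> is at
  most \<open>8 * u\<close>, and \<open>u\<^sup>2 / 2 \<le> exp u\<close> gives the constant 128;
  half of the Gaussian decay is spent on \<open>exp u\<close>.\<close>

lemma poly_exp_bound: "((norm v + 3)\<^sup>2)\<^sup>2 * exp (- (norm v)\<^sup>2 / 2) \<le> 128 * exp (9 / 4) * exp (- (norm (v::'a))\<^sup>2 / 4)"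
proof -
  define u where "u = ((norm v)\<^sup>2 + 9) / 4"
  have "(norm v + 3)\<^sup>2 \<le> 8 * u"
    using zero_le_power2[of "norm v - 3"] by (simp add: u_def power2_eq_square algebra_simps)
  then have "((norm v + 3)\<^sup>2)\<^sup>2 \<le> (8 * u)\<^sup>2" by (intro power_mono) auto
  also have "\<dots> \<le> 128 * exp u"
  proof -
    have "0 \<le> u" by (simp add: u_def)
    then show ?thesis using exp_lower_Taylor_quadratic[of u] by (simp add: power_mult_distrib)
  qed
  finally have "((norm v + 3)\<^sup>2)\<^sup>2 * exp (- (norm v)\<^sup>2 / 2) \<le> 128 * exp u * exp (- (norm v)\<^sup>2 / 2)"
    by (intro mult_right_mono) auto
  also have "\<dots> = 128 * exp (9 / 4) * exp (- (norm v)\<^sup>2 / 4)"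
    by (simp add: u_def exp_add[symmetric] field_simps)
  finally show ?thesis .
qed

text \<open>A product of two values is half the sum of their squares minus half the squared
  difference, and by translation each square integrates to \<open>sconv \<psi> 0\<close>. The
  deficit is therefore a squared first difference, whose second-order behaviour needs only first
  derivatives of \<psi>.\<close>

lemma sconv_deficit:
  "sconv \<psi> x * exp (- (norm x)\<^sup>2 / 2) = sconv \<psi> 0
     - (1 / 2) * (\<integral>y. (dens ((1 / sqrt 2) *\<^sub>R (y + x)) - dens ((1 / sqrt 2) *\<^sub>R (y - x)))\<^sup>2 \<partial>lborel)"
proof -
  let ?r = "\<lambda>y. (1 / sqrt 2) *\<^sub>R y"
  note [measurable] = dens_measurable
  have sq: "(dens (?r y))\<^sup>2 = exp (- (\<psi> (?r (y + 0)) + \<psi> (?r (y - 0)) + (norm y)\<^sup>2 / 2))" for y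
    by (simp add: dens_def exp_double[symmetric] power_divide)
  have i0: "integrable lborel (\<lambda>y. (dens (?r y))\<^sup>2)" "(\<integral>y. (dens (?r y))\<^sup>2 \<partial>lborel) = sconv \<psi> 0"
    unfolding sq using sconv_integrable[OF pot, of 0] by (simp_all add: sconv_def)
  have sh: "integrable lborel (\<lambda>y. (dens (?r (y + c)))\<^sup>2)" "(\<integral>y. (dens (?r (y + c)))\<^sup>2 \<partial>lborel) = sconv \<psi> 0" for c
  proof -
    have d: "(lborel::'a measure) = distr lborel borel ((+) c)" by (rule lborel_distr_plus[symmetric])
    have "integrable (distr lborel borel ((+) c)) (\<lambda>y. (dens (?r y))\<^sup>2)" using i0(1) d by simp
    then show "integrable lborel (\<lambda>y. (dens (?r (y + c)))\<^sup>2)"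
      by (subst (asm) integrable_distr_eq) (auto simp: add.commute)
    have "(\<integral>y. (dens (?r y))\<^sup>2 \<partial>distr lborel borel ((+) c)) = sconv \<psi> 0" using i0(2) d by simp
    then show "(\<integral>y. (dens (?r (y + c)))\<^sup>2 \<partial>lborel) = sconv \<psi> 0"
      by (subst (asm) integral_distr) (auto simp: add.commute)
  qed
  have pr: "dens (?r (y + x)) * dens (?r (y - x)) = exp (- (\<psi> (?r (y + x)) + \<psi> (?r (y - x)) + (norm y)\<^sup>2 / 2)) * exp (- (norm x)\<^sup>2 / 2)" for y
  proof -
    have "(norm (?r (y + x)))\<^sup>2 + (norm (?r (y - x)))\<^sup>2 = (norm x)\<^sup>2 + (norm y)\<^sup>2"
      by (simp add: power_divide power2_norm_eq_inner inner_add_left inner_add_right inner_diff_left inner_diff_right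
        inner_commute add_divide_distrib[symmetric])
    then have "(- \<psi> (?r (y + x)) - (norm (?r (y + x)))\<^sup>2 / 2) + (- \<psi> (?r (y - x)) - (norm (?r (y - x)))\<^sup>2 / 2)
       = - (\<psi> (?r (y + x)) + \<psi> (?r (y - x)) + (norm y)\<^sup>2 / 2) + - (norm x)\<^sup>2 / 2" by argo
    then show ?thesis unfolding dens_def exp_add[symmetric] by (rule arg_cong)
  qed
  have ip: "integrable lborel (\<lambda>y. dens (?r (y + x)) * dens (?r (y - x)))"
    unfolding pr by (intro integrable_mult_left sconv_integrable[OF pot])
  have "(dens (?r (y + x)) - dens (?r (y - x)))\<^sup>2 = ((dens (?r (y + x)))\<^sup>2 + (dens (?r (y + - x)))\<^sup>2) - 2 * (dens (?r (y + x)) * dens (?r (y - x)))" for y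
    by (simp add: power2_eq_square algebra_simps)
  then have "(\<integral>y. (dens (?r (y + x)) - dens (?r (y - x)))\<^sup>2 \<partial>lborel)
     = (\<integral>y. ((dens (?r (y + x)))\<^sup>2 + (dens (?r (y + - x)))\<^sup>2) - 2 * (dens (?r (y + x)) * dens (?r (y - x))) \<partial>lborel)"
    by (simp only:)
  also have "\<dots> = (\<integral>y. ((dens (?r (y + x)))\<^sup>2 + (dens (?r (y + - x)))\<^sup>2) \<partial>lborel) - (\<integral>y. 2 * (dens (?r (y + x)) * dens (?r (y - x))) \<partial>lborel)"
    by (rule Bochner_Integration.integral_diff[OF Bochner_Integration.integrable_add[OF sh(1) sh(1)] integrable_mult_right[OF ip]])
  also have "(\<integral>y. ((dens (?r (y + x)))\<^sup>2 + (dens (?r (y + - x)))\<^sup>2) \<partial>lborel) = 2 * sconv \<psi> 0"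
    by (subst Bochner_Integration.integral_add[OF sh(1) sh(1)]) (simp only: sh(2))
  also have "(\<integral>y. 2 * (dens (?r (y + x)) * dens (?r (y - x))) \<partial>lborel) = 2 * (sconv \<psi> x * exp (- (norm x)\<^sup>2 / 2))"
    unfolding pr by (simp add: sconv_def)
  finally show ?thesis by argo
qed

text \<open>Twice the integral of the product of the derivatives of \<open>dens\<close> along x and
  x', taken at \<open>y / sqrt 2\<close>: a bilinear form of Fisher information type. The factor 2
  is the square of the factor 2 from the symmetric difference, halved by the scaling with
  \<open>1 / sqrt 2\<close>.\<close>

definition fisher :: "'a \<Rightarrow> 'a \<Rightarrow> real" where
  "fisher x x' = (\<integral>y. 2 * (dens ((1 / sqrt 2) *\<^sub>R y))\<^sup>2 * slope ((1 / sqrt 2) *\<^sub>R y) x * slope ((1 / sqrt 2) *\<^sub>R y) x' \<partial>lborel)"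

lemma integrable_gauss_eighth: "integrable lborel (\<lambda>y::'a. c * exp (- (norm ((1 / sqrt 2) *\<^sub>R y))\<^sup>2 / 4))"
  using integrable_mult_right[OF integrable_gauss_scaled[of "1 / 8"], of c] by (simp add: power_divide)

lemma fisher_integrable:
  "integrable lborel (\<lambda>y. 2 * (dens ((1 / sqrt 2) *\<^sub>R y))\<^sup>2 * slope ((1 / sqrt 2) *\<^sub>R y) x * slope ((1 / sqrt 2) *\<^sub>R y) x')"
proof (rule Bochner_Integration.integrable_bound[OF integrable_gauss_eighth])
  let ?r = "\<lambda>y::'a. (1 / sqrt 2) *\<^sub>R y"
  note [measurable] = dens_measurable slope_measurable
  have [measurable]: "(\<lambda>y. slope (?r y) x) \<in> borel_measurable borel" for x
    by (rule measurable_compose[OF _ slope_measurable]) measurable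
  show "(\<lambda>y. 2 * (dens (?r y))\<^sup>2 * slope (?r y) x * slope (?r y) x') \<in> borel_measurable lborel"
    by measurable
  have "norm (2 * (dens v)\<^sup>2 * slope v x * slope v x') \<le> norm (2 * (A + 1)\<^sup>2 * norm x * norm x' * (128 * exp (9 / 4)) * exp (- (norm v)\<^sup>2 / 4))" for v
  proof -
    have A: "0 \<le> A" by (rule potential_const_nonneg[OF pot])
    have "(dens v)\<^sup>2 \<le> exp (- (norm v)\<^sup>2 / 2)"
    proof -
      have "(dens v)\<^sup>2 \<le> (exp (- (norm v)\<^sup>2 / 2))\<^sup>2" using dens_le[of v] by (intro power_mono) auto
      also have "\<dots> \<le> exp (- (norm v)\<^sup>2 / 2)" by (simp add: exp_double[symmetric])
      finally show ?thesis .
    qed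
    then have "norm (2 * (dens v)\<^sup>2 * slope v x * slope v x')
        \<le> 2 * exp (- (norm v)\<^sup>2 / 2) * ((A + 1) * (norm v + 3)\<^sup>2 * norm x) * ((A + 1) * (norm v + 3)\<^sup>2 * norm x')"
      unfolding real_norm_def abs_mult abs_power2 abs_numeral using slope_bound[of v x] slope_bound[of v x'] A
      by (intro mult_mono) (auto intro!: mult_nonneg_nonneg)
    also have "\<dots> = 2 * (A + 1)\<^sup>2 * norm x * norm x' * (((norm v + 3)\<^sup>2)\<^sup>2 * exp (- (norm v)\<^sup>2 / 2))"
      by (simp add: power2_eq_square mult_ac)
    also have "\<dots> \<le> 2 * (A + 1)\<^sup>2 * norm x * norm x' * (128 * exp (9 / 4) * exp (- (norm v)\<^sup>2 / 4))"
      using A by (intro mult_left_mono poly_exp_bound) auto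
    finally show ?thesis by (simp add: mult_ac)
  qed
  then show "AE y in lborel. norm (2 * (dens (?r y))\<^sup>2 * slope (?r y) x * slope (?r y) x')
      \<le> norm (2 * (A + 1)\<^sup>2 * norm x * norm x' * (128 * exp (9 / 4)) * exp (- (norm (?r y))\<^sup>2 / 4))" by (intro AE_I2)
qed

lemma fisher_commute: "fisher x x' = fisher x' x"
  unfolding fisher_def by (simp add: mult_ac)

lemma fisher_linear: "linear (fisher x)"
proof (rule linearI)
  show "fisher x (a + b) = fisher x a + fisher x b" for a b
    unfolding fisher_def linear_add[OF slope_linear] distrib_left
    by (rule Bochner_Integration.integral_add[OF fisher_integrable fisher_integrable])
  show "fisher x (c *\<^sub>R a) = c *\<^sub>R fisher x a" for c a
    unfolding fisher_def linear_scale[OF slope_linear]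
    by (simp add: mult.left_commute[of _ c])
qed

lemma dens_diff_integral_lim:
  "(\<lambda>k. 4 ^ k * (\<integral>y. (dens ((1 / sqrt 2) *\<^sub>R (y + (1 / 2 ^ k) *\<^sub>R x)) - dens ((1 / sqrt 2) *\<^sub>R (y - (1 / 2 ^ k) *\<^sub>R x)))\<^sup>2 \<partial>lborel))
     \<longlonglongrightarrow> fisher x x"
proof -
  let ?r = "\<lambda>y::'a. (1 / sqrt 2) *\<^sub>R y"
  note [measurable] = dens_measurable
  define F where "F k y = 2 ^ k * (dens (?r (y + (1 / 2 ^ k) *\<^sub>R x)) - dens (?r (y - (1 / 2 ^ k) *\<^sub>R x)))" for k :: nat and y
  have sp: "?r (y + (1 / 2 ^ k) *\<^sub>R x) = ?r y + (1 / 2 ^ k) *\<^sub>R ?r x" "?r (y - (1 / 2 ^ k) *\<^sub>R x) = ?r y - (1 / 2 ^ k) *\<^sub>R ?r x" for y and k :: nat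
    by (simp_all add: algebra_simps)
  obtain N :: nat where N: "norm (?r x) < 2 ^ N" using real_arch_pow[of 2 "norm (?r x)"] by auto
  have [measurable]: "F k \<in> borel_measurable borel" for k unfolding F_def by measurable
  have [measurable]: "(\<lambda>y. slope (?r y) x) \<in> borel_measurable borel" for x
    by (rule measurable_compose[OF _ slope_measurable]) measurable
  let ?K = "(2 * (A + 1) * norm (?r x))\<^sup>2 * exp 1 * (128 * exp (9 / 4))"
  \<comment> \<open>The first \<open>N\<close> terms are dropped because the dominating bound needs
    steps of norm at most 1.\<close>
  have "(\<lambda>k. \<integral>y. (F (k + N) y)\<^sup>2 \<partial>lborel) \<longlonglongrightarrow> (\<integral>y. 2 * (dens (?r y))\<^sup>2 * slope (?r y) x * slope (?r y) x \<partial>lborel)"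
  proof (rule integral_dominated_convergence[OF _ _ integrable_gauss_eighth])
    have "(\<lambda>k. (F k y)\<^sup>2) \<longlonglongrightarrow> 2 * (dens (?r y))\<^sup>2 * slope (?r y) x * slope (?r y) x" for y
    proof -
      have "(\<lambda>k. 2 ^ k * (dens (?r y + (1 / 2 ^ k) *\<^sub>R ?r x) - dens (?r y)) - 2 ^ k * (dens (?r y + (1 / 2 ^ k) *\<^sub>R (- ?r x)) - dens (?r y)))
        \<longlonglongrightarrow> - dens (?r y) * slope (?r y) (?r x) - (- dens (?r y) * slope (?r y) (- ?r x))"
        by (intro tendsto_diff dens_diff_lim)
      moreover have "F k y = 2 ^ k * (dens (?r y + (1 / 2 ^ k) *\<^sub>R ?r x) - dens (?r y)) - 2 ^ k * (dens (?r y + (1 / 2 ^ k) *\<^sub>R (- ?r x)) - dens (?r y))" for k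
        unfolding F_def sp by (simp add: algebra_simps)
      ultimately have "(\<lambda>k. (F k y)\<^sup>2) \<longlonglongrightarrow> (- dens (?r y) * slope (?r y) (?r x) - (- dens (?r y) * slope (?r y) (- ?r x)))\<^sup>2"
        by (simp only:) (rule tendsto_power)
      moreover have "(- dens (?r y) * slope (?r y) (?r x) - (- dens (?r y) * slope (?r y) (- ?r x)))\<^sup>2 = 2 * (dens (?r y))\<^sup>2 * slope (?r y) x * slope (?r y) x"
        unfolding linear_neg[OF slope_linear] linear_scale[OF slope_linear] by (simp add: power2_eq_square field_simps)
      ultimately show ?thesis by simp
    qed
    then show "AE y in lborel. (\<lambda>k. (F (k + N) y)\<^sup>2) \<longlonglongrightarrow> 2 * (dens (?r y))\<^sup>2 * slope (?r y) x * slope (?r y) x"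
      by (intro AE_I2 LIMSEQ_ignore_initial_segment)
    have "norm ((F (k + N) y)\<^sup>2) \<le> ?K * exp (- (norm (?r y))\<^sup>2 / 4)" for k y
    proof -
      let ?h = "(1 / 2 ^ (k + N)) *\<^sub>R ?r x"
      have "norm (?r x) < 2 ^ (k + N)" by (rule less_le_trans[OF N power_increasing]) auto
      moreover have "\<bar>1 / 2 ^ m\<bar> * n \<le> 1" if "n < 2 ^ m" for n :: real and m :: nat using that by simp
      ultimately have h: "norm ?h \<le> 1" unfolding norm_scaleR[of "1 / 2 ^ (k + N)"] by blast
      have "\<bar>F (k + N) y\<bar> = 2 ^ (k + N) * \<bar>dens (?r y + ?h) - dens (?r y - ?h)\<bar>" unfolding F_def sp by (simp add: abs_mult)
      also have "\<dots> \<le> 2 ^ (k + N) * (2 * (A + 1) * (norm (?r y) + 3)\<^sup>2 * norm ?h * exp (1 / 2 - (norm (?r y))\<^sup>2 / 4))"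
        by (intro mult_left_mono dens_diff_bound[OF h]) auto
      also have "\<dots> = (2 ^ (k + N) * norm ?h) * (2 * (A + 1) * (norm (?r y) + 3)\<^sup>2 * exp (1 / 2 - (norm (?r y))\<^sup>2 / 4))"
        by (simp only: mult_ac)
      also have "2 ^ (k + N) * norm ?h = norm (?r x)" by simp
      finally have "\<bar>F (k + N) y\<bar>\<^sup>2 \<le> (norm (?r x) * (2 * (A + 1) * (norm (?r y) + 3)\<^sup>2 * exp (1 / 2 - (norm (?r y))\<^sup>2 / 4)))\<^sup>2"
        by (intro power_mono) auto
      also have "\<dots> = (2 * (A + 1) * norm (?r x))\<^sup>2 * exp 1 * (((norm (?r y) + 3)\<^sup>2)\<^sup>2 * exp (- (norm (?r y))\<^sup>2 / 2))"
      proof -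
        have e2: "(exp (1 / 2 - (norm (?r y))\<^sup>2 / 4))\<^sup>2 = exp 1 * exp (- (norm (?r y))\<^sup>2 / 2)"
          unfolding exp_double[symmetric] exp_add[symmetric] by (simp add: algebra_simps)
        have "(n * (a * p * e))\<^sup>2 = (a * n)\<^sup>2 * (p\<^sup>2 * e\<^sup>2)" for n a p e :: real by (simp add: power_mult_distrib)
        then show ?thesis unfolding e2 by (simp only: e2) (simp only: mult_ac)
      qed
      also have "\<dots> \<le> (2 * (A + 1) * norm (?r x))\<^sup>2 * exp 1 * (128 * exp (9 / 4) * exp (- (norm (?r y))\<^sup>2 / 4))"
        by (intro mult_left_mono poly_exp_bound) auto
      finally show ?thesis by (simp add: mult_ac)
    qed
    then show "AE y in lborel. norm ((F (k + N) y)\<^sup>2) \<le> ?K * exp (- (norm (?r y))\<^sup>2 / 4)" for k by (intro AE_I2)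
  qed measurable
  then have "(\<lambda>k. \<integral>y. (F k y)\<^sup>2 \<partial>lborel) \<longlonglongrightarrow> fisher x x"
    unfolding fisher_def by (rule LIMSEQ_offset)
  moreover have "(\<integral>y. (F k y)\<^sup>2 \<partial>lborel) = 4 ^ k * (\<integral>y. (dens (?r (y + (1 / 2 ^ k) *\<^sub>R x)) - dens (?r (y - (1 / 2 ^ k) *\<^sub>R x)))\<^sup>2 \<partial>lborel)" for k
  proof -
    have "(2 ^ k)\<^sup>2 = (4 ^ k :: real)" by (simp add: power2_eq_square power_mult_distrib[symmetric])
    then show ?thesis by (simp add: F_def power_mult_distrib)
  qed
  ultimately show ?thesis by simp
qed

text \<open>The logarithm of the deficit formula is expanded to first order in the deficit, which is
  of order 1 / 4^k. The summand \<open>- (norm x)\<^sup>2\<close> removes the Gaussian factor that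
  multiplies \<open>sconv\<close>.\<close>

lemma spot_blow_up:
  "(\<lambda>k. 4 ^ k * spot \<psi> ((1 / 2 ^ k) *\<^sub>R x)) \<longlonglongrightarrow> (fisher x x / sconv \<psi> 0 - (norm x)\<^sup>2) / 2"
proof -
  define S where "S = sconv \<psi> 0"
  have S: "0 < S" unfolding S_def by (rule sconv_pos[OF pot])
  define I where "I k = (\<integral>y. (dens ((1 / sqrt 2) *\<^sub>R (y + (1 / 2 ^ k) *\<^sub>R x)) - dens ((1 / sqrt 2) *\<^sub>R (y - (1 / 2 ^ k) *\<^sub>R x)))\<^sup>2 \<partial>lborel)" for k :: nat
  define e where "e k = I k / (2 * S)" for k
  have lim: "(\<lambda>k. 4 ^ k * I k) \<longlonglongrightarrow> fisher x x" unfolding I_def by (rule dens_diff_integral_lim)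
  have "(\<lambda>k. (4 ^ k * I k) / (2 * S)) \<longlonglongrightarrow> fisher x x / (2 * S)" using S by (intro tendsto_divide[OF lim] tendsto_const) simp
  then have "(\<lambda>k. 4 ^ k * e k) \<longlonglongrightarrow> fisher x x / (2 * S)" by (simp add: e_def)
  moreover have "filterlim (\<lambda>k. 4 ^ k :: real) at_top sequentially"
    by (rule filterlim_at_infinity_imp_filterlim_at_top[OF filterlim_realpow_sequentially_gt1]) auto
  moreover have "((\<lambda>t. - ln (1 - t)) has_real_derivative 1) (at 0)" by (auto intro!: derivative_eq_intros)
  ultimately have "(\<lambda>k. 4 ^ k * (- ln (1 - e k))) \<longlonglongrightarrow> 1 * (fisher x x / (2 * S))"
    by (intro tendsto_mult_at_zero[where f = "\<lambda>t. - ln (1 - t)"]) auto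
  moreover have "4 ^ k * (- ln (1 - e k)) = 4 ^ k * spot \<psi> ((1 / 2 ^ k) *\<^sub>R x) + (norm x)\<^sup>2 / 2" for k
  proof -
    let ?x = "(1 / 2 ^ k) *\<^sub>R x"
    have "1 - e k = (sconv \<psi> ?x * exp (- (norm ?x)\<^sup>2 / 2)) / S"
      unfolding sconv_deficit[of ?x] e_def I_def[symmetric] S_def[symmetric] using S by (simp add: diff_divide_distrib)
    also have "\<dots> = exp (- spot \<psi> ?x) * exp (- (norm ?x)\<^sup>2 / 2)" by (simp add: exp_spot[OF pot] S_def)
    also have "\<dots> = exp (- (spot \<psi> ?x + (norm ?x)\<^sup>2 / 2))" by (simp add: exp_add[symmetric])
    finally have "- ln (1 - e k) = spot \<psi> ?x + (norm ?x)\<^sup>2 / 2" by simp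
    moreover have "4 ^ k * ((norm ?x)\<^sup>2 / 2) = (norm x)\<^sup>2 / 2"
    proof -
      have "4 ^ k = (2 ^ k * 2 ^ k :: real)" by (simp add: power_mult_distrib[symmetric])
      then show ?thesis by (simp add: power_divide power2_eq_square)
    qed
    ultimately show ?thesis by (simp add: distrib_left)
  qed
  ultimately have "(\<lambda>k. 4 ^ k * spot \<psi> ((1 / 2 ^ k) *\<^sub>R x) + (norm x)\<^sup>2 / 2) \<longlonglongrightarrow> fisher x x / (2 * S)" by simp
  from tendsto_diff[OF this tendsto_const, of "(norm x)\<^sup>2 / 2"]
  show ?thesis by (simp add: S_def diff_divide_distrib mult.commute)
qed

end

section \<open>The inequality for pairs of quadratic potentials\<close>

lemma potential_quadratic:
  assumes P: "selfadjoint P" "\<And>x. 0 \<le> P x \<bullet> x" and K: "\<And>x. P x \<bullet> x \<le> K * (norm x)\<^sup>2"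
  shows "potential K (\<lambda>x. P x \<bullet> x / 2)"
proof (rule potentialI)
  show "P (- x) \<bullet> (- x) / 2 = P x \<bullet> x / 2" for x by (simp add: linear_neg[OF selfadjointD(1)[OF P(1)]])
  show "P 0 \<bullet> 0 / 2 = 0" by simp
  show "2 * (P x \<bullet> x / 2) \<le> P (x + h) \<bullet> (x + h) / 2 + P (x - h) \<bullet> (x - h) / 2" for x h
    unfolding selfadjoint_square[OF P(1)] using P(2)[of h] by argo
  show "P (x + h) \<bullet> (x + h) / 2 + P (x - h) \<bullet> (x - h) / 2 \<le> 2 * (P x \<bullet> x / 2) + K * (norm h)\<^sup>2" for x h
    unfolding selfadjoint_square[OF P(1)] using K[of h] by argo
qed

lemma gquad_eq_gint:
  fixes P :: "'a::euclidean_space \<Rightarrow> 'a"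
  assumes P: "linear P" "\<And>x. 0 \<le> P x \<bullet> x"
  shows "gquad (\<lambda>x. x + P x) = ennreal (gint (\<lambda>x. P x \<bullet> x / 2))"
proof -
  note [measurable] = linear_borel[OF P(1)]
  have e: "- ((u + P u) \<bullet> u) / 2 = - (P u \<bullet> u / 2) - (norm u)\<^sup>2 / 2" for u
    by (simp add: inner_add_left power2_norm_eq_inner)
  show ?thesis unfolding gquad_def e gint_def
    by (intro nn_integral_eq_integral gint_integrable) (use P(2) in auto)
qed

text \<open>The infimal convolution of two quadratics is again quadratic, given by a harmonic mean
  R. Any such mean satisfies the block inequality relative to the two forms, which reduces the claim
  to \<open>gquad_block\<close>. Definiteness of \<open>P\<close> provides the inverse of
  \<open>P1 + Q1\<close>.\<close>

lemma gint_infconv_quadratic_definite: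
  fixes P Q :: "'a::euclidean_space \<Rightarrow> 'a"
  assumes P: "selfadjoint P" "\<And>x. \<delta> * (norm x)\<^sup>2 \<le> P x \<bullet> x" and \<delta>: "0 < \<delta>"
    and Q: "selfadjoint Q" "\<And>x. 0 \<le> Q x \<bullet> x" and mu: "\<mu> > 0"
  shows "gint (\<lambda>x. P x \<bullet> x / 2) * gint (\<lambda>x. Q x \<bullet> x / 2)
    \<le> (gint (infconv \<mu> (\<lambda>x. P x \<bullet> x / 2) (\<lambda>x. Q x \<bullet> x / 2)))\<^sup>2"
proof -
  have P0: "0 \<le> P x \<bullet> x" for x using P(2)[of x] \<delta> by (meson less_imp_le mult_nonneg_nonneg order_trans zero_le_power2)
  obtain K1 K2 where K: "\<And>x. P x \<bullet> x \<le> K1 * (norm x)\<^sup>2" "\<And>x. Q x \<bullet> x \<le> K2 * (norm x)\<^sup>2"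
    using selfadjoint_bound[OF P(1)] selfadjoint_bound[OF Q(1)] by metis
  define K where "K = max K1 K2"
  have "P x \<bullet> x \<le> K * (norm x)\<^sup>2" "Q x \<bullet> x \<le> K * (norm x)\<^sup>2" for x
    using order_trans[OF K(1) mult_right_mono[of K1 K]] order_trans[OF K(2) mult_right_mono[of K2 K]] by (auto simp: K_def)
  then have pP: "potential K (\<lambda>x. P x \<bullet> x / 2)" and pQ: "potential K (\<lambda>x. Q x \<bullet> x / 2)"
    using potential_quadratic[OF P(1) P0] potential_quadratic[OF Q] by auto
  \<comment> \<open>The forms in the variables \<open>\<mu> *\<^sub>R x\<close> and
    \<open>(1 / \<mu>) *\<^sub>R y\<close>, which the constraint requires to sum to 2 z. The
    vanishing summand only gives the shape of \<open>selfadjoint_combination\<close>.\<close>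
  define P1 where "P1 = (\<lambda>x. (1 / \<mu>\<^sup>2) *\<^sub>R P x + 0 *\<^sub>R P x)"
  define Q1 where "Q1 = (\<lambda>x. \<mu>\<^sup>2 *\<^sub>R Q x + 0 *\<^sub>R Q x)"
  have P1: "selfadjoint P1" and Q1: "selfadjoint Q1" unfolding P1_def Q1_def by (rule selfadjoint_combination[OF P(1) P(1)] selfadjoint_combination[OF Q(1) Q(1)])+
  have q1: "0 \<le> Q1 x \<bullet> x" for x using Q(2)[of x] by (simp add: Q1_def)
  have p1: "0 \<le> P1 x \<bullet> x" for x using P0[of x] by (simp add: P1_def)
  have p1': "0 < P1 x \<bullet> x" if "x \<noteq> 0" for x
  proof -
    have "0 < \<delta> * (norm x)\<^sup>2" using \<delta> that by simp
    then have "0 < P x \<bullet> x" using P(2)[of x] by linarith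
    then show ?thesis using mu by (simp add: P1_def)
  qed
  define W where "W = (\<lambda>x. P1 x + Q1 x)"
  have W: "linear W" unfolding W_def using P1 Q1 by (intro linear_compose_add selfadjointD(1))
  obtain W' where W': "linear W'" "\<And>x. W (W' x) = x"
    using positive_inverse[OF W] p1' q1 by (auto simp: W_def inner_add_left add_pos_nonneg)
  \<comment> \<open>Splitting 2 z into 2 (z - \<open>a z\<close>) and 2 \<open>a z\<close>, this is
    the stationary point; the minimum is the form of \<open>R\<close>, twice the parallel sum of
    \<open>P1\<close> and \<open>Q1\<close>.\<close>
  define a where "a = (\<lambda>x. W' (P1 x))"
  have a: "linear a" unfolding a_def using linear_compose[OF selfadjointD(1)[OF P1] W'(1)] by (simp add: o_def)
  have Wa: "P1 (a x) + Q1 (a x) = P1 x" for x using W'(2)[of "P1 x"] by (simp add: a_def W_def)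
  define R where "R = (\<lambda>x. 2 *\<^sub>R Q1 (a x))"
  have PaQ: "P1 (a x) \<bullet> y = P1 x \<bullet> y - Q1 (a x) \<bullet> y" for x y
    using arg_cong[OF Wa[of x], of "\<lambda>z. z \<bullet> y"] by (simp add: inner_add_left)
  have sym: "P1 (a x) \<bullet> y = x \<bullet> P1 (a y)" for x y
  proof -
    have "P1 (a x) \<bullet> y = a x \<bullet> P1 y" by (rule selfadjointD(2)[OF P1])
    also have "\<dots> = a x \<bullet> P1 (a y) + a x \<bullet> Q1 (a y)" using Wa[of y] by (metis inner_add_right)
    also have "\<dots> = (P1 (a x) + Q1 (a x)) \<bullet> a y" by (simp add: inner_add_left selfadjointD(2)[OF P1] selfadjointD(2)[OF Q1])
    also have "\<dots> = x \<bullet> P1 (a y)" unfolding Wa by (rule selfadjointD(2)[OF P1])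
    finally show ?thesis .
  qed
  have R: "selfadjoint R" unfolding selfadjoint_def
  proof (intro conjI allI)
    show "linear R" unfolding R_def
      using linear_compose_scale_right[OF linear_compose[OF a selfadjointD(1)[OF Q1]]] by (simp add: o_def)
    fix x y
    have "Q1 (a x) \<bullet> y = P1 x \<bullet> y - P1 (a x) \<bullet> y" by (simp add: PaQ)
    also have "\<dots> = x \<bullet> P1 y - x \<bullet> P1 (a y)" by (simp only: sym selfadjointD(2)[OF P1, of x y])
    also have "\<dots> = x \<bullet> Q1 (a y)" using PaQ[of y x] by (simp add: inner_commute)
    finally show "R x \<bullet> y = x \<bullet> R y" by (simp add: R_def)
  qed
  have Qaa: "Q1 (a x) \<bullet> a x = P1 x \<bullet> a x - P1 (a x) \<bullet> a x" for x using PaQ[of x "a x"] by simp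
  \<comment> \<open>Completing the square: the left side is a sum of two nonnegative forms, so the
    right side is nonnegative, which is the block inequality up to the sign of y.\<close>
  have I1: "P1 (x - 2 *\<^sub>R a x) \<bullet> (x - 2 *\<^sub>R a x) + Q1 (y + 2 *\<^sub>R a x) \<bullet> (y + 2 *\<^sub>R a x) = P1 x \<bullet> x + Q1 y \<bullet> y + 2 * (R x \<bullet> y)" for x y
  proof -
    have "Q1 y \<bullet> (2 *\<^sub>R a x) = R x \<bullet> y" unfolding R_def using selfadjointD(2)[OF Q1, of "a x" y] by (simp add: inner_commute)
    then show ?thesis
      unfolding selfadjoint_square(2)[OF P1] selfadjoint_square(1)[OF Q1] linear_scale[OF selfadjointD(1)[OF P1]] linear_scale[OF selfadjointD(1)[OF Q1]]
      using Qaa[of x] by simp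
  qed
  have I2: "P1 (z - a z) \<bullet> (z - a z) + Q1 (a z) \<bullet> a z = R z \<bullet> z / 2" for z
  proof -
    have "P1 z \<bullet> a z = P1 (a z) \<bullet> z" using selfadjointD(2)[OF P1, of "a z" z] by (simp add: inner_commute)
    then show ?thesis
      unfolding selfadjoint_square(2)[OF P1] using Qaa[of z] PaQ[of z z] by (simp add: R_def)
  qed
  have R0: "0 \<le> R z \<bullet> z" for z using I2[of z] p1[of "z - a z"] q1[of "a z"] by simp
  have blockR: "2 * (R x \<bullet> y) \<le> P x \<bullet> x + Q y \<bullet> y" for x y
  proof -
    let ?x = "\<mu> *\<^sub>R x" and ?y = "- ((1 / \<mu>) *\<^sub>R y)"
    have "P1 ?x \<bullet> ?x = P x \<bullet> x" using mu by (simp add: P1_def linear_scale[OF selfadjointD(1)[OF P(1)]] power2_eq_square)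
    moreover have "Q1 ?y \<bullet> ?y = Q y \<bullet> y" using mu
      by (simp add: Q1_def linear_scale[OF selfadjointD(1)[OF Q(1)]] linear_neg[OF selfadjointD(1)[OF Q(1)]] power2_eq_square)
    moreover have "R ?x \<bullet> ?y = - (R x \<bullet> y)" using mu by (simp add: linear_scale[OF selfadjointD(1)[OF R]])
    ultimately show ?thesis using I1[of ?x ?y] p1[of "?x - 2 *\<^sub>R a ?x"] q1[of "?y + 2 *\<^sub>R a ?x"] by simp
  qed
  let ?m = "infconv \<mu> (\<lambda>x. P x \<bullet> x / 2) (\<lambda>x. Q x \<bullet> x / 2)"
  have pm: "potential (K * (1 / \<mu>\<^sup>2 + \<mu>\<^sup>2) / 2) ?m" by (rule potential_infconv[OF pP pQ mu])
  \<comment> \<open>Evaluation at the minimising pair. An upper bound for the potential is the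
    direction needed, as it bounds its Gaussian integral from below.\<close>
  have mR: "?m z \<le> R z \<bullet> z / 2" for z
  proof -
    let ?x = "(2 / \<mu>) *\<^sub>R (z - a z)" and ?y = "(2 * \<mu>) *\<^sub>R a z"
    have "\<mu> *\<^sub>R ?x + (1 / \<mu>) *\<^sub>R ?y = 2 *\<^sub>R z" using mu by (simp add: algebra_simps)
    then have "?m z \<le> (P ?x \<bullet> ?x / 2 + Q ?y \<bullet> ?y / 2) / 2"
      by (rule infconv_le[OF potential_nonneg[OF pP] potential_nonneg[OF pQ] mu])
    also have "P ?x \<bullet> ?x = 4 * (P1 (z - a z) \<bullet> (z - a z))"
      using mu unfolding linear_scale[OF selfadjointD(1)[OF P(1)]] by (simp add: P1_def power2_eq_square)
    also have "Q ?y \<bullet> ?y = 4 * (Q1 (a z) \<bullet> a z)"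
      using mu unfolding linear_scale[OF selfadjointD(1)[OF Q(1)]] by (simp add: Q1_def power2_eq_square)
    finally show ?thesis using I2[of z] by simp
  qed
  \<comment> \<open>Adding the identity absorbs the Gaussian weight into the form; the block
    inequality persists because 2 x . y \<le> |x|^2 + |y|^2.\<close>
  define I where "I = (\<lambda>T :: 'a \<Rightarrow> 'a. \<lambda>x. x + T x)"
  have sI: "selfadjoint (I T)" if "selfadjoint T" for T
    using selfadjoint_combination[OF selfadjoint_id that, of 1 1] by (simp add: I_def)
  have nI: "(norm x)\<^sup>2 \<le> I T x \<bullet> x" if "\<And>x. 0 \<le> T x \<bullet> x" for T x
    using that[of x] by (simp add: I_def inner_add_left power2_norm_eq_inner)
  have "gquad (I P) * gquad (I Q) \<le> (gquad (I R))\<^sup>2"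
  proof (rule gquad_block[OF sI[OF P(1)] nI sI[OF Q(1)] nI sI[OF R] nI])
    fix x y :: 'a
    have "0 \<le> (x - y) \<bullet> (x - y)" by simp
    then have "2 * (x \<bullet> y) \<le> x \<bullet> x + y \<bullet> y" by (simp add: inner_diff_left inner_diff_right inner_commute)
    then show "2 * (I R x \<bullet> y) \<le> I P x \<bullet> x + I Q y \<bullet> y" using blockR[of x y] by (simp add: I_def inner_add_left)
  qed (use P0 Q(2) R0 in auto)
  then have "ennreal (gint (\<lambda>x. P x \<bullet> x / 2)) * ennreal (gint (\<lambda>x. Q x \<bullet> x / 2)) \<le> (ennreal (gint (\<lambda>x. R x \<bullet> x / 2)))\<^sup>2"
    unfolding I_def gquad_eq_gint[OF selfadjointD(1)[OF P(1)] P0] gquad_eq_gint[OF selfadjointD(1)[OF Q(1)] Q(2)]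
      gquad_eq_gint[OF selfadjointD(1)[OF R] R0] .
  moreover have "0 \<le> gint \<theta>" for \<theta> :: "'a \<Rightarrow> real" by (simp add: gint_def)
  ultimately have "gint (\<lambda>x. P x \<bullet> x / 2) * gint (\<lambda>x. Q x \<bullet> x / 2) \<le> (gint (\<lambda>x. R x \<bullet> x / 2))\<^sup>2"
    by (simp add: ennreal_mult[symmetric] ennreal_power ennreal_le_iff)
  also have "\<dots> \<le> (gint ?m)\<^sup>2"
  proof (rule power_mono)
    show "gint (\<lambda>x. R x \<bullet> x / 2) \<le> gint ?m"
    proof (rule gint_mono[OF potential_measurable[OF pm] _ potential_nonneg[OF pm] mR])
      note [measurable] = linear_borel[OF selfadjointD(1)[OF R]]
      show "(\<lambda>x. R x \<bullet> x / 2) \<in> borel_measurable borel" by measurable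
    qed
  qed (simp add: gint_def)
  finally show ?thesis .
qed

text \<open>Adding \<open>?d n\<close> times the identity makes the first form definite. It raises
  the infimal convolution and hence lowers the right side, so the definite inequality already
  implies the bound with the unperturbed right side; on the left the perturbation disappears in the
  limit.\<close>

lemma gint_infconv_quadratic:
  fixes P Q :: "'a::euclidean_space \<Rightarrow> 'a"
  assumes P: "selfadjoint P" "\<And>x. 0 \<le> P x \<bullet> x" and Q: "selfadjoint Q" "\<And>x. 0 \<le> Q x \<bullet> x" and mu: "\<mu> > 0"
  shows "gint (\<lambda>x. P x \<bullet> x / 2) * gint (\<lambda>x. Q x \<bullet> x / 2)
    \<le> (gint (infconv \<mu> (\<lambda>x. P x \<bullet> x / 2) (\<lambda>x. Q x \<bullet> x / 2)))\<^sup>2"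
proof -
  let ?d = "\<lambda>n. 1 / real (Suc n)"
  define Pn where "Pn n = (\<lambda>x. 1 *\<^sub>R P x + ?d n *\<^sub>R x)" for n
  let ?q = "\<lambda>x. Q x \<bullet> x / 2" and ?p = "\<lambda>x. P x \<bullet> x / 2" and ?pn = "\<lambda>n x. Pn n x \<bullet> x / 2"
  have Pn: "selfadjoint (Pn n)" for n unfolding Pn_def by (rule selfadjoint_combination[OF P(1) selfadjoint_id])
  have Pnx: "Pn n x \<bullet> x = P x \<bullet> x + ?d n * (norm x)\<^sup>2" for n x
    by (simp add: Pn_def inner_add_left power2_norm_eq_inner)
  have Pn0: "0 \<le> Pn n x \<bullet> x" for n x unfolding Pnx using P(2)[of x] by (intro add_nonneg_nonneg) auto
  have pot: "\<exists>K. potential K (\<lambda>x. T x \<bullet> x / 2)" if "selfadjoint T" "\<And>x. 0 \<le> T x \<bullet> x" for T :: "'a \<Rightarrow> 'a"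
    using selfadjoint_bound[OF that(1)] potential_quadratic[OF that] by metis
  have meas: "(\<lambda>x. T x \<bullet> x / 2) \<in> borel_measurable borel" if "selfadjoint T" for T :: "'a \<Rightarrow> 'a"
  proof -
    note [measurable] = linear_borel[OF selfadjointD(1)[OF that]]
    show ?thesis by measurable
  qed
  have mm: "infconv \<mu> (\<lambda>x. T x \<bullet> x / 2) ?q \<in> borel_measurable borel \<and> (\<forall>x. 0 \<le> infconv \<mu> (\<lambda>x. T x \<bullet> x / 2) ?q x)"
    if T: "selfadjoint T" "\<And>x. 0 \<le> T x \<bullet> x" for T :: "'a \<Rightarrow> 'a"
  proof -
    obtain K1 K2 where K: "\<And>x. T x \<bullet> x \<le> K1 * (norm x)\<^sup>2" "\<And>x. Q x \<bullet> x \<le> K2 * (norm x)\<^sup>2"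
      using selfadjoint_bound[OF T(1)] selfadjoint_bound[OF Q(1)] by metis
    define K where "K = max K1 K2"
    have "T x \<bullet> x \<le> K * (norm x)\<^sup>2" "Q x \<bullet> x \<le> K * (norm x)\<^sup>2" for x
      using order_trans[OF K(1) mult_right_mono[of K1 K]] order_trans[OF K(2) mult_right_mono[of K2 K]] by (auto simp: K_def)
    then have "potential K (\<lambda>x. T x \<bullet> x / 2)" "potential K ?q"
      using potential_quadratic[OF T] potential_quadratic[OF Q] by auto
    from potential_infconv[OF this mu] show ?thesis by (blast intro: potential_measurable potential_nonneg)
  qed
  have "gint (?pn n) * gint ?q \<le> (gint (infconv \<mu> ?p ?q))\<^sup>2" for n
  proof -
    have "gint (?pn n) * gint ?q \<le> (gint (infconv \<mu> (?pn n) ?q))\<^sup>2"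
      by (rule gint_infconv_quadratic_definite[OF Pn _ _ Q mu, where \<delta> = "?d n"]) (use P(2) in \<open>simp_all add: Pnx\<close>)
    also have "\<dots> \<le> (gint (infconv \<mu> ?p ?q))\<^sup>2"
    proof (intro power_mono gint_mono)
      show "infconv \<mu> ?p ?q x \<le> infconv \<mu> (?pn n) ?q x" for x
      proof (rule infconv_greatest)
        fix u v assume uv: "\<mu> *\<^sub>R u + (1 / \<mu>) *\<^sub>R v = 2 *\<^sub>R x"
        have "infconv \<mu> ?p ?q x \<le> (?p u + ?q v) / 2" by (rule infconv_le[OF _ _ mu uv]) (use P(2) Q(2) in auto)
        also have "\<dots> \<le> (?pn n u + ?q v) / 2" by (simp add: Pnx)
        finally show "infconv \<mu> ?p ?q x \<le> (?pn n u + ?q v) / 2" .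
      qed (use Pn0 Q(2) mu in auto)
    qed (use mm[OF P] mm[OF Pn Pn0] in \<open>auto simp: gint_def\<close>)
    finally show ?thesis .
  qed
  moreover have "(\<lambda>n. gint (?pn n) * gint ?q) \<longlonglongrightarrow> gint ?p * gint ?q"
  proof (intro tendsto_mult tendsto_const gint_tendsto meas[OF Pn] meas[OF P(1)])
    show "0 \<le> ?pn n x" for n x using Pn0 by simp
    show "(\<lambda>n. ?pn n x) \<longlonglongrightarrow> ?p x" for x
    proof -
      have "(\<lambda>n. (P x \<bullet> x + ?d n * (norm x)\<^sup>2) / 2) \<longlonglongrightarrow> (P x \<bullet> x + 0 * (norm x)\<^sup>2) / 2"
        by (intro tendsto_intros LIMSEQ_Suc[OF lim_1_over_n]) simp
      then show ?thesis by (simp add: Pnx)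
    qed
  qed
  ultimately show ?thesis by (intro LIMSEQ_le_const2) auto
qed

section \<open>The dilated Gaussian Brunn--Minkowski inequality\<close>

text \<open>The Fisher form is represented by a self-adjoint map. Nonnegativity of \<open>P\<close>,
  a difference of two forms, is inherited from the nonnegative rescaled potentials whose limit it
  is.\<close>

lemma spot_blow_up_quadratic:
  fixes \<psi> :: "'a::euclidean_space \<Rightarrow> real"
  assumes pot: "potential A \<psi>"
  obtains P where "selfadjoint P" "\<And>x. 0 \<le> P x \<bullet> x"
    "\<And>x. (\<lambda>k. 4 ^ k * spot \<psi> ((1 / 2 ^ k) *\<^sub>R x)) \<longlonglongrightarrow> P x \<bullet> x / 2"
proof -
  define c where "c = 1 / sconv \<psi> 0"
  define F where "F x = (\<Sum>b\<in>Basis. fisher \<psi> x b *\<^sub>R b)" for x :: 'a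
  have Fxy: "F x \<bullet> y = fisher \<psi> x y" for x y
  proof -
    have "fisher \<psi> x y = fisher \<psi> x (\<Sum>b\<in>Basis. (y \<bullet> b) *\<^sub>R b)" by (simp add: euclidean_representation)
    also have "\<dots> = (\<Sum>b\<in>Basis. (y \<bullet> b) * fisher \<psi> x b)"
      by (simp add: linear_sum[OF fisher_linear[OF pot]] linear_scale[OF fisher_linear[OF pot]])
    moreover have "F x \<bullet> y = (\<Sum>b\<in>Basis. fisher \<psi> x b * (b \<bullet> y))" by (simp add: F_def inner_sum_left)
    ultimately show ?thesis by (simp add: inner_commute mult.commute)
  qed
  have F: "selfadjoint F" unfolding selfadjoint_def
  proof (intro conjI allI)
    show "linear F"
    proof (rule linearI)
      show "F (x + y) = F x + F y" for x y
        unfolding F_def fisher_commute[OF pot, of "x + y"] fisher_commute[OF pot, of x] fisher_commute[OF pot, of y]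
          linear_add[OF fisher_linear[OF pot]] by (simp add: scaleR_add_left sum.distrib)
      show "F (r *\<^sub>R x) = r *\<^sub>R F x" for r x
        unfolding F_def fisher_commute[OF pot, of "r *\<^sub>R x"] fisher_commute[OF pot, of x]
          linear_scale[OF fisher_linear[OF pot]] by (simp add: scaleR_sum_right)
    qed
    show "F x \<bullet> y = x \<bullet> F y" for x y using Fxy[of x y] Fxy[of y x] fisher_commute[OF pot, of x y] by (simp add: inner_commute)
  qed
  define P where "P = (\<lambda>x. c *\<^sub>R F x + (-1) *\<^sub>R x)"
  have P: "selfadjoint P" unfolding P_def by (rule selfadjoint_combination[OF F selfadjoint_id])
  have Px: "P x \<bullet> x / 2 = (fisher \<psi> x x / sconv \<psi> 0 - (norm x)\<^sup>2) / 2" for x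
    by (simp add: P_def inner_diff_left Fxy c_def power2_norm_eq_inner)
  have lim: "(\<lambda>k. 4 ^ k * spot \<psi> ((1 / 2 ^ k) *\<^sub>R x)) \<longlonglongrightarrow> P x \<bullet> x / 2" for x
    unfolding Px by (rule spot_blow_up[OF pot])
  have "0 \<le> P x \<bullet> x / 2" for x
    by (rule LIMSEQ_le_const[OF lim]) (use potential_nonneg[OF potential_spot[OF pot]] in auto)
  then show ?thesis using that P lim by simp
qed

theorem gint_infconv_le:
  fixes \<psi> \<phi> :: "'a::euclidean_space \<Rightarrow> real"
  assumes p: "potential A \<psi>" and q: "potential A \<phi>" and mu: "\<mu> > 0"
  shows "gint \<psi> * gint \<phi> \<le> (gint (infconv \<mu> \<psi> \<phi>))\<^sup>2"
proof -
  have A: "0 \<le> A" by (rule potential_const_nonneg[OF p])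
  obtain C and \<psi>0 \<phi>0 :: "'a \<Rightarrow> real" where C: "C > 0" and ex: "extremal A \<mu> C \<psi>0 \<phi>0"
    and max: "\<And>\<psi> \<phi> :: 'a \<Rightarrow> real. potential A \<psi> \<Longrightarrow> potential A \<phi> \<Longrightarrow> gint \<psi> * gint \<phi> \<le> C * (gint (infconv \<mu> \<psi> \<phi>))\<^sup>2"
    using extremal_exists[OF A mu] by blast
  have p0: "potential A \<psi>0" "potential A \<phi>0" using ex by (auto simp: extremal_def)
  note step = extremal_step[OF mu C _ max]
  let ?p = "\<lambda>k x. 4 ^ k * spot \<psi>0 ((1 / 2 ^ k) *\<^sub>R x)" and ?q = "\<lambda>k x. 4 ^ k * spot \<phi>0 ((1 / 2 ^ k) *\<^sub>R x)"
  have iter: "extremal A \<mu> C (?p k) (?q k)" for k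
  proof (induction k)
    case 0
    then show ?case using step(1)[OF ex] by simp
  next
    \<comment> \<open>Two rescalings by \<open>sqrt 2\<close> make one dyadic step, as in the
      blow-up limit.\<close>
    case (Suc k)
    have h: "(1 / 2 ^ k) *\<^sub>R ((1 / sqrt 2) *\<^sub>R ((1 / sqrt 2) *\<^sub>R x)) = (1 / 2 ^ Suc k) *\<^sub>R x" for x :: 'a by simp
    have e: "2 * (2 * (4 ^ k * t)) = 4 ^ Suc k * t" for t :: real by simp
    show ?case using step(2)[OF step(2)[OF Suc]] unfolding h e .
  qed
  obtain P where P: "selfadjoint P" "\<And>x. 0 \<le> P x \<bullet> x" "\<And>x. (\<lambda>k. ?p k x) \<longlonglongrightarrow> P x \<bullet> x / 2"
    using spot_blow_up_quadratic[OF p0(1)] by blast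
  obtain Q where Q: "selfadjoint Q" "\<And>x. 0 \<le> Q x \<bullet> x" "\<And>x. (\<lambda>k. ?q k x) \<longlonglongrightarrow> Q x \<bullet> x / 2"
    using spot_blow_up_quadratic[OF p0(2)] by blast
  let ?P = "\<lambda>x. P x \<bullet> x / 2" and ?Q = "\<lambda>x. Q x \<bullet> x / 2"
  have pk: "potential A (?p k)" "potential A (?q k)" "C * (gint (infconv \<mu> (?p k) (?q k)))\<^sup>2 \<le> gint (?p k) * gint (?q k)" for k
    using iter[of k] by (auto simp: extremal_def)
  \<comment> \<open>The constant \<open>C\<close> survives in the limit pair, whereas quadratic
    pairs satisfy the inequality with constant 1; hence \<open>C \<le> 1\<close>.\<close>
  have "C * (gint (infconv \<mu> ?P ?Q))\<^sup>2 \<le> gint ?P * gint ?Q"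
    by (rule gint_infconv_limit[where C = "\<lambda>_. C", OF pk(1,2) mu P(3) Q(3) tendsto_const _ pk(3)]) (use C in simp)
  also have "\<dots> \<le> (gint (infconv \<mu> ?P ?Q))\<^sup>2" by (rule gint_infconv_quadratic[OF P(1,2) Q(1,2) mu])
  finally have "C * (gint (infconv \<mu> ?P ?Q))\<^sup>2 \<le> 1 * (gint (infconv \<mu> ?P ?Q))\<^sup>2" by simp
  moreover have "0 < (gint (infconv \<mu> ?P ?Q))\<^sup>2"
  proof -
    have "potential A ?P" "potential A ?Q"
      using potential_limit[of A ?p, OF pk(1) P(3)] potential_limit[of A ?q, OF pk(2) Q(3)] by auto
    from potential_infconv[OF this mu] show ?thesis using potential_gint_pos by fastforce
  qed
  ultimately have "C \<le> 1" by (simp only: mult_le_cancel_right_pos)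
  then have "C * (gint (infconv \<mu> \<psi> \<phi>))\<^sup>2 \<le> 1 * (gint (infconv \<mu> \<psi> \<phi>))\<^sup>2" by (intro mult_right_mono) auto
  with max[OF p q] show ?thesis by simp
qed

section \<open>From potentials to convex bodies\<close>

definition gset :: "'a::euclidean_space set \<Rightarrow> real" where
  "gset S = (\<integral>x. indicator S x * exp (- (norm x)\<^sup>2 / 2) \<partial>lborel)"

lemma gset_integrable:
  assumes "S \<in> sets borel"
  shows "integrable lborel (\<lambda>x::'a::euclidean_space. indicator S x * exp (- (norm x)\<^sup>2 / 2))"
  by (rule Bochner_Integration.integrable_bound[OF integrable_gauss]) (use assms in \<open>auto simp: indicator_def\<close>)

lemma gset_mono:
  fixes S T :: "'a::euclidean_space set"
  assumes "S \<in> sets borel" "T \<in> sets borel" "S \<subseteq> T" shows "gset S \<le> gset T"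
  unfolding gset_def using assms by (intro integral_mono gset_integrable) (auto simp: indicator_def)

text \<open>Convexity of \<open>U\<close> makes the distance midpoint convex. For the upper bound
  the nearest point of \<open>x\<close> serves as a competitor for \<open>x + h\<close> and
  \<open>x - h\<close>, and the parallelogram identity evaluates the sum.\<close>

lemma potential_infdist:
  fixes U :: "'a::euclidean_space set"
  assumes U: "closed U" "convex U" "symmetric_set U" "U \<noteq> {}" and A: "0 \<le> A"
  shows "potential A (\<lambda>x. A / 2 * (infdist x U)\<^sup>2)"
proof (rule potentialI)
  have neg: "- u \<in> U" if "u \<in> U" for u using U(3) that unfolding symmetric_set_def by (metis image_eqI)
  obtain u where "u \<in> U" using U(4) by blast
  then have "(1/2) *\<^sub>R u + (1/2) *\<^sub>R (- u) \<in> U" by (intro convexD[OF U(2)] neg) auto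
  then have zero: "0 \<in> U" by simp
  then show "A / 2 * (infdist 0 U)\<^sup>2 = 0" by simp
  have le: "infdist (- x) U \<le> infdist x U" for x
  proof -
    obtain u where u: "u \<in> U" "infdist x U = dist x u" using infdist_attains_inf[OF U(1,4)] by blast
    have "infdist (- x) U \<le> dist (- x) (- u)" by (rule infdist_le[OF neg[OF u(1)]])
    then show ?thesis using u(2) by (simp add: dist_minus)
  qed
  show "A / 2 * (infdist (- x) U)\<^sup>2 = A / 2 * (infdist x U)\<^sup>2" for x
    using le[of x] le[of "- x"] by simp
  fix x h
  obtain p where p: "p \<in> U" "infdist (x + h) U = dist (x + h) p" using infdist_attains_inf[OF U(1,4)] by blast
  obtain q where q: "q \<in> U" "infdist (x - h) U = dist (x - h) q" using infdist_attains_inf[OF U(1,4)] by blast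
  have m: "(1/2) *\<^sub>R p + (1/2) *\<^sub>R q \<in> U" using p q by (intro convexD[OF U(2)]) auto
  have "infdist x U \<le> dist x ((1/2) *\<^sub>R p + (1/2) *\<^sub>R q)" by (rule infdist_le[OF m])
  also have "x - ((1/2) *\<^sub>R p + (1/2) *\<^sub>R q) = (1/2) *\<^sub>R ((x + h) - p) + (1/2) *\<^sub>R ((x - h) - q)"
    by (simp add: algebra_simps flip: scaleR_add_left)
  then have "dist x ((1/2) *\<^sub>R p + (1/2) *\<^sub>R q) \<le> (dist (x + h) p + dist (x - h) q) / 2"
    unfolding dist_norm using norm_triangle_ineq[of "(1/2) *\<^sub>R ((x + h) - p)" "(1/2) *\<^sub>R ((x - h) - q)"] by simp
  finally have "(infdist x U)\<^sup>2 \<le> ((infdist (x + h) U + infdist (x - h) U) / 2)\<^sup>2"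
    unfolding p q by (intro power_mono) (auto simp: infdist_nonneg)
  also have "\<dots> \<le> ((infdist (x + h) U)\<^sup>2 + (infdist (x - h) U)\<^sup>2) / 2"
    using zero_le_power2[of "infdist (x + h) U - infdist (x - h) U"] by (simp add: power2_eq_square field_simps)
  finally have "A * (2 * (infdist x U)\<^sup>2) \<le> A * ((infdist (x + h) U)\<^sup>2 + (infdist (x - h) U)\<^sup>2)"
    using A by (intro mult_left_mono) auto
  then show "2 * (A / 2 * (infdist x U)\<^sup>2) \<le> A / 2 * (infdist (x + h) U)\<^sup>2 + A / 2 * (infdist (x - h) U)\<^sup>2"
    by (simp add: algebra_simps)
  obtain r where r: "r \<in> U" "infdist x U = dist x r" using infdist_attains_inf[OF U(1,4)] by blast
  have "(infdist (x + h) U)\<^sup>2 + (infdist (x - h) U)\<^sup>2 \<le> (dist (x + h) r)\<^sup>2 + (dist (x - h) r)\<^sup>2"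
    by (intro add_mono power_mono infdist_le r infdist_nonneg)
  also have "\<dots> = 2 * (dist x r)\<^sup>2 + 2 * (norm h)\<^sup>2"
    by (simp add: dist_norm power2_norm_eq_inner inner_add_left inner_add_right inner_diff_left inner_diff_right inner_commute algebra_simps)
  finally have "A / 2 * ((infdist (x + h) U)\<^sup>2 + (infdist (x - h) U)\<^sup>2) \<le> A / 2 * (2 * (dist x r)\<^sup>2 + 2 * (norm h)\<^sup>2)"
    using A by (intro mult_left_mono) auto
  then show "A / 2 * (infdist (x + h) U)\<^sup>2 + A / 2 * (infdist (x - h) U)\<^sup>2 \<le> 2 * (A / 2 * (infdist x U)\<^sup>2) + A * (norm h)\<^sup>2"
    unfolding r(2) by (simp add: algebra_simps)
qed

text \<open>Multiples of squared distances are penalties: their Gaussian integrals dominate the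
  measures of \<open>U\<close> and \<open>V\<close>, and the infimal convolution dominates a
  multiple of the squared distance to \<open>M\<close>, whose Gaussian integral tends to the measure
  of \<open>M\<close> as the weight grows.\<close>

theorem gset_dilated_mean:
  fixes U V M :: "'a::euclidean_space set"
  assumes U: "compact U" "convex U" "symmetric_set U" "U \<noteq> {}" and V: "compact V" "convex V" "symmetric_set V" "V \<noteq> {}"
    and mu: "\<mu> > 0" and M: "closed M" "\<And>u v. u \<in> U \<Longrightarrow> v \<in> V \<Longrightarrow> (1/2) *\<^sub>R (\<mu> *\<^sub>R u + (1 / \<mu>) *\<^sub>R v) \<in> M"
  shows "gset U * gset V \<le> (gset M)\<^sup>2"
proof -
  \<comment> \<open>A common bound for the factors \<open>\<mu>\<^sup>2\<close> and
    \<open>1 / \<mu>\<^sup>2\<close> by which the squared distances to \<open>U\<close> and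
    \<open>V\<close> enter the squared distance to \<open>M\<close>.\<close>
  define \<kappa> where "\<kappa> = \<mu>\<^sup>2 + 1 / \<mu>\<^sup>2"
  have \<kappa>: "0 < \<kappa>" using mu by (simp add: \<kappa>_def add_pos_pos)
  have Mne: "M \<noteq> {}" using M(2) U(4) V(4) by blast
  have cl: "closed U" "closed V" using U V compact_imp_closed by auto
  have [measurable]: "U \<in> sets borel" "V \<in> sets borel" "M \<in> sets borel" using cl M by auto
  let ?d = "\<lambda>S (j::nat) (x::'a). real j / 2 * (infdist x S)\<^sup>2"
  let ?m = "\<lambda>j z. real j / (2 * \<kappa>) * (infdist z M)\<^sup>2"
  have pU: "potential (real j) (?d U j)" for j by (rule potential_infdist[OF cl(1) U(2-4)]) simp
  have pV: "potential (real j) (?d V j)" for j by (rule potential_infdist[OF cl(2) V(2-4)]) simp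
  have mm: "?m j \<in> borel_measurable borel" for j
    by (intro borel_measurable_continuous_onI continuous_intros) 
  have low: "gset S \<le> gint (?d S j)" if S: "closed S" "convex S" "symmetric_set S" "S \<noteq> {}" for S :: "'a set" and j
  proof -
    have p: "potential (real j) (?d S j)" by (rule potential_infdist[OF S]) simp
    show ?thesis unfolding gset_def gint_def
    proof (rule integral_mono)
      show "integrable lborel (\<lambda>x. indicator S x * exp (- (norm x)\<^sup>2 / 2))" using S by (intro gset_integrable) auto
      show "integrable lborel (\<lambda>x. exp (- ?d S j x - (norm x)\<^sup>2 / 2))"
        by (intro gint_integrable potential_measurable[OF p] potential_nonneg[OF p])
    qed (auto simp: indicator_def)
  qed
  have ge: "?m j z \<le> infconv \<mu> (?d U j) (?d V j) z" for j z
  proof (rule infconv_greatest[OF _ _ mu])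
    fix x y assume xy: "\<mu> *\<^sub>R x + (1 / \<mu>) *\<^sub>R y = 2 *\<^sub>R z"
    obtain p where p: "p \<in> U" "infdist x U = dist x p" using infdist_attains_inf[OF cl(1) U(4)] by blast
    obtain q where q: "q \<in> V" "infdist y V = dist y q" using infdist_attains_inf[OF cl(2) V(4)] by blast
    let ?z = "(1/2) *\<^sub>R (\<mu> *\<^sub>R p + (1 / \<mu>) *\<^sub>R q)"
    have "infdist z M \<le> dist z ?z" by (rule infdist_le[OF M(2)[OF p(1) q(1)]])
    also have "dist z ?z \<le> (\<mu> * dist x p + (1 / \<mu>) * dist y q) / 2"
    proof -
      have "z = (1/2) *\<^sub>R (\<mu> *\<^sub>R x + (1 / \<mu>) *\<^sub>R y)" unfolding xy by simp
      then have "z - ?z = (1/2) *\<^sub>R (\<mu> *\<^sub>R (x - p) + (1 / \<mu>) *\<^sub>R (y - q))" by (simp add: algebra_simps)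
      moreover have "norm (\<mu> *\<^sub>R (x - p) + (1 / \<mu>) *\<^sub>R (y - q)) \<le> \<mu> * norm (x - p) + (1 / \<mu>) * norm (y - q)"
        using norm_triangle_ineq[of "\<mu> *\<^sub>R (x - p)" "(1 / \<mu>) *\<^sub>R (y - q)"] mu by simp
      ultimately show ?thesis by (simp add: dist_norm)
    qed
    finally have "(infdist z M)\<^sup>2 \<le> ((\<mu> * dist x p + (1 / \<mu>) * dist y q) / 2)\<^sup>2"
      by (intro power_mono) (auto simp: infdist_nonneg)
    also have "\<dots> \<le> \<kappa> / 2 * ((dist x p)\<^sup>2 + (dist y q)\<^sup>2)"
    proof -
      have "((a + b) / 2)\<^sup>2 \<le> (a\<^sup>2 + b\<^sup>2) / 2" for a b :: real
        using zero_le_power2[of "a - b"] by (simp add: power2_eq_square field_simps)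
      then have "((\<mu> * dist x p + (1 / \<mu>) * dist y q) / 2)\<^sup>2 \<le> ((\<mu> * dist x p)\<^sup>2 + ((1 / \<mu>) * dist y q)\<^sup>2) / 2" .
      also have "\<dots> = (\<mu>\<^sup>2 * (dist x p)\<^sup>2 + 1 / \<mu>\<^sup>2 * (dist y q)\<^sup>2) / 2" by (simp add: power_mult_distrib power_divide)
      also have "\<dots> \<le> (\<kappa> * (dist x p)\<^sup>2 + \<kappa> * (dist y q)\<^sup>2) / 2"
        by (intro divide_right_mono add_mono mult_right_mono) (auto simp: \<kappa>_def)
      finally show ?thesis by (simp add: algebra_simps)
    qed
    finally have "real j / (2 * \<kappa>) * (infdist z M)\<^sup>2 \<le> real j / (2 * \<kappa>) * (\<kappa> / 2 * ((dist x p)\<^sup>2 + (dist y q)\<^sup>2))"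
      using \<kappa> by (intro mult_left_mono) auto
    also have "\<dots> = (?d U j x + ?d V j y) / 2" unfolding p q using \<kappa> by (simp add: field_simps)
    finally show "?m j z \<le> (?d U j x + ?d V j y) / 2" .
  qed auto
  have "gset U * gset V \<le> (gint (?m j))\<^sup>2" for j
  proof -
    have g0: "0 \<le> gset S" for S :: "'a set" by (simp add: gset_def)
    have "gset U * gset V \<le> gint (?d U j) * gint (?d V j)"
      using low[OF cl(1) U(2-4), of j] low[OF cl(2) V(2-4), of j] g0[of U] g0[of V] by (intro mult_mono) (auto intro: order_trans)
    also have "\<dots> \<le> (gint (infconv \<mu> (?d U j) (?d V j)))\<^sup>2" by (rule gint_infconv_le[OF pU pV mu])
    also have "\<dots> \<le> (gint (?m j))\<^sup>2"
    proof (intro power_mono gint_mono mm ge)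
      show "infconv \<mu> (?d U j) (?d V j) \<in> borel_measurable borel"
        by (rule potential_measurable[OF potential_infconv[OF pU pV mu]])
    qed (use \<kappa> in \<open>auto simp: gint_def\<close>)
    finally show ?thesis .
  qed
  moreover have "(\<lambda>j. (gint (?m j))\<^sup>2) \<longlonglongrightarrow> (gset M)\<^sup>2"
  proof (intro tendsto_power)
    show "(\<lambda>j. gint (?m j)) \<longlonglongrightarrow> gset M" unfolding gint_def gset_def
    proof (rule integral_dominated_convergence[OF _ _ integrable_gauss])
      show "(\<lambda>x. indicator M x * exp (- (norm x)\<^sup>2 / 2)) \<in> borel_measurable lborel" by measurable
      show "(\<lambda>x. exp (- ?m j x - (norm x)\<^sup>2 / 2)) \<in> borel_measurable lborel" for j using mm[of j] by measurable
      show "AE x in lborel. norm (exp (- ?m j x - (norm x)\<^sup>2 / 2)) \<le> exp (- (norm x)\<^sup>2 / 2)" for j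
        using \<kappa> by (intro AE_I2) auto
      show "AE x in lborel. (\<lambda>j. exp (- ?m j x - (norm x)\<^sup>2 / 2)) \<longlonglongrightarrow> indicator M x * exp (- (norm x)\<^sup>2 / 2)"
      proof (rule AE_I2)
        fix x :: 'a
        have e: "exp (- ?m j x - (norm x)\<^sup>2 / 2) = (exp (- (infdist x M)\<^sup>2 / (2 * \<kappa>))) ^ j * exp (- (norm x)\<^sup>2 / 2)" for j
          by (simp add: exp_of_nat_mult[symmetric] exp_add[symmetric])
        have "(\<lambda>j. (exp (- (infdist x M)\<^sup>2 / (2 * \<kappa>))) ^ j) \<longlonglongrightarrow> indicator M x"
        proof (cases "x \<in> M")
          case False
          then have "0 < infdist x M" using infdist_pos_not_in_closed[OF M(1) Mne] by simp
          then show ?thesis using \<kappa> False by (simp add: LIMSEQ_power_zero)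
        qed simp
        then show "(\<lambda>j. exp (- ?m j x - (norm x)\<^sup>2 / 2)) \<longlonglongrightarrow> indicator M x * exp (- (norm x)\<^sup>2 / 2)"
          unfolding e by (intro tendsto_mult tendsto_const)
      qed
    qed
  qed
  ultimately show ?thesis by (intro LIMSEQ_le_const) auto
qed

section \<open>Gaussian measure and balls\<close>

lemma emeasure_gaussian_measure:
  fixes S :: "'a::euclidean_space set"
  assumes "S \<in> sets borel"
  shows "emeasure gaussian_measure S = ennreal ((2 * pi) powr (- real DIM('a) / 2) * gset S)"
proof -
  let ?c = "(2 * pi) powr (- real DIM('a) / 2)"
  have m: "(\<lambda>x::'a. ennreal (?c * exp (- (norm x)\<^sup>2 / 2))) \<in> borel_measurable lebesgue"
    by (rule measurable_completion) measurable
  have [measurable]: "S \<in> sets lborel" using assms by simp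
  have "emeasure gaussian_measure S = (\<integral>\<^sup>+x. ennreal (?c * exp (- (norm x)\<^sup>2 / 2)) * indicator S x \<partial>lebesgue)"
    unfolding gaussian_measure_def by (rule emeasure_density[OF m]) (rule sets_completionI_sets, simp add: assms)
  also have "\<dots> = (\<integral>\<^sup>+x. ennreal (?c * exp (- (norm x)\<^sup>2 / 2)) * indicator S x \<partial>lborel)"
    by (rule nn_integral_completion) measurable
  also have "\<dots> = (\<integral>\<^sup>+x. ennreal (?c * (indicator S x * exp (- (norm x)\<^sup>2 / 2))) \<partial>lborel)"
    by (rule nn_integral_cong) (auto simp: indicator_def)
  also have "\<dots> = ennreal (?c * gset S)"
    unfolding gset_def using gset_integrable[OF assms]
    by (subst nn_integral_eq_integral) auto
  finally show ?thesis .
qed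

lemma gset_nonneg: "0 \<le> gset S" by (simp add: gset_def)

lemma gamma_n_eq_gset:
  fixes S :: "'a::euclidean_space set"
  assumes "S \<in> sets borel"
  shows "gamma_n S = (2 * pi) powr (- real DIM('a) / 2) * gset S"
  unfolding gamma_n_def measure_def emeasure_gaussian_measure[OF assms] using gset_nonneg[of S] by simp

lemma gamma_n_UNIV: "gamma_n (UNIV :: 'a::euclidean_space set) = 1"
proof -
  have "sqrt (2 * pi) ^ DIM('a) = (2 * pi) powr (real DIM('a) / 2)"
    by (simp add: powr_half_sqrt[symmetric] powr_powr powr_realpow[symmetric])
  then have "gset (UNIV :: 'a set) = (2 * pi) powr (real DIM('a) / 2)"
    using integral_gauss[where ?'a = 'a] by (simp add: gset_def)
  then show ?thesis by (subst gamma_n_eq_gset) (auto simp: powr_add[symmetric])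
qed

lemma sets_gaussian_measure: "sets (gaussian_measure :: 'a::euclidean_space measure) = sets lebesgue"
  by (simp add: gaussian_measure_def)

lemma space_gaussian_measure: "space (gaussian_measure :: 'a::euclidean_space measure) = UNIV"
  by (simp add: gaussian_measure_def)

lemma finite_gaussian_measure: "finite_measure (gaussian_measure :: 'a::euclidean_space measure)"
  by (rule finite_measureI) (simp add: space_gaussian_measure emeasure_gaussian_measure)

lemma gamma_n_mono:
  fixes S T :: "'a::euclidean_space set"
  assumes "S \<subseteq> T" "T \<in> sets lebesgue"
  shows "gamma_n S \<le> gamma_n T"
  unfolding gamma_n_def
  using finite_measure.finite_measure_mono[OF finite_gaussian_measure assms(1)] assms(2) by (simp add: sets_gaussian_measure)

lemma gamma_n_bounds: "0 \<le> gamma_n S" "gamma_n (S :: 'a::euclidean_space set) \<le> 1"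
  using gamma_n_mono[of S UNIV] gamma_n_UNIV[where ?'a = 'a] by (auto simp: gamma_n_def)

lemma gamma_n_negligible_diff:
  fixes S T :: "'a::euclidean_space set"
  assumes "S \<in> sets lebesgue" "S \<subseteq> T" "negligible (T - S)"
  shows "gamma_n T = gamma_n S" "T \<in> sets lebesgue"
proof -
  have N: "T - S \<in> sets lebesgue" "emeasure lebesgue (T - S) = 0"
    using assms(3) negligible_iff_null_sets[of "T - S"] by (auto dest: null_setsD1 null_setsD2)
  have T: "T = S \<union> (T - S)" using assms(2) by auto
  show "T \<in> sets lebesgue" using assms(1) N(1) T by (metis sets.Un)
  have "T - S \<in> null_sets (gaussian_measure :: 'a measure)"
    unfolding gaussian_measure_def
  proof (subst null_sets_density_iff)
    show "(\<lambda>x::'a. ennreal ((2 * pi) powr (- real DIM('a) / 2) * exp (- (norm x)\<^sup>2 / 2))) \<in> borel_measurable lebesgue"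
      by (rule measurable_completion) measurable
    have "AE x in lebesgue. x \<notin> T - S" by (rule AE_not_in) (use N in auto)
    then show "T - S \<in> sets lebesgue \<and> (AE x in lebesgue. x \<in> T - S \<longrightarrow> ennreal ((2 * pi) powr (- real DIM('a) / 2) * exp (- (norm x)\<^sup>2 / 2)) = 0)"
      using N(1) by (auto elim: eventually_mono)
  qed
  then have "emeasure gaussian_measure (S \<union> (T - S)) = emeasure gaussian_measure S"
    by (rule emeasure_Un_null_set[rotated]) (use assms(1) in \<open>simp add: sets_gaussian_measure\<close>)
  then show "gamma_n T = gamma_n S" using T by (simp add: gamma_n_def measure_def)
qed

text \<open>A convex set lies between its interior and its closure, which differ within the
  frontier, a null set; the completed \<sigma>-algebra then makes it measurable.\<close>

lemma convex_gamma_n: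
  fixes K :: "'a::euclidean_space set"
  assumes "convex K"
  shows "K \<in> sets lebesgue" "gamma_n (closure K) = gamma_n K"
proof -
  have i: "interior K \<in> sets lebesgue" by (simp add: borel_open)
  have n: "negligible (frontier K)" by (rule negligible_convex_frontier[OF assms])
  have 1: "negligible (K - interior K)" by (rule negligible_subset[OF n]) (auto simp: frontier_def intro: closure_subset[THEN subsetD])
  have 2: "negligible (closure K - interior K)" by (rule negligible_subset[OF n]) (auto simp: frontier_def)
  note a = gamma_n_negligible_diff[OF i interior_subset 1]
  show "K \<in> sets lebesgue" by (rule a(2))
  show "gamma_n (closure K) = gamma_n K"
    using gamma_n_negligible_diff(1)[OF i _ 2] a(1) interior_subset closure_subset by (metis order_trans)
qed

section \<open>Gaussian measure of dilated sets\<close>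

lemma gset_scale:
  fixes S :: "'a::euclidean_space set"
  assumes S: "S \<in> sets borel" "S' \<in> sets borel" and c: "0 < c" and iff: "\<And>x. c *\<^sub>R x \<in> S' \<longleftrightarrow> x \<in> S"
  shows "gset S' = c ^ DIM('a) * (\<integral>x. indicator S x * exp (- c\<^sup>2 * (norm x)\<^sup>2 / 2) \<partial>lborel)"
    and "integrable lborel (\<lambda>x. indicator S x * exp (- c\<^sup>2 * (norm x)\<^sup>2 / 2))"
proof -
  have i: "integrable lborel (\<lambda>x::'a. exp (- c\<^sup>2 * (norm x)\<^sup>2 / 2))"
    using integrable_gauss_scaled[of "c\<^sup>2 / 2", where ?'a = 'a] c by simp
  show i2: "integrable lborel (\<lambda>x. indicator S x * exp (- c\<^sup>2 * (norm x)\<^sup>2 / 2))"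
    by (rule Bochner_Integration.integrable_bound[OF i]) (use S in \<open>auto simp: indicator_def\<close>)
  have "ennreal (gset S') = (\<integral>\<^sup>+x. ennreal (indicator S' x * exp (- (norm x)\<^sup>2 / 2)) \<partial>lborel)"
    unfolding gset_def by (rule nn_integral_eq_integral[symmetric, OF gset_integrable[OF S(2)]]) simp
  also have "\<dots> = ennreal (\<bar>c\<bar> ^ DIM('a)) * (\<integral>\<^sup>+x. ennreal (indicator S' (0 + c *\<^sub>R x) * exp (- (norm (0 + c *\<^sub>R x))\<^sup>2 / 2)) \<partial>lborel)"
    by (rule nn_integral_lborel_affine) (use S c in auto)
  also have "(\<lambda>x. ennreal (indicator S' (0 + c *\<^sub>R x) * exp (- (norm (0 + c *\<^sub>R x))\<^sup>2 / 2))) = (\<lambda>x. ennreal (indicator S x * exp (- c\<^sup>2 * (norm x)\<^sup>2 / 2)))"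
    using iff by (auto simp: fun_eq_iff indicator_def power_mult_distrib)
  also have "(\<integral>\<^sup>+x. ennreal (indicator S x * exp (- c\<^sup>2 * (norm x)\<^sup>2 / 2)) \<partial>lborel) = ennreal (\<integral>x. indicator S x * exp (- c\<^sup>2 * (norm x)\<^sup>2 / 2) \<partial>lborel)"
    by (rule nn_integral_eq_integral[OF i2]) simp
  finally show "gset S' = c ^ DIM('a) * (\<integral>x. indicator S x * exp (- c\<^sup>2 * (norm x)\<^sup>2 / 2) \<partial>lborel)"
    using c gset_nonneg[of S'] by (simp add: ennreal_mult[symmetric] integral_nonneg_AE)
qed

context
  fixes S S' :: "'a::euclidean_space set" and c :: real
  assumes S: "S \<in> sets borel" "S' \<in> sets borel" and iff: "\<And>x. c *\<^sub>R x \<in> S' \<longleftrightarrow> x \<in> S" and c: "0 < c"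
begin

lemma gset_dilate_le: assumes "1 \<le> c" shows "gset S' \<le> c ^ DIM('a) * gset S"
proof -
  have "(norm x)\<^sup>2 \<le> c\<^sup>2 * (norm x)\<^sup>2" for x :: 'a
    using assms mult_right_mono[of 1 "c\<^sup>2" "(norm x)\<^sup>2"] by (simp add: one_le_power)
  then show ?thesis
    unfolding gset_scale(1)[OF S c iff] unfolding gset_def using c
    by (intro mult_left_mono integral_mono gset_scale(2)[OF S c iff] gset_integrable S) (auto simp: indicator_def)
qed

lemma gset_dilate_ge: assumes "c \<le> 1" shows "c ^ DIM('a) * gset S \<le> gset S'"
proof -
  have "c\<^sup>2 * (norm x)\<^sup>2 \<le> (norm x)\<^sup>2" for x :: 'a
    using assms c mult_right_mono[of "c\<^sup>2" 1 "(norm x)\<^sup>2"] by (simp add: power_le_one)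
  then show ?thesis
    unfolding gset_scale(1)[OF S c iff] unfolding gset_def using c
    by (intro mult_left_mono integral_mono gset_scale(2)[OF S c iff] gset_integrable S) (auto simp: indicator_def)
qed

text \<open>Pulling the dilation into the weight multiplies the density by a factor that decreases
  with the norm, so at given Gaussian measure a centred ball retains the most mass.\<close>

lemma gset_dilate_le_ball:
  assumes c1: "1 \<le> c" and R: "0 \<le> R" and le: "gset S \<le> gset (cball (0::'a) R)"
  shows "gset S' \<le> gset (cball (0::'a) (c * R))"
proof -
  let ?B = "cball (0::'a) R"
  have B: "?B \<in> sets borel" "cball (0::'a) (c * R) \<in> sets borel" by auto
  have iB: "c *\<^sub>R x \<in> cball 0 (c * R) \<longleftrightarrow> x \<in> ?B" for x :: 'a using c by simp
  define k where "k = c\<^sup>2 - 1"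
  define m where "m = exp (- k * R\<^sup>2 / 2)"
  let ?w = "\<lambda>x::'a. exp (- (norm x)\<^sup>2 / 2)" and ?W = "\<lambda>x::'a. exp (- c\<^sup>2 * (norm x)\<^sup>2 / 2)"
  \<comment> \<open>Bathtub principle: \<open>m\<close> is the value of the factor \<open>?W / ?w\<close> on the boundary of the ball.\<close>
  have pw: "m * (indicator ?B x * ?w x) - m * (indicator S x * ?w x) \<le> indicator ?B x * ?W x - indicator S x * ?W x" for x
  proof -
    have W: "?W x = exp (- k * (norm x)\<^sup>2 / 2) * ?w x"
      unfolding exp_add[symmetric] by (simp add: k_def field_simps)
    have k: "0 \<le> k" using c1 by (simp add: k_def one_le_power)
    have in_B: "m * ?w x \<le> ?W x" if "x \<in> ?B"
    proof -
      have "(norm x)\<^sup>2 \<le> R\<^sup>2" using that by (intro power_mono) auto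
      from mult_left_mono[OF this k] show ?thesis unfolding W m_def by (intro mult_right_mono) auto
    qed
    have out_B: "?W x \<le> m * ?w x" if "x \<notin> ?B"
    proof -
      have "R\<^sup>2 \<le> (norm x)\<^sup>2" using that R by (intro power_mono) auto
      from mult_left_mono[OF this k] show ?thesis unfolding W m_def by (intro mult_right_mono) auto
    qed
    show ?thesis using in_B out_B by (cases "x \<in> ?B"; cases "x \<in> S") (auto simp: indicator_def)
  qed
  have "0 \<le> m * (gset ?B - gset S)" using le by (simp add: m_def)
  also have "\<dots> = (\<integral>x. m * (indicator ?B x * ?w x) - m * (indicator S x * ?w x) \<partial>lborel)"
    by (subst Bochner_Integration.integral_diff[OF integrable_mult_right[OF gset_integrable[OF B(1)]] integrable_mult_right[OF gset_integrable[OF S(1)]]])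
      (simp add: gset_def right_diff_distrib)
  also have "\<dots> \<le> (\<integral>x. indicator ?B x * ?W x - indicator S x * ?W x \<partial>lborel)"
    using pw by (intro integral_mono Bochner_Integration.integrable_diff integrable_mult_right gset_integrable S B
        gset_scale(2)[OF S c iff] gset_scale(2)[OF B c iB])
  also have "\<dots> = (\<integral>x. indicator ?B x * ?W x \<partial>lborel) - (\<integral>x. indicator S x * ?W x \<partial>lborel)"
    by (rule Bochner_Integration.integral_diff[OF gset_scale(2)[OF B c iB] gset_scale(2)[OF S c iff]])
  finally show ?thesis
    unfolding gset_scale(1)[OF S c iff] gset_scale(1)[OF B c iB] using c by simp
qed

end

section \<open>The measure of a ball as a function of its radius\<close>

lemma Psi_eq_gset: "Psi TYPE('a::euclidean_space) r = (2 * pi) powr (- real DIM('a) / 2) * gset (cball (0::'a) r)"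
  unfolding Psi_def by (rule gamma_n_eq_gset) simp

text \<open>On a thin shell the density lies between its values on the two boundary spheres. This
  determines the derivative of \<open>Psi\<close> without polar coordinates.\<close>

lemma cball_shell_bounds:
  assumes r: "0 < a" "a < b"
  shows "(2 * pi) powr (- real DIM('a) / 2) * unit_ball_vol (real DIM('a)) * exp (- b\<^sup>2 / 2) * (b ^ DIM('a) - a ^ DIM('a))
     \<le> Psi TYPE('a::euclidean_space) b - Psi TYPE('a) a"
    and "Psi TYPE('a) b - Psi TYPE('a) a
     \<le> (2 * pi) powr (- real DIM('a) / 2) * unit_ball_vol (real DIM('a)) * exp (- a\<^sup>2 / 2) * (b ^ DIM('a) - a ^ DIM('a))"
proof -
  let ?A = "cball (0::'a) b - cball 0 a"
  let ?c = "(2 * pi) powr (- real DIM('a) / 2)"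
  have sub: "cball (0::'a) a \<subseteq> cball 0 b" using r by auto
  have vol: "measure lborel ?A = unit_ball_vol (real DIM('a)) * (b ^ DIM('a) - a ^ DIM('a))"
  proof -
    have "measure lborel ?A = measure lborel (cball (0::'a) b) - measure lborel (cball (0::'a) a)"
      using sub emeasure_lborel_cball_finite[of "0::'a" b] by (intro measure_Diff) auto
    then show ?thesis using r by (simp add: content_cball right_diff_distrib)
  qed
  have fin: "emeasure lborel ?A < \<infinity>"
    by (rule le_less_trans[OF emeasure_mono emeasure_lborel_cball_finite[of 0 b]]) auto
  have ii: "integrable lborel (\<lambda>x. k * indicator ?A x)" "(\<integral>x. k * indicator ?A x \<partial>lborel) = k * measure lborel ?A" for k :: real
    using fin by (auto simp: integrable_indicator_iff)
  have i: "integrable lborel (\<lambda>x. indicator ?A x * exp (- (norm x)\<^sup>2 / 2))" by (rule gset_integrable) auto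
  have diff: "gset (cball (0::'a) b) - gset (cball (0::'a) a) = gset ?A"
  proof -
    have "gset (cball (0::'a) b) - gset (cball (0::'a) a) = (\<integral>x. indicator (cball (0::'a) b) x * exp (- (norm x)\<^sup>2 / 2) - indicator (cball (0::'a) a) x * exp (- (norm x)\<^sup>2 / 2) \<partial>lborel)"
      unfolding gset_def by (rule Bochner_Integration.integral_diff[symmetric]; rule gset_integrable; simp)
    also have "\<dots> = gset ?A" unfolding gset_def
      by (rule Bochner_Integration.integral_cong) (use sub in \<open>auto simp: indicator_def\<close>)
    finally show ?thesis .
  qed
  have "exp (- b\<^sup>2 / 2) * measure lborel ?A \<le> gset ?A"
    unfolding ii(2)[symmetric] gset_def using ii(1) i
  proof (rule integral_mono)
    fix x :: 'a
    have "(norm x)\<^sup>2 \<le> b\<^sup>2" if "x \<in> ?A" using that by (intro power_mono) auto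
    then show "exp (- b\<^sup>2 / 2) * indicator ?A x \<le> indicator ?A x * exp (- (norm x)\<^sup>2 / 2)" by (auto simp: indicator_def)
  qed
  moreover have "gset ?A \<le> exp (- a\<^sup>2 / 2) * measure lborel ?A"
    unfolding ii(2)[symmetric] gset_def using i ii(1)
  proof (rule integral_mono)
    fix x :: 'a
    have "a\<^sup>2 \<le> (norm x)\<^sup>2" if "x \<in> ?A" using that r by (intro power_mono) auto
    then show "indicator ?A x * exp (- (norm x)\<^sup>2 / 2) \<le> exp (- a\<^sup>2 / 2) * indicator ?A x" by (auto simp: indicator_def)
  qed
  moreover have "Psi TYPE('a) b - Psi TYPE('a) a = ?c * gset ?A"
    unfolding Psi_eq_gset diff[symmetric] by (simp add: right_diff_distrib)
  ultimately show "?c * unit_ball_vol (real DIM('a)) * exp (- b\<^sup>2 / 2) * (b ^ DIM('a) - a ^ DIM('a)) \<le> Psi TYPE('a) b - Psi TYPE('a) a"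
     "Psi TYPE('a) b - Psi TYPE('a) a \<le> ?c * unit_ball_vol (real DIM('a)) * exp (- a\<^sup>2 / 2) * (b ^ DIM('a) - a ^ DIM('a))"
    unfolding vol using mult_left_mono[of _ _ ?c] by (simp_all add: mult_ac)
qed

text \<open>\<open>n * unit_ball_vol n\<close> is the area of the unit sphere, so
  \<open>c_const\<close> is the normalised constant of the radial density.\<close>

lemma Psi_density_const:
  fixes n :: nat assumes n: "0 < n"
  shows "(2 * pi) powr (- real n / 2) * unit_ball_vol (real n) * real n = c_const n"
proof -
  have g: "Gamma (real n / 2 + 1) = real n / 2 * Gamma (real n / 2)"
    using n by (intro Gamma_plus1) (auto simp: nonpos_Ints_def)
  have G: "0 < Gamma (real n / 2)" using n by (intro Gamma_real_pos) auto
  have "(2 * pi) powr (- real n / 2) * pi powr (real n / 2) = 2 powr (- real n / 2)"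
    by (simp add: powr_mult powr_minus)
  moreover have "2 powr (- real n / 2) = 1 / (2 powr (real n / 2 - 1)) / 2"
    by (simp add: powr_diff powr_minus_divide)
  ultimately have "(2 * pi) powr (- real n / 2) * pi powr (real n / 2) = 1 / (2 powr (real n / 2 - 1)) / 2" by simp
  then have "(2 * pi) powr (- real n / 2) * (pi powr (real n / 2) / (real n / 2 * Gamma (real n / 2))) * real n
      = 1 / (2 powr (real n / 2 - 1)) / 2 / (real n / 2 * Gamma (real n / 2)) * real n" by (metis times_divide_eq_right)
  then show ?thesis unfolding unit_ball_vol_def g c_const_def using n G by simp
qed

lemma Psi_has_derivative:
  assumes r: "0 < r"
  shows "(Psi TYPE('a::euclidean_space) has_real_derivative c_const DIM('a) * r ^ (DIM('a) - 1) * exp (- r\<^sup>2 / 2)) (at r)"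
proof -
  let ?n = "DIM('a)"
  let ?C = "(2 * pi) powr (- real DIM('a) / 2) * unit_ball_vol (real DIM('a))"
  define q where "q h = ((r + h) ^ ?n - r ^ ?n) / h" for h
  define D where "D = ?C * exp (- r\<^sup>2 / 2) * (real ?n * r ^ (?n - 1))"
  define U where "U h = ?C * exp (- r\<^sup>2 / 2) * q h" for h
  define L where "L h = ?C * exp (- (r + h)\<^sup>2 / 2) * q h" for h
  have "((\<lambda>x. x ^ ?n) has_real_derivative real ?n * r ^ (?n - 1)) (at r)" by (auto intro!: derivative_eq_intros)
  then have ql: "(q \<longlongrightarrow> real ?n * r ^ (?n - 1)) (at 0)" unfolding q_def by (simp add: DERIV_def)
  have Ul: "(U \<longlongrightarrow> D) (at 0)" unfolding U_def D_def by (intro tendsto_intros ql)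
  have "((\<lambda>h. ?C * exp (- (r + h)\<^sup>2 / 2) * q h) \<longlongrightarrow> ?C * exp (- (r + 0)\<^sup>2 / 2) * (real ?n * r ^ (?n - 1))) (at 0)"
    by (intro tendsto_intros ql) auto
  then have Ll: "(L \<longlongrightarrow> D) (at 0)" unfolding L_def D_def by simp
  let ?Q = "\<lambda>h. (Psi TYPE('a) (r + h) - Psi TYPE('a) r) / h"
  \<comment> \<open>For negative \<open>h\<close> the two shell bounds exchange roles, hence the
    minimum and maximum.\<close>
  have bounds: "min (L h) (U h) \<le> ?Q h \<and> ?Q h \<le> max (L h) (U h)" if h: "h \<noteq> 0" "\<bar>h\<bar> < r" for h
  proof (cases "0 < h")
    case True
    then have "L h \<le> ?Q h" "?Q h \<le> U h"
      using cball_shell_bounds[of r "r + h", where ?'a = 'a] r unfolding L_def U_def q_def by (simp_all add: divide_right_mono)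
    then show ?thesis by linarith
  next
    case False
    then have hn: "h < 0" using h by simp
    have "?Q h = (Psi TYPE('a) r - Psi TYPE('a) (r + h)) / (- h)" by (simp add: minus_divide_right[symmetric] diff_divide_distrib)
    moreover have "q h = (r ^ ?n - (r + h) ^ ?n) / (- h)" by (simp add: q_def minus_divide_right[symmetric] diff_divide_distrib)
    ultimately have "U h \<le> ?Q h" "?Q h \<le> L h"
      using cball_shell_bounds[of "r + h" r, where ?'a = 'a] hn h unfolding L_def U_def
      by (simp_all only: times_divide_eq_right) (simp_all add: divide_right_mono_neg)
    then show ?thesis by linarith
  qed
  have ev: "eventually (\<lambda>h. h \<noteq> 0 \<and> \<bar>h\<bar> < r) (at 0)"
    unfolding eventually_at using r by (intro exI[of _ r]) auto
  have "(?Q \<longlongrightarrow> D) (at 0)"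
  proof (rule tendsto_sandwich)
    show "((\<lambda>h. min (L h) (U h)) \<longlongrightarrow> D) (at 0)" using tendsto_min[OF Ll Ul] by simp
    show "((\<lambda>h. max (L h) (U h)) \<longlongrightarrow> D) (at 0)" using tendsto_max[OF Ll Ul] by simp
  qed (use ev bounds in \<open>auto elim: eventually_mono\<close>)
  moreover have "D = c_const ?n * r ^ (?n - 1) * exp (- r\<^sup>2 / 2)"
    unfolding D_def Psi_density_const[OF DIM_positive, symmetric] by (simp add: mult_ac)
  ultimately show ?thesis by (simp add: DERIV_def)
qed

lemma c_const_pos: "0 < n \<Longrightarrow> 0 < c_const n"
  unfolding c_const_def by (auto intro!: divide_pos_pos mult_pos_pos Gamma_real_pos)

lemma Psi_strict_mono: "0 < a \<Longrightarrow> a < b \<Longrightarrow> Psi TYPE('a::euclidean_space) a < Psi TYPE('a) b"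
proof -
  assume ab: "0 < a" "a < b"
  have "0 < (2 * pi) powr (- real DIM('a) / 2) * unit_ball_vol (real DIM('a)) * exp (- b\<^sup>2 / 2) * (b ^ DIM('a) - a ^ DIM('a))"
    using ab by (intro mult_pos_pos unit_ball_vol_pos) (auto intro!: power_strict_mono)
  with cball_shell_bounds(1)[OF ab, where ?'a = 'a] show ?thesis by linarith
qed

lemma Psi_less_one: "0 < r \<Longrightarrow> Psi TYPE('a::euclidean_space) r < 1"
  using Psi_strict_mono[of r "r + 1", where ?'a = 'a] gamma_n_bounds(2)[of "cball (0::'a) (r + 1)"] by (simp add: Psi_def)

lemma Psi_pos: "0 < r \<Longrightarrow> 0 < Psi TYPE('a::euclidean_space) r"
  using Psi_strict_mono[of "r / 2" r, where ?'a = 'a] gamma_n_bounds(1)[of "cball (0::'a) (r / 2)"] by (simp add: Psi_def)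

lemma gset_tendsto:
  fixes S :: "nat \<Rightarrow> 'a::euclidean_space set"
  assumes [measurable]: "\<And>k. S k \<in> sets borel" "T \<in> sets borel" and lim: "\<And>x. (\<lambda>k. indicator (S k) x :: real) \<longlonglongrightarrow> indicator T x"
  shows "(\<lambda>k. gset (S k)) \<longlonglongrightarrow> gset T"
  unfolding gset_def
proof (rule integral_dominated_convergence[OF _ _ integrable_gauss])
  show "AE x in lborel. (\<lambda>k. indicator (S k) x * exp (- (norm x)\<^sup>2 / 2)) \<longlonglongrightarrow> indicator T x * exp (- (norm x)\<^sup>2 / 2)"
    by (intro AE_I2 tendsto_mult tendsto_const lim)
qed (auto simp: indicator_def)

lemma gamma_n_tendsto:
  fixes S :: "nat \<Rightarrow> 'a::euclidean_space set"
  assumes "\<And>k. S k \<in> sets borel" "T \<in> sets borel" and lim: "\<And>x. (\<lambda>k. indicator (S k) x :: real) \<longlonglongrightarrow> indicator T x"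
  shows "(\<lambda>k. gamma_n (S k)) \<longlonglongrightarrow> gamma_n T"
  unfolding gamma_n_eq_gset[OF assms(1)] gamma_n_eq_gset[OF assms(2)] by (intro tendsto_intros gset_tendsto assms)

lemma Psi_surj:
  assumes p: "0 < p" "p < 1"
  obtains r where "0 < r" "Psi TYPE('a::euclidean_space) r = p"
proof -
  have "(\<lambda>k. gamma_n (cball (0::'a) (real k))) \<longlonglongrightarrow> gamma_n (UNIV :: 'a set)"
  proof (rule gamma_n_tendsto)
    fix x :: 'a
    obtain N where "norm x \<le> real N" using real_arch_simple by blast
    then have "eventually (\<lambda>k. indicator (cball (0::'a) (real k)) x = (1::real)) sequentially"
      by (auto simp: eventually_sequentially intro!: exI[of _ N])
    then show "(\<lambda>k. indicator (cball (0::'a) (real k)) x :: real) \<longlonglongrightarrow> indicator UNIV x" by (simp add: tendsto_eventually)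
  qed auto
  then have "eventually (\<lambda>k. p < gamma_n (cball (0::'a) (real k))) sequentially"
    using p by (intro order_tendstoD) (auto simp: gamma_n_UNIV)
  then obtain k where "p < gamma_n (cball (0::'a) (real k))" by (auto simp: eventually_sequentially)
  then have k: "p < Psi TYPE('a) (real (Suc k))"
    using gamma_n_mono[of "cball (0::'a) (real k)" "cball 0 (real (Suc k))"] subset_cball[of "real k" "real (Suc k)" "0::'a"]
    by (simp add: Psi_def)
  have "(\<lambda>k. gamma_n (cball (0::'a) (1 / real (Suc k)))) \<longlonglongrightarrow> gamma_n {0::'a}"
  proof (rule gamma_n_tendsto)
    fix x :: 'a
    show "(\<lambda>k. indicator (cball (0::'a) (1 / real (Suc k))) x :: real) \<longlonglongrightarrow> indicator {0} x"
    proof (cases "x = 0")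
      case False
      then obtain N where N: "1 / real (Suc N) < norm x" using nat_approx_posE[of "norm x"] by auto
      have "indicator (cball (0::'a) (1 / real (Suc k))) x = (0::real)" if "N \<le> k" for k
      proof -
        have "1 / real (Suc k) \<le> 1 / real (Suc N)" using that by (intro divide_left_mono) auto
        then show ?thesis using N by (simp add: indicator_def)
      qed
      then have "eventually (\<lambda>k. indicator (cball (0::'a) (1 / real (Suc k))) x = (0::real)) sequentially"
        by (auto simp: eventually_sequentially)
      then show ?thesis using False by (simp add: tendsto_eventually)
    qed simp
  qed auto
  moreover have "gamma_n {0::'a} = 0"
    using gamma_n_negligible_diff(1)[of "{}" "{0::'a}"] by (simp add: gamma_n_def)
  ultimately have "eventually (\<lambda>k. gamma_n (cball (0::'a) (1 / real (Suc k))) < p) sequentially"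
    using p by (intro order_tendstoD) auto
  then obtain j where j: "Psi TYPE('a) (1 / real (Suc j)) < p" by (auto simp: eventually_sequentially Psi_def)
  have le: "1 / real (Suc j) \<le> real (Suc k)" by (simp add: divide_le_eq) (metis le_add1 mult_le_mono nat_mult_1_right of_nat_1 of_nat_Suc of_nat_le_iff of_nat_mult plus_1_eq_Suc)
  \<comment> \<open>The intermediate value theorem is used away from 0, since the derivative, and
    with it continuity, is established only at positive radii.\<close>
  have "\<exists>r\<ge>1 / real (Suc j). r \<le> real (Suc k) \<and> Psi TYPE('a) r = p"
  proof (rule IVT)
    show "\<forall>x. 1 / real (Suc j) \<le> x \<and> x \<le> real (Suc k) \<longrightarrow> isCont (Psi TYPE('a)) x"
      by (intro allI impI DERIV_isCont[OF Psi_has_derivative]) (metis less_le_trans of_nat_0_less_iff zero_less_Suc zero_less_divide_1_iff)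
  qed (use j k le in auto)
  then obtain r where "1 / real (Suc j) \<le> r" "Psi TYPE('a) r = p" by blast
  moreover have "0 < 1 / real (Suc j)" by simp
  ultimately show ?thesis using that[of r] by linarith
qed

section \<open>Second-order comparison on the line\<close>

lemma second_derivative_test:
  fixes F F' :: "real \<Rightarrow> real"
  assumes F: "\<And>h. \<bar>h\<bar> < r \<Longrightarrow> (F has_real_derivative F' h) (at h)" and r: "0 < r"
    and F': "F' 0 = 0" "(F' has_real_derivative d) (at 0)" and d: "0 < d"
  obtains r' where "0 < r'" "\<And>h. \<bar>h\<bar> < r' \<Longrightarrow> F 0 \<le> F h"
proof -
  obtain r1 where r1: "0 < r1" "\<And>h. 0 < h \<Longrightarrow> h < r1 \<Longrightarrow> F' 0 < F' (0 + h)" using DERIV_pos_inc_right[OF F'(2) d] by blast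
  obtain r2 where r2: "0 < r2" "\<And>h. 0 < h \<Longrightarrow> h < r2 \<Longrightarrow> F' (0 - h) < F' 0" using DERIV_pos_inc_left[OF F'(2) d] by blast
  define r' where "r' = min r (min r1 r2)"
  have "F 0 \<le> F h" if h: "\<bar>h\<bar> < r'" for h
  proof (cases "0 < h")
    case True
    obtain z where z: "0 < z" "z < h" "F h - F 0 = (h - 0) * F' z"
      using MVT2[OF True, of F F'] F h by (auto simp: r'_def)
    then have "0 < F' z" using r1(2)[of z] h F'(1) by (simp add: r'_def)
    then have "0 \<le> (h - 0) * F' z" using True by (intro mult_nonneg_nonneg) auto
    then show ?thesis using z(3) by linarith
  next
    case False
    show ?thesis
    proof (cases "h = 0")
      case neq: False
      then have hn: "h < 0" using False by simp
      obtain z where z: "h < z" "z < 0" "F 0 - F h = (0 - h) * F' z"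
        using MVT2[OF hn, of F F'] F h by (auto simp: r'_def)
      then have "F' z < 0" using r2(2)[of "- z"] h hn F'(1) by (simp add: r'_def)
      then have "(0 - h) * F' z \<le> 0" using hn by (intro mult_nonneg_nonpos) auto
      then show ?thesis using z(3) by linarith
    qed simp
  qed
  moreover have "0 < r'" using r r1 r2 by (simp add: r'_def)
  ultimately show ?thesis using that by blast
qed

text \<open>A parabola below \<tau> composed with \<open>s\<close> is carried to one below
  \<open>s\<close>: a quadratic \<open>g\<close> is chosen so that \<tau> composed with
  \<open>g\<close> has the same slope at \<open>u0\<close> as the given parabola and smaller
  curvature. Then \<tau>(g) stays below locally, and monotonicity of \<tau> removes \<tau>.\<close>

lemma lower_parabola_pullback:
  fixes \<tau> \<tau>' s :: "real \<Rightarrow> real"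
  assumes \<tau>: "\<And>x. x < 0 \<Longrightarrow> (\<tau> has_real_derivative \<tau>' x) (at x)"
    and mono: "\<And>x y. x < y \<Longrightarrow> y < 0 \<Longrightarrow> \<tau> x < \<tau> y"
    and s0: "s u0 < 0" and d2: "(\<tau>' has_real_derivative \<tau>2) (at (s u0))" and pos: "0 < \<tau>' (s u0)"
    and neg: "\<And>u. \<bar>u - u0\<bar> < r \<Longrightarrow> s u < 0" and r: "0 < r" and \<delta>: "0 < \<delta>"
    and touch: "\<And>u. \<bar>u - u0\<bar> < r \<Longrightarrow> \<tau> (s u0) + \<beta> * (u - u0) + \<delta> * (u - u0)\<^sup>2 \<le> \<tau> (s u)"
  obtains p P r' where "0 < r'" "0 < P + \<tau>2 / \<tau>' (s u0) * p\<^sup>2"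
    "\<And>u. \<bar>u - u0\<bar> < r' \<Longrightarrow> s u0 + p * (u - u0) + P / 2 * (u - u0)\<^sup>2 \<le> s u"
proof -
  define t1 where "t1 = \<tau>' (s u0)"
  define p where "p = \<beta> / t1"
  \<comment> \<open>With this value \<tau> composed with \<open>g\<close> has second derivative
    \<delta> at 0, half of that of the touching parabola; the other half is the strict margin used
    below.\<close>
  define P where "P = (\<delta> - \<tau>2 * p\<^sup>2) / t1"
  define g where "g h = s u0 + p * h + P / 2 * h\<^sup>2" for h
  define F where "F h = \<beta> * h + \<delta> * h\<^sup>2 - (\<tau> (g h) - \<tau> (s u0))" for h
  define F' where "F' h = \<beta> + 2 * \<delta> * h - \<tau>' (g h) * (p + P * h)" for h
  have t1: "0 < t1" using pos by (simp add: t1_def)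
  have g0: "g 0 = s u0" by (simp add: g_def)
  have dg: "(g has_real_derivative (p + P * h)) (at h)" for h
    unfolding g_def by (auto intro!: derivative_eq_intros)
  have "isCont g 0" using dg DERIV_isCont by blast
  then have "\<exists>d>0. \<forall>h. \<bar>h\<bar> < d \<longrightarrow> g h < 0"
  proof -
    have "(g \<longlongrightarrow> s u0) (at 0)" using \<open>isCont g 0\<close> g0 by (simp add: isCont_def)
    from order_tendstoD(2)[OF this s0] obtain d where "d > 0" "\<And>x. x \<noteq> 0 \<Longrightarrow> dist x 0 < d \<Longrightarrow> g x < 0"
      unfolding eventually_at by auto
    then show ?thesis using g0 s0 by (intro exI[of _ d]) (metis dist_real_def diff_zero)
  qed
  then obtain r1 where r1: "0 < r1" "\<And>h. \<bar>h\<bar> < r1 \<Longrightarrow> g h < 0" by blast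
  have "(F has_real_derivative F' h) (at h)" if "\<bar>h\<bar> < r1" for h
    unfolding F_def F'_def
    by (auto intro!: derivative_eq_intros DERIV_chain2[OF \<tau> dg] r1(2) that)
  moreover have "F' 0 = 0" using t1 by (simp add: F'_def g0 p_def flip: t1_def)
  moreover have "(F' has_real_derivative \<delta>) (at 0)"
  proof -
    have "((\<lambda>h. \<tau>' (g h)) has_real_derivative \<tau>2 * (p + P * 0)) (at 0)"
      by (rule DERIV_chain2[OF _ dg]) (use d2 g0 in simp)
    then have "(F' has_real_derivative (2 * \<delta> - (\<tau>2 * (p + P * 0) * (p + P * 0) + P * \<tau>' (g 0)))) (at 0)"
      unfolding F'_def by (auto intro!: derivative_eq_intros)
    moreover have "2 * \<delta> - (\<tau>2 * (p + P * 0) * (p + P * 0) + P * \<tau>' (g 0)) = \<delta>"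
      using t1 by (simp add: g0 P_def power2_eq_square flip: t1_def)
    ultimately show ?thesis by (simp only:)
  qed
  ultimately obtain r2 where r2: "0 < r2" "\<And>h. \<bar>h\<bar> < r2 \<Longrightarrow> F 0 \<le> F h"
    using second_derivative_test[of r1 F F' \<delta>] r1(1) \<delta> by blast
  show ?thesis
  proof (rule that)
    show "0 < min r (min r1 r2)" using r r1 r2 by simp
    have "P + \<tau>2 / \<tau>' (s u0) * p\<^sup>2 = \<delta> / t1" using t1 by (simp add: P_def diff_divide_distrib flip: t1_def)
    then show "0 < P + \<tau>2 / \<tau>' (s u0) * p\<^sup>2" using \<delta> t1 by simp
    fix u assume u: "\<bar>u - u0\<bar> < min r (min r1 r2)"
    have "\<tau> (g (u - u0)) \<le> \<tau> (s u)"
      using r2(2)[of "u - u0"] touch[of u] u by (simp add: F_def g0)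
    then have "g (u - u0) \<le> s u" using mono[of "s u" "g (u - u0)"] r1(2)[of "u - u0"] u by fastforce
    then show "s u0 + p * (u - u0) + P / 2 * (u - u0)\<^sup>2 \<le> s u" by (simp add: g_def)
  qed
qed

lemma ln_cosh_le: "ln (cosh x) \<le> x\<^sup>2 / 2" for x :: real
proof -
  have le: "cosh x \<le> exp (x\<^sup>2 / 2)" if "0 \<le> x" for x :: real
  proof -
    define f where "f t = exp (t\<^sup>2 / 2) - cosh t" for t :: real
    have th: "sinh t \<le> t * cosh t" if "0 \<le> t" for t :: real
    proof -
      have "0 * cosh 0 - sinh 0 \<le> t * cosh t - sinh (t::real)"
      proof (rule DERIV_nonneg_imp_nondecreasing[OF that, of "\<lambda>t. t * cosh t - sinh t"])
        fix y :: real assume "0 \<le> y"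
        then show "\<exists>d. ((\<lambda>t. t * cosh t - sinh t) has_real_derivative d) (at y) \<and> 0 \<le> d"
          by (intro exI[of _ "y * sinh y"]) (auto intro!: derivative_eq_intros)
      qed
      then show ?thesis by simp
    qed
    have "ln (cosh 0) - 0\<^sup>2 / 2 \<ge> ln (cosh x) - x\<^sup>2 / 2"
    proof (rule DERIV_nonpos_imp_nonincreasing[OF that, of "\<lambda>t. ln (cosh t) - t\<^sup>2 / 2"])
      fix y :: real assume "0 \<le> y"
      then have "sinh y / cosh y \<le> y" using th[of y] by (simp add: divide_le_eq)
      then show "\<exists>d. ((\<lambda>t. ln (cosh t) - t\<^sup>2 / 2) has_real_derivative d) (at y) \<and> d \<le> 0"
        by (intro exI[of _ "sinh y / cosh y - y"]) (auto intro!: derivative_eq_intros)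
    qed
    then have "ln (cosh x) \<le> x\<^sup>2 / 2" by simp
    then have "exp (ln (cosh x)) \<le> exp (x\<^sup>2 / 2)" by (simp only: exp_le_cancel_iff)
    then show ?thesis by simp
  qed
  have "cosh x \<le> exp (x\<^sup>2 / 2)" using le[of "\<bar>x\<bar>"] by (cases "0 \<le> x") auto
  then have "ln (cosh x) \<le> ln (exp (x\<^sup>2 / 2))" by (intro ln_mono) auto
  then show ?thesis by simp
qed

text \<open>Expanding the hypothesis \<open>key\<close> to second order with \<open>\<eta> = \<kappa> e\<close>, \<open>e \<rightarrow> 0\<close>, bounds the second derivative
  \<open>P\<close> by \<open>N * \<kappa>\<^sup>2 - 2 * p * \<kappa>\<close>; the choice \<open>\<kappa> = p / n\<close> contradicts the last hypothesis.\<close>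
lemma parabola_contradiction:
  fixes s G :: "real \<Rightarrow> real"
  assumes G: "(G has_real_derivative N) (at y0)" "G y0 = s u0" and mono: "strict_mono G" and N: "0 < N" and r: "0 < r"
    and surj: "\<And>u. \<bar>u - u0\<bar> < r \<Longrightarrow> \<exists>y. G y = s u"
    and key: "\<And>e \<eta> y. 0 < e \<Longrightarrow> e < r \<Longrightarrow> G y = s (u0 - e * tanh \<eta>) \<Longrightarrow> s (u0 - e) + s (u0 + e) \<le> 2 * G (ln (cosh \<eta>) + y)"
    and low: "\<And>u. \<bar>u - u0\<bar> < r \<Longrightarrow> s u0 + p * (u - u0) + P / 2 * (u - u0)\<^sup>2 \<le> s u"
    and P: "0 < P + (2 / n - N / n\<^sup>2) * p\<^sup>2" and n: "n \<noteq> 0"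
  shows False
proof -
  define \<kappa> where "\<kappa> = p / n"
  define \<Delta> where "\<Delta> = P + (2 / n - N / n\<^sup>2) * p\<^sup>2"
  \<comment> \<open>A quarter of the contradiction margin, in units of \<open>N\<close>: the
    coefficient below becomes \<open>2 * (N * B) = P - \<Delta> / 2\<close>.\<close>
  define \<epsilon> where "\<epsilon> = \<Delta> / (4 * N)"
  have \<epsilon>: "0 < \<epsilon>" using P N by (simp add: \<epsilon>_def \<Delta>_def)
  obtain g where g: "\<And>y. G y - G y0 = g y * (y - y0)" "isCont g y0" "g y0 = N"
    using G(1) unfolding CARAT_DERIV by auto
  \<comment> \<open>Coefficients of \<open>e\<^sup>2\<close> in bounds for log-radii:
    \<open>b\<close> is -p \<kappa> / N, from the parameter shift of about \<kappa> e^2, with slack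
    \<epsilon>; \<open>B\<close> adds the contribution \<kappa>^2 / 2 of
    \<open>ln (cosh (\<kappa> * e))\<close>.\<close>
  define b where "b = - (p * \<kappa> / N) + \<epsilon>"
  define B where "B = b + \<kappa>\<^sup>2 / 2"
  define a where "a e = e * tanh (\<kappa> * e)" for e
  have at: "((\<lambda>e. tanh (\<kappa> * e) / e) \<longlongrightarrow> \<kappa>) (at_right 0)"
  proof -
    have "((\<lambda>e. tanh (\<kappa> * e)) has_real_derivative \<kappa>) (at 0)" by (auto intro!: derivative_eq_intros)
    then have "((\<lambda>e. tanh (\<kappa> * e) / e) \<longlongrightarrow> \<kappa>) (at 0)" by (simp add: has_field_derivative_iff)
    then show ?thesis by (rule filterlim_mono[OF _ order_refl at_le]) auto
  qed
  have e0: "((\<lambda>e::real. e) \<longlongrightarrow> 0) (at_right 0)" by (rule tendsto_ident_at)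
  have th0: "((\<lambda>e. tanh (\<kappa> * e)) \<longlongrightarrow> 0) (at_right 0)"
    using tendsto_tanh[OF tendsto_mult[OF tendsto_const e0], of \<kappa>] by simp
  have glim: "((\<lambda>e. g (y0 + c * e\<^sup>2) * c) \<longlongrightarrow> N * c) (at_right 0)" for c
  proof -
    have "((\<lambda>e. y0 + c * e\<^sup>2) \<longlongrightarrow> y0) (at_right 0)"
      using tendsto_add[OF tendsto_const tendsto_mult[OF tendsto_const tendsto_power[OF e0]], of y0 c 2] by simp
    from isCont_tendsto_compose[OF g(2) this] show ?thesis unfolding g(3) by (intro tendsto_intros)
  qed
  have ev1: "\<forall>\<^sub>F e in at_right 0. 0 < g (y0 + b * e\<^sup>2) * b + (p * (tanh (\<kappa> * e) / e) + P / 2 * (tanh (\<kappa> * e))\<^sup>2)"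
  proof (rule order_tendstoD)
    show "((\<lambda>e. g (y0 + b * e\<^sup>2) * b + (p * (tanh (\<kappa> * e) / e) + P / 2 * (tanh (\<kappa> * e))\<^sup>2)) \<longlongrightarrow> N * b + (p * \<kappa> + P / 2 * 0\<^sup>2)) (at_right 0)"
      by (intro tendsto_intros glim at th0)
    show "0 < N * b + (p * \<kappa> + P / 2 * 0\<^sup>2)" using N \<epsilon> by (simp add: b_def algebra_simps)
  qed
  have ev2: "\<forall>\<^sub>F e in at_right 0. 2 * (g (y0 + B * e\<^sup>2) * B) < P"
  proof (rule order_tendstoD)
    show "((\<lambda>e. 2 * (g (y0 + B * e\<^sup>2) * B)) \<longlongrightarrow> 2 * (N * B)) (at_right 0)" by (intro tendsto_intros glim)
    have "2 * (N * B) = - 2 * p * \<kappa> + N * \<kappa>\<^sup>2 + \<Delta> / 2" using N by (simp add: B_def b_def \<epsilon>_def algebra_simps)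
    also have "\<dots> = P - \<Delta> + \<Delta> / 2" using n by (simp add: \<Delta>_def \<kappa>_def power2_eq_square field_simps)
    also have "\<dots> < P" using P by (simp add: \<Delta>_def)
    finally show "2 * (N * B) < P" .
  qed
  have ev3: "\<forall>\<^sub>F e in at_right 0. e < r" using order_tendstoD(2)[OF e0 r] .
  have ev4: "\<forall>\<^sub>F e::real in at_right 0. 0 < e" by (simp add: eventually_at_right_less)
  obtain e where e: "0 < g (y0 + b * e\<^sup>2) * b + (p * (tanh (\<kappa> * e) / e) + P / 2 * (tanh (\<kappa> * e))\<^sup>2)"
     "2 * (g (y0 + B * e\<^sup>2) * B) < P" "e < r" "0 < e"
    using eventually_happens'[OF trivial_limit_at_right_real eventually_conj[OF ev1 eventually_conj[OF ev2 eventually_conj[OF ev3 ev4]]]] by blast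
  have ae: "\<bar>a e\<bar> < r"
  proof -
    have "\<bar>tanh (\<kappa> * e)\<bar> < 1" using tanh_real_bounds[of "\<kappa> * e"] by (auto simp: abs_if)
    then have "\<bar>a e\<bar> < e * 1" using e(4) unfolding a_def abs_mult by (intro mult_strict_left_mono[THEN le_less_trans[rotated]]) auto
    then show ?thesis using e(3) by simp
  qed
  obtain y where y: "G y = s (u0 - a e)" using surj[of "u0 - a e"] ae by auto
  \<comment> \<open>The case \<eta> = 0, midpoint concavity at \<open>u0\<close>. It converts the
    lower parabola at \<open>u0 + a e\<close> into the upper bound needed for
    \<open>s (u0 - a e)\<close>, and with it for \<open>y\<close>.\<close>
  have half: "s (u0 - c) + s (u0 + c) \<le> 2 * s u0" if "0 < c" "c < r" for c
    using key[of c y0 0] that G(2) by simp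
  have "s (u0 - a e) + s (u0 + a e) \<le> 2 * s u0"
    using half[of "a e"] half[of "- a e"] ae by (cases "a e" "0::real" rule: linorder_cases) auto
  moreover have "s u0 + p * a e + P / 2 * (a e)\<^sup>2 \<le> s (u0 + a e)" using low[of "u0 + a e"] ae by simp
  ultimately have "G y \<le> s u0 - p * a e - P / 2 * (a e)\<^sup>2" using y by linarith
  also have "\<dots> < G (y0 + b * e\<^sup>2)"
  proof -
    have "0 < e\<^sup>2 * (g (y0 + b * e\<^sup>2) * b + (p * (tanh (\<kappa> * e) / e) + P / 2 * (tanh (\<kappa> * e))\<^sup>2))" using e by simp
    also have "\<dots> = (G (y0 + b * e\<^sup>2) - G y0) + (p * a e + P / 2 * (a e)\<^sup>2)"
      using e(4) by (simp add: g(1) a_def power2_eq_square algebra_simps)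
    finally show ?thesis using G(2) by simp
  qed
  finally have "y < y0 + b * e\<^sup>2" using mono by (simp add: strict_mono_less)
  moreover have "ln (cosh (\<kappa> * e)) \<le> \<kappa>\<^sup>2 / 2 * e\<^sup>2" using ln_cosh_le[of "\<kappa> * e"] by (simp add: power_mult_distrib)
  ultimately have "ln (cosh (\<kappa> * e)) + y \<le> y0 + B * e\<^sup>2" by (simp add: B_def algebra_simps)
  then have "G (ln (cosh (\<kappa> * e)) + y) \<le> G (y0 + B * e\<^sup>2)" using mono by (simp add: strict_mono_less_eq)
  also have "\<dots> = s u0 + g (y0 + B * e\<^sup>2) * (B * e\<^sup>2)" using g(1)[of "y0 + B * e\<^sup>2"] G(2) by simp
  finally have "s (u0 - e) + s (u0 + e) \<le> 2 * (s u0 + g (y0 + B * e\<^sup>2) * (B * e\<^sup>2))"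
    using key[OF e(4,3), of y "\<kappa> * e"] y by (simp add: a_def)
  moreover have "2 * s u0 + P * e\<^sup>2 \<le> s (u0 - e) + s (u0 + e)"
    using low[of "u0 - e"] low[of "u0 + e"] e by simp
  ultimately have "P * e\<^sup>2 \<le> (2 * (g (y0 + B * e\<^sup>2) * B)) * e\<^sup>2" by (simp add: algebra_simps)
  then show False using e by simp
qed

section \<open>Minkowski combinations of symmetric bodies\<close>

lemma minkowski_comb_image: "minkowski_comb t K L = (\<lambda>p. t *\<^sub>R fst p + (1 - t) *\<^sub>R snd p) ` (K \<times> L)"
  unfolding minkowski_comb_def by force

text \<open>The pointwise form of aK + bK = (a + b)K for convex K; the degenerate case
  \<open>a + b = 0\<close> occurs at the ends of the path.\<close>

lemma convex_combine:
  fixes K :: "'a::real_vector set"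
  assumes K: "convex K" "k \<in> K" "k' \<in> K" and c: "0 \<le> a" "0 \<le> b"
  shows "\<exists>k''\<in>K. a *\<^sub>R k + b *\<^sub>R k' = (a + b) *\<^sub>R k''"
proof (cases "a + b = 0")
  case True
  then have "a = 0" "b = 0" using c by linarith+
  then show ?thesis using K by auto
next
  case False
  have "(a / (a + b)) *\<^sub>R k + (b / (a + b)) *\<^sub>R k' \<in> K"
    using K c False by (intro convexD[OF K(1)]) (auto simp: add_divide_distrib[symmetric])
  moreover have "a *\<^sub>R k + b *\<^sub>R k' = (a + b) *\<^sub>R ((a / (a + b)) *\<^sub>R k + (b / (a + b)) *\<^sub>R k')"
    using False by (simp add: scaleR_add_right)
  ultimately show ?thesis by blast
qed

lemma symmetric_convex_zero:
  fixes K :: "'a::real_vector set"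
  assumes "convex K" "symmetric_set K" "K \<noteq> {}" shows "0 \<in> K"
proof -
  obtain k where k: "k \<in> K" using assms by blast
  then have "- k \<in> K" using assms(2) unfolding symmetric_set_def by (metis image_eqI)
  then have "(1/2) *\<^sub>R k + (1/2) *\<^sub>R (- k) \<in> K" using k by (intro convexD[OF assms(1)]) auto
  then show ?thesis by simp
qed

lemma tanh_segment:
  fixes e u \<eta> :: real
  assumes u: "0 \<le> u - e" "u + e \<le> 1" and e: "0 < e"
  shows "0 \<le> u - e * tanh \<eta>" "u - e * tanh \<eta> \<le> 1"
proof -
  define w where "w = e * tanh \<eta>"
  have "e * - 1 \<le> w" "w \<le> e * 1"
    unfolding w_def using e tanh_real_bounds[of \<eta>] by (intro mult_left_mono; simp)+
  then show "0 \<le> u - e * tanh \<eta>" "u - e * tanh \<eta> \<le> 1" unfolding w_def[symmetric] using u by linarith+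
qed

context
  fixes K L :: "'a::euclidean_space set"
  assumes K: "compact K" "convex K" "symmetric_set K" "K \<noteq> {}" and L: "compact L" "convex L" "symmetric_set L" "L \<noteq> {}"
begin

lemma minkowski_comb_body:
  assumes t: "0 \<le> t" "t \<le> 1"
  shows "compact (minkowski_comb t K L)" "convex (minkowski_comb t K L)" "symmetric_set (minkowski_comb t K L)" "minkowski_comb t K L \<noteq> {}"
proof -
  show "compact (minkowski_comb t K L)" unfolding minkowski_comb_image
    by (intro compact_continuous_image continuous_intros compact_Times K L)
  show "minkowski_comb t K L \<noteq> {}" unfolding minkowski_comb_image using K L by auto
  have "minkowski_comb t K L = (\<Union>x\<in>(\<lambda>x. t *\<^sub>R x) ` K. \<Union>y\<in>(\<lambda>x. (1 - t) *\<^sub>R x) ` L. {x + y})"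
    unfolding minkowski_comb_def by auto
  then show "convex (minkowski_comb t K L)" using convex_sums[OF convex_scaling[OF K(2), of t] convex_scaling[OF L(2), of "1 - t"]] by simp
  have neg: "- k \<in> K" if "k \<in> K" for k using K(3) that unfolding symmetric_set_def by (metis image_eqI)
  have neg': "- k \<in> L" if "k \<in> L" for k using L(3) that unfolding symmetric_set_def by (metis image_eqI)
  have sub: "- x \<in> minkowski_comb t K L" if x: "x \<in> minkowski_comb t K L" for x
  proof -
    obtain a b where ab: "a \<in> K" "b \<in> L" "x = t *\<^sub>R a + (1 - t) *\<^sub>R b" using x unfolding minkowski_comb_def by blast
    then have "- x = t *\<^sub>R (- a) + (1 - t) *\<^sub>R (- b)" by simp
    then show ?thesis using neg[OF ab(1)] neg'[OF ab(2)] unfolding minkowski_comb_def by blast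
  qed
  show "symmetric_set (minkowski_comb t K L)" unfolding symmetric_set_def
  proof (intro equalityI subsetI)
    fix x assume "x \<in> minkowski_comb t K L"
    from sub[OF this] show "x \<in> uminus ` minkowski_comb t K L" by (intro image_eqI[of _ _ "- x"]) auto
  next
    fix x assume "x \<in> uminus ` minkowski_comb t K L"
    then obtain y where "x = - y" "y \<in> minkowski_comb t K L" by blast
    then show "x \<in> minkowski_comb t K L" using sub by blast
  qed
qed

lemma minkowski_comb_borel: "0 \<le> t \<Longrightarrow> t \<le> 1 \<Longrightarrow> minkowski_comb t K L \<in> sets borel"
  by (rule borel_closed[OF compact_imp_closed[OF minkowski_comb_body(1)]])

text \<open>The mean \<open>(exp \<eta> * U + exp (- \<eta>) * V) / 2\<close> of the bodies at \<open>u - e\<close> and \<open>u + e\<close> is the body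
  at \<open>u - e * tanh \<eta>\<close>, dilated by \<open>cosh \<eta>\<close>.\<close>
lemma gset_minkowski_path:
  assumes u: "0 \<le> u - e" "u + e \<le> 1" and e: "0 < e"
  shows "gset (minkowski_comb (u - e) K L) * gset (minkowski_comb (u + e) K L)
    \<le> (gset ((\<lambda>x. cosh \<eta> *\<^sub>R x) ` minkowski_comb (u - e * tanh \<eta>) K L))\<^sup>2"
proof -
  have r1: "0 \<le> u - e" "u - e \<le> 1" "0 \<le> u + e" "u + e \<le> 1" using u e by auto
  note r2 = tanh_segment[OF u e, of \<eta>]
  note b1 = minkowski_comb_body[OF r1(1,2)] and b2 = minkowski_comb_body[OF r1(3,4)] and b3 = minkowski_comb_body[OF r2]
  show ?thesis
  proof (rule gset_dilated_mean[OF b1 b2, of "exp \<eta>"])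
    show "closed ((\<lambda>x. cosh \<eta> *\<^sub>R x) ` minkowski_comb (u - e * tanh \<eta>) K L)"
      using b3(1) by (intro compact_imp_closed compact_scaling)
    fix x y assume "x \<in> minkowski_comb (u - e) K L" "y \<in> minkowski_comb (u + e) K L"
    then obtain k l k' l' where kl: "k \<in> K" "l \<in> L" "k' \<in> K" "l' \<in> L"
      "x = (u - e) *\<^sub>R k + (1 - (u - e)) *\<^sub>R l" "y = (u + e) *\<^sub>R k' + (1 - (u + e)) *\<^sub>R l'"
      unfolding minkowski_comb_def by blast
    let ?E = "exp \<eta> / 2" and ?F = "exp (- \<eta>) / 2"
    obtain k2 where k2: "k2 \<in> K" "(?E * (u - e)) *\<^sub>R k + (?F * (u + e)) *\<^sub>R k' = (?E * (u - e) + ?F * (u + e)) *\<^sub>R k2"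
      using convex_combine[OF K(2) kl(1,3), of "?E * (u - e)" "?F * (u + e)"] r1 by auto
    obtain l2 where l2: "l2 \<in> L" "(?E * (1 - (u - e))) *\<^sub>R l + (?F * (1 - (u + e))) *\<^sub>R l' = (?E * (1 - (u - e)) + ?F * (1 - (u + e))) *\<^sub>R l2"
      using convex_combine[OF L(2) kl(2,4), of "?E * (1 - (u - e))" "?F * (1 - (u + e))"] r1 by auto
    have alg: "(E + F) * u - e * (E - F) = E * (u - e) + F * (u + e)"
      "(E + F) - (E + F) * u + e * (E - F) = E * (1 - (u - e)) + F * (1 - (u + e))" for E F :: real
      by (simp_all add: algebra_simps)
    have ch: "cosh \<eta> = ?E + ?F" by (simp add: cosh_def)
    have "cosh \<eta> * tanh \<eta> = sinh \<eta>" by (simp add: tanh_def)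
    then have sh: "cosh \<eta> * tanh \<eta> = ?E - ?F" by (simp add: sinh_def diff_divide_distrib)
    have c1: "?E * (u - e) + ?F * (u + e) = cosh \<eta> * (u - e * tanh \<eta>)"
    proof -
      have "cosh \<eta> * (u - e * tanh \<eta>) = cosh \<eta> * u - e * (cosh \<eta> * tanh \<eta>)" by (simp add: algebra_simps)
      also have "\<dots> = (?E + ?F) * u - e * (?E - ?F)" unfolding sh unfolding ch ..
      also have "\<dots> = ?E * (u - e) + ?F * (u + e)" by (rule alg(1))
      finally show ?thesis ..
    qed
    have c2: "?E * (1 - (u - e)) + ?F * (1 - (u + e)) = cosh \<eta> * (1 - (u - e * tanh \<eta>))"
    proof -
      have "cosh \<eta> * (1 - (u - e * tanh \<eta>)) = cosh \<eta> - cosh \<eta> * u + e * (cosh \<eta> * tanh \<eta>)" by (simp add: algebra_simps)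
      also have "\<dots> = (?E + ?F) - (?E + ?F) * u + e * (?E - ?F)" unfolding sh unfolding ch ..
      also have "\<dots> = ?E * (1 - (u - e)) + ?F * (1 - (u + e))" by (rule alg(2))
      finally show ?thesis ..
    qed
    have "(1/2) *\<^sub>R (exp \<eta> *\<^sub>R x + (1 / exp \<eta>) *\<^sub>R y)
      = ((?E * (u - e)) *\<^sub>R k + (?F * (u + e)) *\<^sub>R k') + ((?E * (1 - (u - e))) *\<^sub>R l + (?F * (1 - (u + e))) *\<^sub>R l')"
      unfolding kl exp_minus by (simp add: scaleR_add_right inverse_eq_divide mult.commute)
    also have "\<dots> = cosh \<eta> *\<^sub>R ((u - e * tanh \<eta>) *\<^sub>R k2 + (1 - (u - e * tanh \<eta>)) *\<^sub>R l2)"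
      unfolding k2(2) l2(2) c1 c2 by (simp add: scaleR_add_right)
    finally show "(1/2) *\<^sub>R (exp \<eta> *\<^sub>R x + (1 / exp \<eta>) *\<^sub>R y) \<in> (\<lambda>x. cosh \<eta> *\<^sub>R x) ` minkowski_comb (u - e * tanh \<eta>) K L"
      using k2(1) l2(1) unfolding minkowski_comb_def by blast
  qed simp
qed

lemma gamma_n_minkowski_path:
  assumes u: "0 \<le> u - e" "u + e \<le> 1" and e: "0 < e" and R: "0 < R"
    and le: "gamma_n (minkowski_comb (u - e * tanh \<eta>) K L) \<le> Psi TYPE('a) R"
  shows "gamma_n (minkowski_comb (u - e) K L) * gamma_n (minkowski_comb (u + e) K L) \<le> (Psi TYPE('a) (cosh \<eta> * R))\<^sup>2"
proof -
  let ?c = "(2 * pi) powr (- real DIM('a) / 2)"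
  have c: "0 < ?c" by simp
  have r1: "0 \<le> u - e" "u - e \<le> 1" "0 \<le> u + e" "u + e \<le> 1" using u e by auto
  note r2 = tanh_segment[OF u e, of \<eta>]
  let ?S = "minkowski_comb (u - e * tanh \<eta>) K L" and ?S' = "(\<lambda>x. cosh \<eta> *\<^sub>R x) ` minkowski_comb (u - e * tanh \<eta>) K L"
  have S': "?S' \<in> sets borel"
    using minkowski_comb_body(1)[OF r2] by (intro borel_closed compact_imp_closed compact_scaling)
  have "gset ?S' \<le> gset (cball (0::'a) (cosh \<eta> * R))"
  proof (rule gset_dilate_le_ball[OF minkowski_comb_borel[OF r2] S'])
    show "cosh \<eta> *\<^sub>R x \<in> ?S' \<longleftrightarrow> x \<in> ?S" for x by auto
    show "gset ?S \<le> gset (cball (0::'a) R)"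
      using le c unfolding Psi_eq_gset gamma_n_eq_gset[OF minkowski_comb_borel[OF r2]] by simp
  qed (use cosh_real_ge_1[of \<eta>] R in auto)
  then have "(gset ?S')\<^sup>2 \<le> (gset (cball (0::'a) (cosh \<eta> * R)))\<^sup>2" by (intro power_mono gset_nonneg)
  with gset_minkowski_path[OF u e, of \<eta>]
  have "gset (minkowski_comb (u - e) K L) * gset (minkowski_comb (u + e) K L) \<le> (gset (cball (0::'a) (cosh \<eta> * R)))\<^sup>2" by linarith
  then have "?c\<^sup>2 * (gset (minkowski_comb (u - e) K L) * gset (minkowski_comb (u + e) K L)) \<le> ?c\<^sup>2 * (gset (cball (0::'a) (cosh \<eta> * R)))\<^sup>2"
    by (intro mult_left_mono) auto
  then show ?thesis
    unfolding Psi_eq_gset gamma_n_eq_gset[OF minkowski_comb_borel[OF r1(1,2)]] gamma_n_eq_gset[OF minkowski_comb_borel[OF r1(3,4)]]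
    by (simp add: power2_eq_square mult_ac)
qed

text \<open>Both bodies contain 0, so lowering a coefficient shrinks the corresponding summand; the
  body at \<open>v\<close> thus lies in the \<open>c\<close>-fold dilate of the body at
  \<open>u\<close>. This controls positivity, continuity and the end behaviour of the measure along
  the path.\<close>

lemma gamma_n_minkowski_comparison:
  assumes u: "0 \<le> u" "u \<le> 1" and v: "0 \<le> v" "v \<le> 1" and c: "1 \<le> c" "v \<le> c * u" "1 - v \<le> c * (1 - u)"
  shows "gamma_n (minkowski_comb v K L) \<le> c ^ DIM('a) * gamma_n (minkowski_comb u K L)"
proof -
  let ?S = "minkowski_comb u K L" and ?S' = "(\<lambda>x. c *\<^sub>R x) ` minkowski_comb u K L"
  have S': "?S' \<in> sets borel"
    using minkowski_comb_body(1)[OF u] by (intro borel_closed compact_imp_closed compact_scaling)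
  have "minkowski_comb v K L \<subseteq> ?S'"
  proof
    fix x assume "x \<in> minkowski_comb v K L"
    then obtain k l where kl: "k \<in> K" "l \<in> L" "x = v *\<^sub>R k + (1 - v) *\<^sub>R l" unfolding minkowski_comb_def by blast
    obtain k2 where k2: "k2 \<in> K" "v *\<^sub>R k + (c * u - v) *\<^sub>R 0 = (v + (c * u - v)) *\<^sub>R k2"
      using convex_combine[OF K(2) kl(1) symmetric_convex_zero[OF K(2-4)], of v "c * u - v"] v c by auto
    obtain l2 where l2: "l2 \<in> L" "(1 - v) *\<^sub>R l + (c * (1 - u) - (1 - v)) *\<^sub>R 0 = ((1 - v) + (c * (1 - u) - (1 - v))) *\<^sub>R l2"
      using convex_combine[OF L(2) kl(2) symmetric_convex_zero[OF L(2-4)], of "1 - v" "c * (1 - u) - (1 - v)"] v c by auto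
    have "x = c *\<^sub>R (u *\<^sub>R k2 + (1 - u) *\<^sub>R l2)" using k2(2) l2(2) kl(3) by (simp add: scaleR_add_right)
    then show "x \<in> ?S'" using k2(1) l2(1) unfolding minkowski_comb_def by blast
  qed
  then have "gset (minkowski_comb v K L) \<le> gset ?S'" by (intro gset_mono minkowski_comb_borel[OF v] S')
  also have "\<dots> \<le> c ^ DIM('a) * gset ?S"
    by (rule gset_dilate_le[OF minkowski_comb_borel[OF u] S']) (use c in auto)
  finally show ?thesis unfolding gamma_n_eq_gset[OF minkowski_comb_borel[OF u]] gamma_n_eq_gset[OF minkowski_comb_borel[OF v]]
    by (simp add: mult.left_commute mult_left_mono)
qed

end

lemma minkowski_comb_0: "K \<noteq> {} \<Longrightarrow> minkowski_comb 0 K L = L"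
  unfolding minkowski_comb_def by auto

lemma minkowski_comb_1: "L \<noteq> {} \<Longrightarrow> minkowski_comb 1 K L = K"
  unfolding minkowski_comb_def by auto

section \<open>Concavity\<close>

lemma minkowski_comb_swap: "minkowski_comb t K L = minkowski_comb (1 - t) L K"
  unfolding minkowski_comb_def by (auto simp: add.commute) 

lemma symmetric_setD: "symmetric_set K \<Longrightarrow> x \<in> K \<Longrightarrow> - x \<in> K"
  unfolding symmetric_set_def by (metis image_eqI)

lemma symmetric_setI: "(\<And>x. x \<in> K \<Longrightarrow> - x \<in> K) \<Longrightarrow> symmetric_set K"
  unfolding symmetric_set_def by (auto intro: image_eqI[of _ _ "- x" for x])

text \<open>The complement of the closure is open and null, hence empty, and a dense convex set is
  the whole space. This settles measure 1, where \<sigma> need not be continuous.\<close>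

lemma gamma_n_eq_1_imp_UNIV:
  fixes K :: "'a::euclidean_space set"
  assumes K: "convex K" "gamma_n K = 1" shows "K = UNIV"
proof -
  have "closure K = UNIV"
  proof (rule ccontr)
    assume ne: "closure K \<noteq> UNIV"
    let ?A = "- closure K"
    have A: "open ?A" "?A \<noteq> {}" "?A \<in> sets borel" using ne by auto
    have "gset (UNIV :: 'a set) = (\<integral>x. indicator (closure K) x * exp (- (norm x)\<^sup>2 / 2) + indicator ?A x * exp (- (norm x)\<^sup>2 / 2) \<partial>lborel)"
      unfolding gset_def by (rule Bochner_Integration.integral_cong) (auto simp: indicator_def)
    also have "\<dots> = gset (closure K) + gset ?A"
      unfolding gset_def by (rule Bochner_Integration.integral_add; rule gset_integrable; simp)
    finally have "gset (UNIV :: 'a set) = gset (closure K) + gset ?A" .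
    then have "gamma_n (UNIV :: 'a set) = gamma_n (closure K) + gamma_n ?A"
      by (subst (1 2 3) gamma_n_eq_gset) (auto simp: distrib_left)
    then have "gamma_n ?A = 0" using convex_gamma_n(2)[OF K(1)] K(2) by (simp add: gamma_n_UNIV)
    then have "gset ?A = 0" by (subst (asm) gamma_n_eq_gset) auto
    then have "AE x in lborel. indicator ?A x * exp (- (norm x)\<^sup>2 / 2) = (0::real)"
      unfolding gset_def by (subst (asm) integral_nonneg_eq_0_iff_AE[OF gset_integrable]) auto
    then have "AE x in lborel. x \<notin> ?A" by (rule AE_mp) (auto simp: indicator_def)
    then have "AE x in lebesgue. x \<in> closure K" by (simp add: AE_completion)
    then have "x \<in> closure K" for x by (rule mem_closed_if_AE_lebesgue[OF closed_closure])
    then show False using ne by blast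
  qed
  then have "interior K = UNIV" using convex_interior_closure[OF K(1)] by simp
  then show ?thesis using interior_subset by blast
qed

lemma gamma_n_compact_less_1:
  fixes K :: "'a::euclidean_space set"
  assumes "compact K" shows "gamma_n K < 1"
proof -
  obtain R where R: "0 < R" "\<forall>x\<in>K. norm x \<le> R" using compact_imp_bounded[OF assms] unfolding bounded_pos by blast
  then have "K \<subseteq> cball 0 R" by auto
  then show ?thesis using R(1) gamma_n_mono[of K "cball 0 R"] Psi_less_one[of R, where ?'a = 'a] by (simp add: Psi_def)
qed

context
  fixes \<sigma> \<sigma>' \<sigma>'' :: "real \<Rightarrow> real" and T :: "'a::euclidean_space itself"
  assumes mono: "strict_mono_on {0..1} \<sigma>"
    and d1: "\<And>x. x \<in> {0<..<1} \<Longrightarrow> (\<sigma> has_real_derivative \<sigma>' x) (at x)"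
    and d2: "\<And>x. x \<in> {0<..<1} \<Longrightarrow> (\<sigma>' has_real_derivative \<sigma>'' x) (at x)"
    and pos: "\<And>x. x \<in> {0<..<1} \<Longrightarrow> \<sigma>' x > 0"
    and ode: "\<And>r. r > 0 \<Longrightarrow>
       1 + \<sigma>'' (Psi TYPE('a) r) * Psi TYPE('a) r / \<sigma>' (Psi TYPE('a) r)
         = 2 / real DIM('a)
           - c_const DIM('a) / ((real DIM('a))\<^sup>2 * Psi TYPE('a) r) * r ^ DIM('a) * exp (- r\<^sup>2 / 2)"
begin

lemma sigma_mono: "0 \<le> x \<Longrightarrow> x \<le> y \<Longrightarrow> y \<le> 1 \<Longrightarrow> \<sigma> x \<le> \<sigma> y"
  using strict_mono_on_leD[OF mono] by simp

lemma sigma_tendsto: "0 < x \<Longrightarrow> x < 1 \<Longrightarrow> (f \<longlongrightarrow> x) F \<Longrightarrow> ((\<lambda>k. \<sigma> (f k)) \<longlongrightarrow> \<sigma> x) F"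
  by (rule isCont_tendsto_compose[OF DERIV_isCont[OF d1]]) simp

text \<open>If the chord inequality failed, the gap to the chord with a small concave term added
  would have an interior minimum. There a parabola with strictly positive extra curvature touches
  from below, and its pullback to ln \<gamma> contradicts the second-order estimate.\<close>

lemma sigma_concave_compact_pos:
  fixes K L :: "'a set"
  assumes K: "compact K" "convex K" "symmetric_set K" "K \<noteq> {}" and L: "compact L" "convex L" "symmetric_set L" "L \<noteq> {}"
    and posK: "0 < gamma_n K" and posL: "0 < gamma_n L" and t: "0 < t" "t < 1"
  shows "t * \<sigma> (gamma_n K) + (1 - t) * \<sigma> (gamma_n L) \<le> \<sigma> (gamma_n (minkowski_comb t K L))"
proof (rule ccontr)
  let ?n = "DIM('a)"
  define g where "g u = gamma_n (minkowski_comb u K L)" for u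
  define s where "s u = ln (g u)" for u
  note path = gamma_n_minkowski_path[OF K L, folded g_def] and comparison = gamma_n_minkowski_comparison[OF K L, folded g_def]
  have g0: "g 0 = gamma_n L" and g1: "g 1 = gamma_n K" by (simp_all add: g_def minkowski_comb_0[OF K(4)] minkowski_comb_1[OF L(4)])
  have gpos: "0 < g u" if "0 \<le> u" "u \<le> 1" for u
  proof (cases "u = 0")
    case False
    have "g 1 \<le> (1 / u) ^ ?n * g u" using comparison[of u 1 "1 / u"] that False by simp
    then have "0 < (1 / u) ^ ?n * g u" using posK g1 by simp
    then show ?thesis using that by (simp add: zero_less_mult_iff)
  qed (use g0 posL in simp)
  have gless: "g u < 1" if "0 \<le> u" "u \<le> 1" for u
    unfolding g_def by (rule gamma_n_compact_less_1[OF minkowski_comb_body(1)[OF K L that]])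
  have gcont: "isCont g u" if u: "0 < u" "u < 1" for u
  proof -
    \<comment> \<open>The factors needed to compare \<open>v\<close> with \<open>u\<close> and
      \<open>u\<close> with \<open>v\<close>; both tend to 1 as \<open>v\<close> tends to
      \<open>u\<close>, which squeezes \<open>g v\<close>.\<close>
    define c where "c v = max 1 (max (v / u) ((1 - v) / (1 - u)))" for v
    define c' where "c' v = max 1 (max (u / v) ((1 - u) / (1 - v)))" for v
    have "eventually (\<lambda>v. v \<in> {0<..<1}) (at u)" using u by (intro eventually_at_in_open') auto
    then have ev: "eventually (\<lambda>v. g u / c' v ^ ?n \<le> g v \<and> g v \<le> c v ^ ?n * g u) (at u)"
    proof eventually_elim
      case (elim v)
      have "v / u \<le> c v" "(1 - v) / (1 - u) \<le> c v" "u / v \<le> c' v" "(1 - u) / (1 - v) \<le> c' v" "1 \<le> c v" "1 \<le> c' v"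
        by (auto simp: c_def c'_def)
      then have "g v \<le> c v ^ ?n * g u" "g u \<le> c' v ^ ?n * g v"
        using elim u by (auto intro!: comparison simp: pos_divide_le_eq)
      then show ?case using \<open>1 \<le> c' v\<close> by (simp add: pos_divide_le_eq mult.commute)
    qed
    have cl: "(c \<longlongrightarrow> max 1 (max (u / u) ((1 - u) / (1 - u)))) (at u)" "(c' \<longlongrightarrow> max 1 (max (u / u) ((1 - u) / (1 - u)))) (at u)"
      unfolding c_def c'_def using u by (intro tendsto_intros; simp)+
    have "(g \<longlongrightarrow> g u) (at u)"
    proof (rule tendsto_sandwich)
      show "((\<lambda>v. g u / c' v ^ ?n) \<longlongrightarrow> g u) (at u)"
        using tendsto_divide[OF tendsto_const[of "g u"] tendsto_power[OF cl(2), of ?n]] u by simp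
      show "((\<lambda>v. c v ^ ?n * g u) \<longlongrightarrow> g u) (at u)"
        using tendsto_mult[OF tendsto_power[OF cl(1), of ?n] tendsto_const[of "g u"]] u by simp
    qed (use ev in \<open>auto elim: eventually_mono\<close>)
    then show ?thesis by (simp add: isCont_def)
  qed
  assume "\<not> ?thesis"
  then have contra: "\<sigma> (g t) < t * \<sigma> (g 1) + (1 - t) * \<sigma> (g 0)" by (simp add: g_def[symmetric] g0 g1)
  define ch where "ch u = u * \<sigma> (g 1) + (1 - u) * \<sigma> (g 0)" for u
  define \<delta> where "\<delta> = ch t - \<sigma> (g t)"
  \<comment> \<open>The term with \<delta> provides the strict curvature. Its size is harmless:
    \<open>u * (1 - u) \<le> 1 / 4\<close> keeps \<open>D t\<close> negative, while \<open>D\<close>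
    vanishes at 0 and 1.\<close>
  define D where "D u = \<sigma> (g u) - ch u + \<delta> * (u * (1 - u))" for u
  have \<delta>: "0 < \<delta>" using contra by (simp add: \<delta>_def ch_def)
  have quarter: "u * (1 - u) \<le> 1 / 4" for u :: real
    using zero_le_power2[of "u - 1 / 2"] by (simp add: power2_eq_square algebra_simps)
  have "\<delta> * (t * (1 - t)) \<le> \<delta> * (1 / 4)" using \<delta> by (intro mult_left_mono quarter) simp
  then have Dt: "D t < 0" using \<delta> \<delta>_def unfolding D_def by linarith
  \<comment> \<open>Near 0 the bound \<open>(1 - u) ^ ?n * g 0 \<le> g u\<close> prevents a drop of
    \<open>D\<close> below its end value; the other end is treated in the same way.\<close>
  obtain a where a: "0 < a" "a < t" "D t < D a"
  proof -
    have "((\<lambda>u. (1 - u) ^ ?n * g 0) \<longlongrightarrow> (1 - 0) ^ ?n * g 0) (at_right 0)" by (intro tendsto_intros)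
    then have "((\<lambda>u. \<sigma> ((1 - u) ^ ?n * g 0)) \<longlongrightarrow> \<sigma> (g 0)) (at_right 0)"
      using gpos[of 0] gless[of 0] by (intro sigma_tendsto) auto
    then have "((\<lambda>u. \<sigma> ((1 - u) ^ ?n * g 0) - ch u) \<longlongrightarrow> \<sigma> (g 0) - ch 0) (at_right 0)"
      unfolding ch_def by (intro tendsto_intros)
    then have "\<forall>\<^sub>F u in at_right 0. D t < \<sigma> ((1 - u) ^ ?n * g 0) - ch u"
      by (rule order_tendstoD) (use Dt in \<open>simp add: ch_def\<close>)
    moreover have "\<forall>\<^sub>F u in at_right 0. u \<in> {0<..<t}" by (rule eventually_at_right_real) (use t in simp)
    ultimately have "\<forall>\<^sub>F u in at_right 0. D t < \<sigma> ((1 - u) ^ ?n * g 0) - ch u \<and> u \<in> {0<..<t}" by (rule eventually_conj)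
    from eventually_happens'[OF trivial_limit_at_right_real this]
    obtain u where u: "D t < \<sigma> ((1 - u) ^ ?n * g 0) - ch u" "0 < u" "u < t" by auto
    have "g 0 \<le> (1 / (1 - u)) ^ ?n * g u" using comparison[of u 0 "1 / (1 - u)"] u t by simp
    then have "(1 - u) ^ ?n * g 0 \<le> g u" using u t by (simp add: power_divide pos_le_divide_eq mult.commute)
    then have "\<sigma> ((1 - u) ^ ?n * g 0) \<le> \<sigma> (g u)" using gpos[of 0] gless[of u] u t by (intro sigma_mono) auto
    moreover have "0 \<le> \<delta> * (u * (1 - u))" using \<delta> u t by simp
    ultimately have "D t < D u" using u(1) unfolding D_def by linarith
    then show ?thesis using that u by blast
  qed
  obtain b where b: "t < b" "b < 1" "D t < D b"
  proof -
    have "((\<lambda>u. (1 - u) ^ ?n * g 1) \<longlongrightarrow> (1 - 0) ^ ?n * g 1) (at_right 0)" by (intro tendsto_intros)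
    then have "((\<lambda>u. \<sigma> ((1 - u) ^ ?n * g 1)) \<longlongrightarrow> \<sigma> (g 1)) (at_right 0)"
      using gpos[of 1] gless[of 1] by (intro sigma_tendsto) auto
    then have "((\<lambda>u. \<sigma> ((1 - u) ^ ?n * g 1) - ch (1 - u)) \<longlongrightarrow> \<sigma> (g 1) - ch (1 - 0)) (at_right 0)"
      unfolding ch_def by (intro tendsto_intros)
    then have "\<forall>\<^sub>F u in at_right 0. D t < \<sigma> ((1 - u) ^ ?n * g 1) - ch (1 - u)"
      by (rule order_tendstoD) (use Dt in \<open>simp add: ch_def\<close>)
    moreover have "\<forall>\<^sub>F u in at_right 0. u \<in> {0<..<1 - t}" by (rule eventually_at_right_real) (use t in simp)
    ultimately have "\<forall>\<^sub>F u in at_right 0. D t < \<sigma> ((1 - u) ^ ?n * g 1) - ch (1 - u) \<and> u \<in> {0<..<1 - t}" by (rule eventually_conj)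
    from eventually_happens'[OF trivial_limit_at_right_real this]
    obtain u where u: "D t < \<sigma> ((1 - u) ^ ?n * g 1) - ch (1 - u)" "0 < u" "u < 1 - t" by auto
    have "g 1 \<le> (1 / (1 - u)) ^ ?n * g (1 - u)" using comparison[of "1 - u" 1 "1 / (1 - u)"] u t by simp
    then have "(1 - u) ^ ?n * g 1 \<le> g (1 - u)" using u t by (simp add: power_divide pos_le_divide_eq mult.commute)
    then have "\<sigma> ((1 - u) ^ ?n * g 1) \<le> \<sigma> (g (1 - u))" using gpos[of 1] gless[of "1 - u"] u t by (intro sigma_mono) auto
    moreover have "0 \<le> \<delta> * ((1 - u) * (1 - (1 - u)))" using \<delta> u t by simp
    ultimately have "D t < D (1 - u)" using u(1) unfolding D_def by linarith
    then show ?thesis using that[of "1 - u"] u by simp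
  qed
  have "continuous_on {a..b} D"
  proof (intro continuous_at_imp_continuous_on ballI)
    fix u assume "u \<in> {a..b}"
    then have u: "0 < u" "u < 1" using a b by auto
    have "isCont (\<lambda>u. \<sigma> (g u)) u"
      using sigma_tendsto[of "g u" g "at u"] gcont[OF u] gpos[of u] gless[of u] u by (simp add: isCont_def)
    then show "isCont D u" unfolding D_def ch_def by (intro continuous_intros)
  qed
  then obtain u0 where u0: "u0 \<in> {a..b}" "\<And>u. u \<in> {a..b} \<Longrightarrow> D u0 \<le> D u"
    using continuous_attains_inf[of "{a..b}" D] a b by auto
  have "D u0 \<le> D t" using u0(2)[of t] a b by simp
  then have "u0 \<noteq> a" "u0 \<noteq> b" using a b by auto
  then have ab: "a < u0" "u0 < b" using u0(1) by auto
  then have u01: "0 < u0" "u0 < 1" using a b by auto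
  \<comment> \<open>The slope of the chord minus the derivative of the concave correction at
    \<open>u0\<close>, so that minimality of \<open>D\<close> becomes contact with a parabola of
    leading coefficient \<delta>.\<close>
  define \<beta> where "\<beta> = \<sigma> (g 1) - \<sigma> (g 0) - \<delta> * (1 - 2 * u0)"
  define r where "r = min (u0 - a) (b - u0)"
  have r: "0 < r" using ab by (simp add: r_def)
  have in_ab: "u \<in> {a..b}" if "\<bar>u - u0\<bar> < r" for u using that by (auto simp: r_def abs_if split: if_splits)
  have touch: "\<sigma> (g u0) + \<beta> * (u - u0) + \<delta> * (u - u0)\<^sup>2 \<le> \<sigma> (g u)" if "\<bar>u - u0\<bar> < r" for u
  proof -
    have "D u - D u0 = \<sigma> (g u) - (\<sigma> (g u0) + \<beta> * (u - u0) + \<delta> * (u - u0)\<^sup>2)"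
      by (simp add: D_def ch_def \<beta>_def power2_eq_square algebra_simps)
    then show ?thesis using u0(2)[OF in_ab[OF that]] by linarith
  qed
  define \<tau> where "\<tau> x = \<sigma> (exp x)" for x
  define \<tau>' where "\<tau>' x = \<sigma>' (exp x) * exp x" for x
  have es: "exp (s u) = g u" if "0 \<le> u" "u \<le> 1" for u using gpos[OF that] by (simp add: s_def)
  have sneg: "s u < 0" if "0 \<le> u" "u \<le> 1" for u using gpos[OF that] gless[OF that] by (simp add: s_def)
  have gu0: "g u0 \<in> {0<..<1}" using gpos[of u0] gless[of u0] u01 by simp
  let ?\<tau>2 = "\<sigma>'' (g u0) * g u0 * g u0 + \<sigma>' (g u0) * g u0"
  obtain p P r' where low: "0 < r'" "0 < P + ?\<tau>2 / \<tau>' (s u0) * p\<^sup>2"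
    "\<And>u. \<bar>u - u0\<bar> < r' \<Longrightarrow> s u0 + p * (u - u0) + P / 2 * (u - u0)\<^sup>2 \<le> s u"
  proof (rule lower_parabola_pullback[of \<tau> \<tau>' s u0 ?\<tau>2 r \<delta> \<beta>])
    show "(\<tau> has_real_derivative \<tau>' x) (at x)" if "x < 0" for x
      unfolding \<tau>_def \<tau>'_def by (rule DERIV_chain2[OF d1 DERIV_exp]) (use that in auto)
    show "\<tau> x < \<tau> y" if "x < y" "y < 0" for x y
      unfolding \<tau>_def by (rule strict_mono_onD[OF mono]) (use that in auto)
    show "s u0 < 0" using sneg u01 by simp
    have "((\<lambda>x. \<sigma>' (exp x)) has_real_derivative \<sigma>'' (g u0) * g u0) (at (s u0))"
      using DERIV_chain2[OF d2 DERIV_exp, of "s u0"] gu0 es[of u0] u01 by simp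
    from DERIV_mult[OF this DERIV_exp] show "(\<tau>' has_real_derivative ?\<tau>2) (at (s u0))"
      unfolding \<tau>'_def using es[of u0] u01 by (simp add: mult_ac add.commute)
    show "0 < \<tau>' (s u0)" unfolding \<tau>'_def using es[of u0] u01 pos[OF gu0] gu0 by simp
    show "s u < 0" if "\<bar>u - u0\<bar> < r" for u using in_ab[OF that] a b by (intro sneg) auto
    show "\<tau> (s u0) + \<beta> * (u - u0) + \<delta> * (u - u0)\<^sup>2 \<le> \<tau> (s u)" if "\<bar>u - u0\<bar> < r" for u
      using touch[OF that] in_ab[OF that] a b u01 by (simp add: \<tau>_def es)
  qed (use r \<delta> in auto)
  define G where "G y = ln (Psi TYPE('a) (exp y))" for y
  obtain R where R: "0 < R" "Psi TYPE('a) R = g u0" using Psi_surj[of "g u0", where ?'a = 'a] gu0 by auto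
  define N where "N = c_const ?n * R ^ ?n * exp (- R\<^sup>2 / 2) / g u0"
  have N: "0 < N" unfolding N_def using R gu0 c_const_pos[of ?n] by auto
  \<comment> \<open>The hypothesis on \<sigma> in logarithmic coordinates: \<open>N\<close> is R
    \<Psi>'(R) / \<Psi>(R), the derivative of \<open>G\<close> at \<open>ln R\<close>.\<close>
  have q: "?\<tau>2 / \<tau>' (s u0) = 2 / real ?n - N / (real ?n)\<^sup>2"
  proof -
    have "?\<tau>2 / \<tau>' (s u0) = 1 + \<sigma>'' (g u0) * g u0 / \<sigma>' (g u0)"
      unfolding \<tau>'_def using es[of u0] u01 pos[OF gu0] gu0 by (simp add: field_simps)
    also have "\<dots> = 2 / real ?n - N / (real ?n)\<^sup>2"
      using ode[OF R(1)] unfolding R(2) N_def by simp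
    finally show ?thesis .
  qed
  show False
  proof (rule parabola_contradiction[of G N "ln R" s u0 "min r' (min u0 (1 - u0))" p P "real ?n"])
    have "((\<lambda>y. Psi TYPE('a) (exp y)) has_real_derivative (c_const ?n * R ^ (?n - 1) * exp (- R\<^sup>2 / 2)) * R) (at (ln R))"
      using DERIV_chain2[OF Psi_has_derivative[of "exp (ln R)"] DERIV_exp] R by simp
    then have "(G has_real_derivative (1 / g u0) * ((c_const ?n * R ^ (?n - 1) * exp (- R\<^sup>2 / 2)) * R)) (at (ln R))"
      unfolding G_def using R gu0 by (auto intro!: derivative_eq_intros simp: field_simps)
    moreover have "(1 / g u0) * ((c_const ?n * R ^ (?n - 1) * exp (- R\<^sup>2 / 2)) * R) = N"
    proof -
      have "R ^ (?n - 1) * R = R ^ ?n" by (rule power_minus_mult[OF DIM_positive])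
      then show ?thesis by (simp add: N_def mult_ac)
    qed
    ultimately show "(G has_real_derivative N) (at (ln R))" by simp
    show "G (ln R) = s u0" using R by (simp add: G_def s_def)
    show "strict_mono G" unfolding G_def
      by (rule strict_monoI) (use Psi_pos[where ?'a = 'a] in \<open>auto intro!: Psi_strict_mono\<close>)
    show "0 < min r' (min u0 (1 - u0))" using low(1) u01 by simp
    show "\<exists>y. G y = s u" if u: "\<bar>u - u0\<bar> < min r' (min u0 (1 - u0))" for u
    proof -
      have u': "0 \<le> u" "u \<le> 1" using u by (auto simp: abs_if split: if_splits)
      obtain \<rho> where "0 < \<rho>" "Psi TYPE('a) \<rho> = g u" using Psi_surj[of "g u", where ?'a = 'a] gpos[OF u'] gless[OF u'] by auto
      then show ?thesis by (intro exI[of _ "ln \<rho>"]) (simp add: G_def s_def)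
    qed
    show "s (u0 - e) + s (u0 + e) \<le> 2 * G (ln (cosh \<eta>) + y)"
      if e: "0 < e" "e < min r' (min u0 (1 - u0))" and y: "G y = s (u0 - e * tanh \<eta>)" for e \<eta> y
    proof -
      have rng: "0 \<le> u0 - e" "u0 - e \<le> 1" "0 \<le> u0 + e" "u0 + e \<le> 1" using e by auto
      note rng = this tanh_segment[OF rng(1,4) e(1), of \<eta>]
      have "ln (Psi TYPE('a) (exp y)) = ln (g (u0 - e * tanh \<eta>))" using y by (simp add: G_def s_def)
      then have "g (u0 - e * tanh \<eta>) = Psi TYPE('a) (exp y)"
        using gpos[OF rng(5,6)] Psi_pos[of "exp y", where ?'a = 'a] by simp
      then have "g (u0 - e) * g (u0 + e) \<le> (Psi TYPE('a) (cosh \<eta> * exp y))\<^sup>2"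
        using e by (intro path) auto
      then have "ln (g (u0 - e) * g (u0 + e)) \<le> ln ((Psi TYPE('a) (cosh \<eta> * exp y))\<^sup>2)"
        using gpos[OF rng(1,2)] gpos[OF rng(3,4)] by (intro ln_mono) auto
      then show ?thesis
        using gpos[OF rng(1,2)] gpos[OF rng(3,4)] Psi_pos[of "cosh \<eta> * exp y", where ?'a = 'a]
        by (simp add: s_def G_def ln_mult ln_realpow exp_add)
    qed
    show "s u0 + p * (u - u0) + P / 2 * (u - u0)\<^sup>2 \<le> s u" if "\<bar>u - u0\<bar> < min r' (min u0 (1 - u0))" for u
      using low(3) that by simp
    show "0 < P + (2 / real ?n - N / (real ?n)\<^sup>2) * p\<^sup>2" using low(2) unfolding q .
  qed (use N in auto)
qed

lemma sigma_concave_compact_null: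
  fixes K L :: "'a set"
  assumes L: "compact L" "convex L" "symmetric_set L" "L \<noteq> {}" and zK: "0 \<in> K" and K: "gamma_n K = 0"
    and posL: "0 < gamma_n L" and t: "0 < t" "t < 1" and meas: "minkowski_comb t K L \<in> sets lebesgue"
  shows "t * \<sigma> (gamma_n K) + (1 - t) * \<sigma> (gamma_n L) \<le> \<sigma> (gamma_n (minkowski_comb t K L))"
proof -
  let ?n = "DIM('a)"
  have zL: "0 \<in> L" by (rule symmetric_convex_zero[OF L(2-4)])
  define S where "S c = (\<lambda>x. c *\<^sub>R x) ` L" for c :: real
  have S: "compact (S c)" "convex (S c)" "symmetric_set (S c)" "S c \<noteq> {}" for c
    using L by (auto simp: S_def compact_scaling convex_scaling intro!: symmetric_setI dest: symmetric_setD) (metis image_eqI scaleR_minus_right symmetric_setD)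
  have Sb: "S c \<in> sets borel" for c using S(1) by (intro borel_closed compact_imp_closed)
  have Lb: "L \<in> sets borel" using L(1) by (intro borel_closed compact_imp_closed)
  have S_pos: "0 < gamma_n (S c)" if c: "0 < c" "c \<le> 1" for c
  proof -
    have "c ^ ?n * gset L \<le> gset (S c)" by (rule gset_dilate_ge[OF Lb Sb]) (use c in \<open>auto simp: S_def\<close>)
    moreover have "0 < gset L" using posL unfolding gamma_n_eq_gset[OF Lb] by (simp add: zero_less_mult_iff)
    ultimately show ?thesis unfolding gamma_n_eq_gset[OF Sb] using c
      by (intro mult_pos_pos) (auto intro: less_le_trans[of 0 "c ^ ?n * gset L"])
  qed
  have "t * \<sigma> 0 + (1 - t) * \<sigma> (gamma_n L) \<le> \<sigma> (gamma_n (S (1 - t)))"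
  proof (rule tendsto_lowerbound)
    let ?e = "\<lambda>j. 1 / real (Suc j)"
    \<comment> \<open>The ratio of (1 - t + t e) to (1 - t), tending to 1: it compares the enlarged
      dilate of \<open>L\<close> with \<open>S (1 - t)\<close>, where \<sigma> is
      continuous.\<close>
    let ?c = "\<lambda>j. (1 - t + t * ?e j) / (1 - t)"
    have "((\<lambda>j. ?c j ^ ?n * gamma_n (S (1 - t))) \<longlonglongrightarrow> ((1 - t + t * 0) / (1 - t)) ^ ?n * gamma_n (S (1 - t)))"
      by (intro tendsto_intros LIMSEQ_Suc[OF lim_1_over_n]) (use t in auto)
    then have lim: "(\<lambda>j. ?c j ^ ?n * gamma_n (S (1 - t))) \<longlonglongrightarrow> gamma_n (S (1 - t))" using t by simp
    have lt1: "gamma_n (S (1 - t)) < 1" by (rule gamma_n_compact_less_1[OF S(1)])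
    show "(\<lambda>j. \<sigma> (?c j ^ ?n * gamma_n (S (1 - t)))) \<longlonglongrightarrow> \<sigma> (gamma_n (S (1 - t)))"
      by (rule sigma_tendsto[OF S_pos lt1 lim]) (use t in auto)
    have "eventually (\<lambda>j. ?c j ^ ?n * gamma_n (S (1 - t)) < 1) sequentially" by (rule order_tendstoD(2)[OF lim lt1])
    then show "eventually (\<lambda>j. t * \<sigma> 0 + (1 - t) * \<sigma> (gamma_n L) \<le> \<sigma> (?c j ^ ?n * gamma_n (S (1 - t)))) sequentially"
    proof eventually_elim
      case (elim j)
      have e: "0 < ?e j" "?e j \<le> 1" by auto
      have c1: "1 \<le> ?c j" using t by (simp add: le_divide_eq)
      have sub: "minkowski_comb t (S (?e j)) L \<subseteq> S (1 - t + t * ?e j)"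
      proof
        fix x assume "x \<in> minkowski_comb t (S (?e j)) L"
        then obtain a b where ab: "a \<in> L" "b \<in> L" "x = (t * ?e j) *\<^sub>R a + (1 - t) *\<^sub>R b" by (auto simp: minkowski_comb_def S_def)
        have "0 \<le> t * ?e j" using t e by simp
        then obtain z where z: "z \<in> L" "x = (t * ?e j + (1 - t)) *\<^sub>R z"
          using convex_combine[OF L(2) ab(1,2), of "t * ?e j" "1 - t"] t ab(3) by auto
        have "x = (1 - t + t * ?e j) *\<^sub>R z" unfolding z(2) by (simp only: add.commute)
        then show "x \<in> S (1 - t + t * ?e j)" unfolding S_def using z(1) by (rule image_eqI)
      qed
      have "gset (S (1 - t + t * ?e j)) \<le> ?c j ^ ?n * gset (S (1 - t))"
      proof (rule gset_dilate_le[OF Sb Sb _ _ c1])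
        have "1 - t \<noteq> 0" using t by simp
        moreover have "1 - t + t * ?e j \<noteq> 0" using t e by (simp add: add_pos_pos less_imp_neq[symmetric])
        ultimately show "?c j *\<^sub>R x \<in> S (1 - t + t * ?e j) \<longleftrightarrow> x \<in> S (1 - t)" for x
        proof (intro iffI)
          assume nz: "1 - t \<noteq> 0" "1 - t + t * ?e j \<noteq> 0"
          { assume "?c j *\<^sub>R x \<in> S (1 - t + t * ?e j)"
            then obtain z where z: "z \<in> L" "?c j *\<^sub>R x = (1 - t + t * ?e j) *\<^sub>R z" by (auto simp: S_def)
            have "(1 - t + t * ?e j) *\<^sub>R x = (1 - t) *\<^sub>R (?c j *\<^sub>R x)" using nz(1) by simp
            also have "\<dots> = (1 - t + t * ?e j) *\<^sub>R ((1 - t) *\<^sub>R z)" unfolding z(2) by (simp only: scaleR_scaleR mult.commute)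
            finally have "x = (1 - t) *\<^sub>R z" using nz(2) by (simp only: scaleR_cancel_left) simp
            then show "x \<in> S (1 - t)" unfolding S_def using z(1) by (rule image_eqI) }
          { assume "x \<in> S (1 - t)"
            then obtain z where z: "z \<in> L" "x = (1 - t) *\<^sub>R z" by (auto simp: S_def)
            have "?c j *\<^sub>R x = (1 - t + t * ?e j) *\<^sub>R z" unfolding z(2) using nz(1) by simp
            then show "?c j *\<^sub>R x \<in> S (1 - t + t * ?e j)" using z(1) unfolding S_def by (intro image_eqI) }
        qed
      qed (use c1 in auto)
      then have "gamma_n (S (1 - t + t * ?e j)) \<le> ?c j ^ ?n * gamma_n (S (1 - t))"
        unfolding gamma_n_eq_gset[OF Sb] by (simp add: mult.left_commute mult_left_mono)
      then have "gamma_n (minkowski_comb t (S (?e j)) L) \<le> ?c j ^ ?n * gamma_n (S (1 - t))"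
        using gamma_n_mono[OF sub convex_gamma_n(1)[OF S(2)]] by linarith
      then have "\<sigma> (gamma_n (minkowski_comb t (S (?e j)) L)) \<le> \<sigma> (?c j ^ ?n * gamma_n (S (1 - t)))"
        using elim by (intro sigma_mono gamma_n_bounds) auto
      moreover have "t * \<sigma> (gamma_n (S (?e j))) + (1 - t) * \<sigma> (gamma_n L) \<le> \<sigma> (gamma_n (minkowski_comb t (S (?e j)) L))"
        by (rule sigma_concave_compact_pos[OF S L S_pos[OF e] posL t])
      moreover have "t * \<sigma> 0 \<le> t * \<sigma> (gamma_n (S (?e j)))"
        using t gamma_n_bounds by (intro mult_left_mono sigma_mono) auto
      ultimately show ?case by linarith
    qed
  qed simp
  also have "\<dots> \<le> \<sigma> (gamma_n (minkowski_comb t K L))"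
  proof (intro sigma_mono gamma_n_bounds gamma_n_mono meas subsetI)
    fix x assume "x \<in> S (1 - t)"
    then obtain z where "z \<in> L" "x = t *\<^sub>R 0 + (1 - t) *\<^sub>R z" by (auto simp: S_def)
    then show "x \<in> minkowski_comb t K L" using zK unfolding minkowski_comb_def by blast
  qed
  finally show ?thesis by (simp add: K)
qed

lemma sigma_concave_compact:
  fixes K L :: "'a set"
  assumes K: "compact K" "convex K" "symmetric_set K" "K \<noteq> {}" and L: "compact L" "convex L" "symmetric_set L" "L \<noteq> {}"
    and t: "0 < t" "t < 1"
  shows "t * \<sigma> (gamma_n K) + (1 - t) * \<sigma> (gamma_n L) \<le> \<sigma> (gamma_n (minkowski_comb t K L))"
proof -
  have cv: "convex (minkowski_comb t K L)" using minkowski_comb_body(2)[OF K L] t by simp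
  have zero: "0 \<in> K" "0 \<in> L" using symmetric_convex_zero K L by auto
  have g: "0 \<le> gamma_n K" "0 \<le> gamma_n L" by (rule gamma_n_bounds)+
  show ?thesis
  proof (cases "gamma_n K = 0")
    case True
    show ?thesis
    proof (cases "gamma_n L = 0")
      case L0: True
      have "t * \<sigma> 0 + (1 - t) * \<sigma> 0 = \<sigma> 0" by (simp add: algebra_simps)
      also have "\<dots> \<le> \<sigma> (gamma_n (minkowski_comb t K L))" by (intro sigma_mono gamma_n_bounds) auto
      finally show ?thesis unfolding True L0 .
    next
      case False
      then show ?thesis
        using sigma_concave_compact_null[OF L zero(1) True _ t convex_gamma_n(1)[OF cv]] g by simp
    qed
  next
    case False
    show ?thesis
    proof (cases "gamma_n L = 0")
      case True
      have "(1 - t) * \<sigma> (gamma_n L) + (1 - (1 - t)) * \<sigma> (gamma_n K) \<le> \<sigma> (gamma_n (minkowski_comb (1 - t) L K))"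
        by (rule sigma_concave_compact_null[OF K zero(2) True])
           (use False g t convex_gamma_n(1)[OF cv] in \<open>auto simp: minkowski_comb_swap[of t K L]\<close>)
      then show ?thesis unfolding minkowski_comb_swap[of t K L] by (simp add: add.commute)
    qed (use False g in \<open>intro sigma_concave_compact_pos[OF K L _ _ t], auto\<close>)
  qed
qed

section \<open>Removal of compactness\<close>

lemma gamma_n_truncation:
  fixes K :: "'a set"
  assumes K: "convex K"
  shows "(\<lambda>j. gamma_n (closure K \<inter> cball 0 (real j))) \<longlonglongrightarrow> gamma_n K"
proof -
  have "(\<lambda>j. gamma_n (closure K \<inter> cball 0 (real j))) \<longlonglongrightarrow> gamma_n (closure K)"
  proof (rule gamma_n_tendsto)
    fix x :: 'a
    obtain N where "norm x \<le> real N" using real_arch_simple by blast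
    then have "eventually (\<lambda>j. indicator (closure K \<inter> cball 0 (real j)) x = (indicator (closure K) x :: real)) sequentially"
      by (auto simp: eventually_sequentially indicator_def intro!: exI[of _ N])
    then show "(\<lambda>j. indicator (closure K \<inter> cball 0 (real j)) x :: real) \<longlonglongrightarrow> indicator (closure K) x"
      by (rule tendsto_eventually)
  qed auto
  then show ?thesis by (simp add: convex_gamma_n(2)[OF K])
qed

text \<open>Inside the open interval \<sigma> is continuous; at measure 0 all truncations are null,
  so a jump of \<sigma> at 0 does no harm. A jump at 1 is excluded by the hypothesis.\<close>

lemma sigma_gamma_n_truncation:
  fixes K :: "'a set"
  assumes K: "convex K" and less: "gamma_n K < 1"
  shows "(\<lambda>j. \<sigma> (gamma_n (closure K \<inter> cball 0 (real j)))) \<longlonglongrightarrow> \<sigma> (gamma_n K)"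
proof (cases "gamma_n K = 0")
  case True
  have "gamma_n (closure K \<inter> cball 0 (real j)) = 0" for j
  proof -
    have "gamma_n (closure K \<inter> cball 0 (real j)) \<le> gamma_n (closure K)" by (intro gamma_n_mono) auto
    then show ?thesis using gamma_n_bounds(1)[of "closure K \<inter> cball 0 (real j)"] convex_gamma_n(2)[OF K] True by simp
  qed
  then show ?thesis using True by simp
next
  case False
  then have "0 < gamma_n K" using gamma_n_bounds(1)[of K] by simp
  then show ?thesis by (rule sigma_tendsto[OF _ less gamma_n_truncation[OF K]])
qed

lemma sigma_concave:
  fixes K L :: "'a set"
  assumes K: "convex K" "symmetric_set K" "K \<noteq> {}" and L: "convex L" "symmetric_set L" "L \<noteq> {}"
    and t: "0 < t" "t < 1"
  shows "t * \<sigma> (gamma_n K) + (1 - t) * \<sigma> (gamma_n L) \<le> \<sigma> (gamma_n (minkowski_comb t K L))"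
proof -
  \<comment> \<open>For measure 1, where truncation could miss a jump of \<sigma>: one summand is
    then the whole space, and so is the combination.\<close>
  have full: "t * \<sigma> (gamma_n K) + (1 - t) * \<sigma> (gamma_n L) \<le> \<sigma> (gamma_n (minkowski_comb t K L))"
    if "minkowski_comb t K L = UNIV"
  proof -
    have "t * \<sigma> (gamma_n K) + (1 - t) * \<sigma> (gamma_n L) \<le> t * \<sigma> 1 + (1 - t) * \<sigma> 1"
      using t gamma_n_bounds by (intro add_mono mult_left_mono sigma_mono) auto
    also have "\<dots> = \<sigma> 1" by (simp add: algebra_simps)
    finally show ?thesis using that by (simp add: gamma_n_UNIV)
  qed
  consider "gamma_n K = 1" | "gamma_n L = 1" | "gamma_n K < 1" "gamma_n L < 1"
    using gamma_n_bounds(2)[of K] gamma_n_bounds(2)[of L] by linarith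
  then show ?thesis
  proof cases
    case 1
    then have KU: "K = UNIV" by (rule gamma_n_eq_1_imp_UNIV[OF K(1)])
    obtain l where l: "l \<in> L" using L by blast
    have "x = t *\<^sub>R ((1 / t) *\<^sub>R (x - (1 - t) *\<^sub>R l)) + (1 - t) *\<^sub>R l" for x using t by simp
    then have "x \<in> minkowski_comb t K L" for x unfolding minkowski_comb_def KU using l by blast
    then show ?thesis by (intro full) auto
  next
    case 2
    then have LU: "L = UNIV" by (rule gamma_n_eq_1_imp_UNIV[OF L(1)])
    obtain k where k: "k \<in> K" using K by blast
    have "x = t *\<^sub>R k + (1 - t) *\<^sub>R ((1 / (1 - t)) *\<^sub>R (x - t *\<^sub>R k))" for x using t by simp
    then have "x \<in> minkowski_comb t K L" for x unfolding minkowski_comb_def LU using k by blast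
    then show ?thesis by (intro full) auto
  next
    case 3
    have body: "compact (closure M \<inter> cball 0 (real j))" "convex (closure M \<inter> cball 0 (real j))"
      "symmetric_set (closure M \<inter> cball 0 (real j))" "closure M \<inter> cball 0 (real j) \<noteq> {}"
      if M: "convex M" "symmetric_set M" "M \<noteq> {}" for M :: "'a set" and j
    proof -
      show "compact (closure M \<inter> cball 0 (real j))" by (simp add: closed_Int_compact)
      show "convex (closure M \<inter> cball 0 (real j))" using M(1) by (simp add: convex_Int convex_closure)
      have neg: "- x \<in> closure M" if x: "x \<in> closure M" for x
      proof -
        obtain A where A: "\<And>n. A n \<in> M" "A \<longlonglongrightarrow> x" using x unfolding closure_sequential by blast
        have "- A n \<in> M" for n by (rule symmetric_setD[OF M(2) A(1)])
        moreover have "(\<lambda>n. - A n) \<longlonglongrightarrow> - x" by (intro tendsto_intros A)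
        ultimately show ?thesis unfolding closure_sequential by (intro exI[of _ "\<lambda>n. - A n"]) simp
      qed
      show "symmetric_set (closure M \<inter> cball 0 (real j))"
      proof (rule symmetric_setI)
        fix x assume x: "x \<in> closure M \<inter> cball 0 (real j)"
        then have "- x \<in> closure M" using neg by blast
        then show "- x \<in> closure M \<inter> cball 0 (real j)" using x by simp
      qed
      have "0 \<in> closure M" using symmetric_convex_zero[OF M] closure_subset by blast
      then show "closure M \<inter> cball 0 (real j) \<noteq> {}" by auto
    qed
    have sums: "convex {x + y | x y. x \<in> (\<lambda>x. t *\<^sub>R x) ` K \<and> y \<in> (\<lambda>x. (1 - t) *\<^sub>R x) ` L}"
      using convex_sums[OF convex_scaling[OF K(1), of t] convex_scaling[OF L(1), of "1 - t"]]
      by (rule back_subst[of convex]) blast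
    moreover have "minkowski_comb t K L = {x + y | x y. x \<in> (\<lambda>x. t *\<^sub>R x) ` K \<and> y \<in> (\<lambda>x. (1 - t) *\<^sub>R x) ` L}"
      unfolding minkowski_comb_def by blast
    ultimately have cv: "convex (minkowski_comb t K L)" by simp
    \<comment> \<open>The combination of closures may exceed that of the sets themselves, but only
      within its closure, which for a convex set has the same measure.\<close>
    have sub: "minkowski_comb t (closure K \<inter> cball 0 (real j)) (closure L \<inter> cball 0 (real j)) \<subseteq> closure (minkowski_comb t K L)" for j
    proof
      fix x assume "x \<in> minkowski_comb t (closure K \<inter> cball 0 (real j)) (closure L \<inter> cball 0 (real j))"
      then obtain a b where ab: "a \<in> closure K" "b \<in> closure L" "x = t *\<^sub>R a + (1 - t) *\<^sub>R b"
        unfolding minkowski_comb_def by blast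
      obtain A where A: "\<And>n. A n \<in> K" "A \<longlonglongrightarrow> a" using ab(1) unfolding closure_sequential by blast
      obtain B where B: "\<And>n. B n \<in> L" "B \<longlonglongrightarrow> b" using ab(2) unfolding closure_sequential by blast
      have "(\<lambda>n. t *\<^sub>R A n + (1 - t) *\<^sub>R B n) \<longlonglongrightarrow> x" unfolding ab(3) by (intro tendsto_intros A B)
      moreover have "t *\<^sub>R A n + (1 - t) *\<^sub>R B n \<in> minkowski_comb t K L" for n
        using A(1) B(1) unfolding minkowski_comb_def by blast
      ultimately show "x \<in> closure (minkowski_comb t K L)"
        unfolding closure_sequential by (intro exI[of _ "\<lambda>n. t *\<^sub>R A n + (1 - t) *\<^sub>R B n"]) simp
    qed
    have step: "t * \<sigma> (gamma_n (closure K \<inter> cball 0 (real j))) + (1 - t) * \<sigma> (gamma_n (closure L \<inter> cball 0 (real j)))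
      \<le> \<sigma> (gamma_n (minkowski_comb t K L))" for j
    proof -
      have "gamma_n (minkowski_comb t (closure K \<inter> cball 0 (real j)) (closure L \<inter> cball 0 (real j))) \<le> gamma_n (minkowski_comb t K L)"
        using gamma_n_mono[OF sub[of j]] convex_gamma_n(2)[OF cv] by simp
      then have "\<sigma> (gamma_n (minkowski_comb t (closure K \<inter> cball 0 (real j)) (closure L \<inter> cball 0 (real j)))) \<le> \<sigma> (gamma_n (minkowski_comb t K L))"
        by (intro sigma_mono gamma_n_bounds)
      with sigma_concave_compact[OF body[OF K] body[OF L] t, of j j] show ?thesis by linarith
    qed
    show ?thesis
    proof (rule LIMSEQ_le_const2)
      show "(\<lambda>j. t * \<sigma> (gamma_n (closure K \<inter> cball 0 (real j))) + (1 - t) * \<sigma> (gamma_n (closure L \<inter> cball 0 (real j))))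
        \<longlonglongrightarrow> t * \<sigma> (gamma_n K) + (1 - t) * \<sigma> (gamma_n L)"
        by (intro tendsto_intros sigma_gamma_n_truncation K L 3)
    qed (use step in blast)
  qed
qed

end

theorem theorem1p5:
  fixes \<sigma> \<sigma>' \<sigma>'' :: "real \<Rightarrow> real"
    and K L :: "'a::euclidean_space set"
    and t :: real
  assumes mono: "strict_mono_on {0..1} \<sigma>"
    and d1: "\<And>x. x \<in> {0<..<1} \<Longrightarrow> (\<sigma> has_real_derivative \<sigma>' x) (at x)"
    and d2: "\<And>x. x \<in> {0<..<1} \<Longrightarrow> (\<sigma>' has_real_derivative \<sigma>'' x) (at x)"
    and pos: "\<And>x. x \<in> {0<..<1} \<Longrightarrow> \<sigma>' x > 0"
    and ode: "\<And>r. r > 0 \<Longrightarrow>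
       1 + \<sigma>'' (Psi TYPE('a) r) * Psi TYPE('a) r / \<sigma>' (Psi TYPE('a) r)
         = 2 / real DIM('a)
           - c_const DIM('a) / ((real DIM('a))\<^sup>2 * Psi TYPE('a) r) * r ^ DIM('a) * exp (- r\<^sup>2 / 2)"
    and K: "convex K" "symmetric_set K" "K \<noteq> {}"
    and L: "convex L" "symmetric_set L" "L \<noteq> {}"
    and t: "0 < t" "t < 1"
  shows "\<sigma> (gamma_n (minkowski_comb t K L)) \<ge> t * \<sigma> (gamma_n K) + (1 - t) * \<sigma> (gamma_n L)"
  using sigma_concave[OF mono d1 d2 pos ode K L t] by simp

end
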